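(* Let $n\geqslant2$, $\delta\in\mathbb C$, and let $\Delta$ be the linear operator on $\mathbb C[\mathfrak b(\mathcal A)]_n$ defined by $A_n\,e_\zeta=e_{\Delta(\zeta)}$ for all monic monomials $\zeta\in\mathbb C[\mathfrak b(\mathcal A)]_n$. Then $$\Delta=\tfrac12\,\tau\circ\partial^2 .$$
   Context: Brauer algebra: $B_n(\delta)$ has as basis the perfect matchings (diagrams) of $n$ upper and $n$ lower nodes; $b_1b_2$ is computed by placing $b_1$ below $b_2$, identifying the upper nodes of $b_1$ with the lower nodes of $b_2$, and replacing each closed loop by a factor $\delta$. Lines joining nodes in the same row are arcs, the others are vertical lines; diagrams without arcs form $\mathfrak S_n$. $d_{ij}$ has an arc joining upper nodes $i,j$, an arc joining lower nodes $i,j$, and vertical lines elsewhere; $A_n=\sum_{i<j}d_{ij}$. For a diagram $b$, $\gamma_b=\sum_{s\in\mathfrak S_n}sbs^{-1}$. $C_n(\delta)$ is the span of all $\gamma_b$; it is the centraliser of $\mathbb C\mathfrak S_n$ in $B_n(\delta)$. Bracelets: let $\mathcal A=\{\mathbf n,\mathbf s,\mathbf p\}$. A bracelet $[w]$ is the class of a non-empty word $w$ modulo cyclic permutations and reversal; $I(w)$ is the reversed word; $|w|$ is the length; $|w|_{\mathbf a}$ the number of occurrences of the letter $\mathbf a$. $\mathfrak b(\mathcal A)$ is the set of bracelets over $\mathcal A$ with equally many $\mathbf n$ and $\mathbf s$ (possibly $0$) in which, going around the cycle, the letters $\mathbf n$ and $\mathbf s$ alternate (between any two $\mathbf n$ there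 is an $\mathbf s$, and vice versa). $\mathbb C[\mathfrak b(\mathcal A)]$ is the polynomial algebra in the elements of $\mathfrak b(\mathcal A)$, graded by $\deg([w_1]\cdots[w_r])=|w_1|+\dots+|w_r|$; $\mathbb C[\mathfrak b(\mathcal A)]_n$ is the degree-$n$ part. For a diagram $b\in B_n(\delta)$, label upper arcs by $\mathbf n$, lower arcs by $\mathbf s$, vertical lines by $\mathbf p$; identifying each upper node with the lower node below it yields closed loops, each read as a bracelet $[w_k]\in\mathfrak b(\mathcal A)$; the monomial $[w_1]\cdots[w_r]$ depends only on the $\mathfrak S_n$-conjugacy class of $b$, and this gives a bijection between conjugacy classes of diagrams and monic monomials of degree $n$. For the monic monomial $\zeta$ corresponding to $b$ put $e_\zeta=\gamma_b$; the $e_\zeta$ form a basis of $C_n(\delta)$, and $\zeta\mapsto e_\zeta$ is extended linearly to $\mathbb C[\mathfrak b(\mathcal A)]_n$. Derivation: let $\bar{\mathcal A}=\mathcal A\cup\{\dot{\mathbf s},\dot{\mathbf p},\ddot{\mathbf s}\}$, and let $\mathfrak b(\bar{\mathcal A})$ be the set of all bracelets obtained from those of $\mathfrak b(\mathcal A)$ by replacing some (possibly no) letters $\mathbf s$ by $\dot{\mathbf s}$ or $\ddot{\mathbf s}$ and some letters $\mathbf p$ by $\dot{\mathbf p}$. $\partial$ is the linear derivation of $\mathbb C[\mathfrak b(\bar{\mathcal A})]$ acting by the Leibniz rule on products of bracelets and, inside a bracelet, letter by letter, $\partial[\mathbf a_1\dots\mathbf a_\ell]=\sum_j[\mathbf a_1\dots\partial(\mathbf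 a_j)\dots\mathbf a_\ell]$, with $\partial\mathbf s=\dot{\mathbf s}$, $\partial\mathbf p=\dot{\mathbf p}$, $\partial\dot{\mathbf s}=\ddot{\mathbf s}$, $\partial\mathbf n=\partial\dot{\mathbf p}=\partial\ddot{\mathbf s}=0$ (a bracelet containing $0$ is $0$). $\mathbb C[\mathfrak b(\bar{\mathcal A})]''$ is the span of monomials with exactly two dots in total. Trace: a word $w$ over $\mathcal A$ is called fit if it is empty, or if $[w]\in\mathfrak b(\mathcal A)$ and each occurrence of $\mathbf s$ in $w$ (if any) is followed by an occurrence of $\mathbf n$ somewhere to its right. $\tau:\mathbb C[\mathfrak b(\bar{\mathcal A})]''\to\mathbb C[\mathfrak b(\mathcal A)]$ is the $\mathbb C[\mathfrak b(\mathcal A)]$-linear map determined by the following rules, where $u,v$ are (possibly empty) words over $\mathcal A$, and each word directly following a $\dot{\mathbf p}$ is assumed fit unless specified otherwise: $[\ddot{\mathbf s}u]\mapsto2\delta[\mathbf su]$; $[\dot{\mathbf s}u\dot{\mathbf s}v]\mapsto2([\mathbf su\mathbf sI(v)]+[\mathbf su][\mathbf sv])$; $[\dot{\mathbf s}u][\dot{\mathbf s}v]\mapsto2([\mathbf su\mathbf sv]+[\mathbf su\mathbf sI(v)])$; $[\dot{\mathbf p}u\dot{\mathbf s}v]\mapsto[\mathbf pu\mathbf sI(v)]+[\mathbf pu][\mathbf sv]$; $[\dot{\mathbf p}u][\dot{\mathbf s}v]\mapsto[\mathbf pu\mathbf sv]+[\mathbf pu\mathbf sI(v)]$; $[\dot{\mathbf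 p}u\dot{\mathbf p}v]\mapsto[\mathbf nu\mathbf sI(v)]$ if $u,v$ are fit, and $\mapsto[\mathbf nu][\mathbf sv]$ if $|u|_{\mathbf s}>|u|_{\mathbf n}$; $[\dot{\mathbf p}u][\dot{\mathbf p}v]\mapsto[\mathbf nu\mathbf sI(v)]$. (These rules determine $\tau$ unambiguously.) *)

theory Defs
  imports
    Complex_Main
    "HOL-Library.Multiset"
    "HOL-Library.Poly_Mapping"
    "HOL-Combinatorics.Permutations"
begin

section \<open>Linear combinations\<close>

text \<open>Formal complex linear combinations of elements of \<^typ>\<open>'a\<close> are elements of
  \<^typ>\<open>'a \<Rightarrow>\<^sub>0 complex\<close>.\<close>

definition cscale :: "complex \<Rightarrow> ('a \<Rightarrow>\<^sub>0 complex) \<Rightarrow> ('a \<Rightarrow>\<^sub>0 complex)" where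
  "cscale c f = Poly_Mapping.map ((*) c) f"

definition lin_ext :: "('a \<Rightarrow> ('b \<Rightarrow>\<^sub>0 complex)) \<Rightarrow> ('a \<Rightarrow>\<^sub>0 complex) \<Rightarrow> ('b \<Rightarrow>\<^sub>0 complex)" where
  "lin_ext g f = (\<Sum>m\<in>Poly_Mapping.keys f. cscale (Poly_Mapping.lookup f m) (g m))"


section \<open>The Brauer algebra\<close>

text \<open>The nodes in each row are numbered from \<open>0\<close> to \<open>n - 1\<close>; a diagram is the set of its lines,
  each line being the two-element set of its endpoints.\<close>

datatype node = Up nat | Lo nat

type_synonym diagram = "node set set"

definition nodes :: "nat \<Rightarrow> node set" where
  "nodes n = Up ` {..<n} \<union> Lo ` {..<n}"

definition diagrams :: "nat \<Rightarrow> diagram set" where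
  "diagrams n = {b. (\<forall>e\<in>b. e \<subseteq> nodes n \<and> card e = 2) \<and> (\<forall>x\<in>nodes n. \<exists>!e. e \<in> b \<and> x \<in> e)}"

text \<open>Vertex sets of the connected components of the graph with vertices \<open>V\<close> and edges \<open>E\<close>
  (an edge is the set of its endpoints, so a loop is a singleton).\<close>

definition components :: "'v set \<Rightarrow> 'v set set \<Rightarrow> 'v set set" where
  "components V E = V // {(x, y). {x, y} \<in> E}\<^sup>*"

text \<open>To multiply, \<open>b\<^sub>1\<close> is placed below \<open>b\<^sub>2\<close>: the upper nodes of \<open>b\<^sub>1\<close> and the lower nodes of
  \<open>b\<^sub>2\<close> become the middle row.\<close>

datatype stacked_node = Top nat | Mid nat | Bot nat

primrec place_below :: "node \<Rightarrow> stacked_node" where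
  "place_below (Up i) = Mid i"
| "place_below (Lo i) = Bot i"

primrec place_above :: "node \<Rightarrow> stacked_node" where
  "place_above (Up i) = Top i"
| "place_above (Lo i) = Mid i"

primrec outer :: "node \<Rightarrow> stacked_node" where
  "outer (Up i) = Top i"
| "outer (Lo i) = Bot i"

definition stacked_components :: "nat \<Rightarrow> diagram \<Rightarrow> diagram \<Rightarrow> stacked_node set set" where
  "stacked_components n b1 b2 =
     components (Top ` {..<n} \<union> Mid ` {..<n} \<union> Bot ` {..<n})
       ((\<lambda>e. place_below ` e) ` b1 \<union> (\<lambda>e. place_above ` e) ` b2)"

definition diagram_compose :: "nat \<Rightarrow> diagram \<Rightarrow> diagram \<Rightarrow> diagram" where
  "diagram_compose n b1 b2 = {outer -` C | C. C \<in> stacked_components n b1 b2 \<and> outer -` C \<noteq> {}}"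

definition closed_loops :: "nat \<Rightarrow> diagram \<Rightarrow> diagram \<Rightarrow> nat" where
  "closed_loops n b1 b2 = card {C \<in> stacked_components n b1 b2. C \<subseteq> Mid ` {..<n}}"

type_synonym brauer = "diagram \<Rightarrow>\<^sub>0 complex"

definition brauer_mult :: "nat \<Rightarrow> complex \<Rightarrow> brauer \<Rightarrow> brauer \<Rightarrow> brauer" where
  "brauer_mult n \<delta> f g =
     lin_ext (\<lambda>b1. lin_ext (\<lambda>b2. Poly_Mapping.single (diagram_compose n b1 b2) (\<delta> ^ closed_loops n b1 b2)) g) f"

definition dgr :: "diagram \<Rightarrow> brauer" where
  "dgr b = Poly_Mapping.single b 1"

text \<open>With the stacking convention above, \<open>\<sigma> \<mapsto> perm_diagram n \<sigma>\<close> is multiplicative.\<close>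

definition perm_diagram :: "nat \<Rightarrow> (nat \<Rightarrow> nat) \<Rightarrow> diagram" where
  "perm_diagram n \<sigma> = {{Up i, Lo (\<sigma> i)} | i. i < n}"

definition d_diagram :: "nat \<Rightarrow> nat \<Rightarrow> nat \<Rightarrow> diagram" where
  "d_diagram n i j =
     {{Up i, Up j}, {Lo i, Lo j}} \<union> {{Up k, Lo k} | k. k < n \<and> k \<noteq> i \<and> k \<noteq> j}"

definition A_elt :: "nat \<Rightarrow> brauer" where
  "A_elt n = (\<Sum>j<n. \<Sum>i<j. dgr (d_diagram n i j))"

definition gamma_elt :: "nat \<Rightarrow> complex \<Rightarrow> diagram \<Rightarrow> brauer" where
  "gamma_elt n \<delta> b =
     (\<Sum>\<sigma> | \<sigma> permutes {..<n}.
        brauer_mult n \<delta> (brauer_mult n \<delta> (dgr (perm_diagram n \<sigma>)) (dgr b))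
          (dgr (perm_diagram n (inv \<sigma>))))"


section \<open>Bracelets\<close>

definition bracelet_equiv :: "'a list \<Rightarrow> 'a list \<Rightarrow> bool" where
  "bracelet_equiv w w' \<longleftrightarrow> (\<exists>k. w' = rotate k w \<or> w' = rotate k (rev w))"

lemma rotate_complement: "rotate (length w - k mod length w) (rotate k w) = w"
proof (cases "w = []")
  case False
  let ?l = "length w"
  have "?l - k mod ?l + k mod ?l = ?l"
    using False by (intro le_add_diff_inverse2) (simp add: less_imp_le_nat)
  then have "rotate (?l - k mod ?l) (rotate (k mod ?l) w) = w"
    by (simp only: rotate_rotate) simp
  then show ?thesis by (simp flip: rotate_conv_mod)
qed simp

lemma rotate_inverse: "\<exists>k'. rotate k' (rotate k w) = w"
  using rotate_complement by blast

lemma rev_rotate_ex: "\<exists>k'. rev (rotate k w) = rotate k' (rev w)"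
proof -
  have "rotate k (rev (rotate k w)) = rev w"
    by (simp add: rotate_rev rotate_complement del: rotate_rotate)
  then show ?thesis by (metis rotate_inverse)
qed

lemma equivp_bracelet_equiv: "equivp (bracelet_equiv :: 'a list \<Rightarrow> _)"
proof (rule equivpI)
  show "reflp (bracelet_equiv :: 'a list \<Rightarrow> _)"
    by (auto simp: reflp_def bracelet_equiv_def intro: exI[of _ 0])
  show "symp (bracelet_equiv :: 'a list \<Rightarrow> _)"
    unfolding symp_def bracelet_equiv_def by (metis rotate_inverse rev_rotate_ex rev_rev_ident)
  show "transp (bracelet_equiv :: 'a list \<Rightarrow> _)"
    unfolding transp_def bracelet_equiv_def
    by (metis rotate_rotate rev_rotate_ex rev_rev_ident)
qed

text \<open>The class of the empty word is an element of this type, but not a bracelet; it is excluded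
  from the set \<open>frakb\<close> below.\<close>

quotient_type 'a bracelet = "'a list" / bracelet_equiv
  morphisms rep_bracelet bracelet
  by (rule equivp_bracelet_equiv)

lemma bracelet_equiv_rotate1I:
  assumes "\<And>w. f (rotate1 w) = f w" "\<And>w. f (rev w) = f w" "bracelet_equiv w w'"
  shows "f w = f w'"
proof -
  have "f (rotate k w) = f w" for k w
    by (induction k) (simp_all add: assms(1) rotate_Suc)
  then show ?thesis using assms(2,3) by (metis bracelet_equiv_def)
qed

lemma bracelet_rotate1: "bracelet (rotate1 w) = bracelet w"
proof -
  have "bracelet_equiv w (rotate1 w)"
    unfolding bracelet_equiv_def by (metis rotate_Suc rotate0 id_apply)
  then show ?thesis using bracelet.abs_eq_iff by metis
qed

lemma bracelet_rev: "bracelet (rev w) = bracelet w"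
proof -
  have "bracelet_equiv w (rev w)"
    unfolding bracelet_equiv_def by (metis rotate0 id_apply)
  then show ?thesis using bracelet.abs_eq_iff by metis
qed

lift_definition blength :: "'a bracelet \<Rightarrow> nat" is length
  by (auto simp: bracelet_equiv_def)

text \<open>The letters of the extended alphabet: \<open>Sd\<close>, \<open>Pd\<close> and \<open>Sdd\<close> are dotted \<open>S\<close>, dotted \<open>P\<close> and
  doubly dotted \<open>S\<close>. Words over the original alphabet are words over \<open>letters\<close>, so that both
  polynomial algebras live in the same type.\<close>

datatype letter = N | S | P | Sd | Pd | Sdd

definition letters :: "letter set" where
  "letters = {N, S, P}"

definition alternating :: "letter \<Rightarrow> letter \<Rightarrow> letter list \<Rightarrow> bool" where
  "alternating a c w \<longleftrightarrow>
     (\<forall>i j. i < j \<and> j < length w \<and> w ! i = a \<and> w ! j = a \<longrightarrow>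
        (\<exists>k. i < k \<and> k < j \<and> w ! k = c) \<and>
        (\<exists>k < length w. (k < i \<or> j < k) \<and> w ! k = c))"

definition frakb :: "letter bracelet set" where
  "frakb = {bracelet w | w. w \<noteq> [] \<and> set w \<subseteq> letters \<and> count_list w N = count_list w S \<and>
                             alternating N S w \<and> alternating S N w}"

primrec undot :: "letter \<Rightarrow> letter" where
  "undot N = N"
| "undot S = S"
| "undot P = P"
| "undot Sd = S"
| "undot Pd = P"
| "undot Sdd = S"

primrec dots :: "letter \<Rightarrow> nat" where
  "dots N = 0"
| "dots S = 0"
| "dots P = 0"
| "dots Sd = 1"
| "dots Pd = 1"
| "dots Sdd = 2"

definition frakb_bar :: "letter bracelet set" where
  "frakb_bar = {bracelet w | w. bracelet (map undot w) \<in> frakb}"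

lift_definition bdots :: "letter bracelet \<Rightarrow> nat" is "\<lambda>w. sum_list (map dots w)"
proof -
  fix w w' :: "letter list"
  assume "bracelet_equiv w w'"
  then show "sum_list (map dots w) = sum_list (map dots w')"
  proof (rule bracelet_equiv_rotate1I[rotated 2])
    fix w :: "letter list"
    show "sum_list (map dots (rotate1 w)) = sum_list (map dots w)"
      by (cases w) simp_all
    show "sum_list (map dots (rev w)) = sum_list (map dots w)"
      by (simp add: rev_map[symmetric])
  qed
qed


section \<open>The polynomial algebras and the derivation\<close>

text \<open>Monomials are multisets of bracelets; since multisets form an additive monoid, \<open>bpoly\<close> is
  a commutative ring with the product of polynomials.\<close>

type_synonym monomial = "letter bracelet multiset"
type_synonym bpoly = "monomial \<Rightarrow>\<^sub>0 complex"

definition br :: "letter list \<Rightarrow> bpoly" where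
  "br w = Poly_Mapping.single {#bracelet w#} 1"

definition cpoly :: "complex \<Rightarrow> bpoly" where
  "cpoly c = Poly_Mapping.single 0 c"

definition mdeg :: "monomial \<Rightarrow> nat" where
  "mdeg m = \<Sum>\<^sub># (image_mset blength m)"

definition mdots :: "monomial \<Rightarrow> nat" where
  "mdots m = \<Sum>\<^sub># (image_mset bdots m)"

definition poly_alg :: "bpoly set" where
  "poly_alg = {f. \<forall>m\<in>Poly_Mapping.keys f. set_mset m \<subseteq> frakb}"

definition poly_alg_deg :: "nat \<Rightarrow> bpoly set" where
  "poly_alg_deg n = {f \<in> poly_alg. \<forall>m\<in>Poly_Mapping.keys f. mdeg m = n}"

definition poly_bar_2 :: "bpoly set" where
  "poly_bar_2 = {f. \<forall>m\<in>Poly_Mapping.keys f. set_mset m \<subseteq> frakb_bar \<and> mdots m = 2}"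

primrec letter_deriv :: "letter \<Rightarrow> letter option" where
  "letter_deriv N = None"
| "letter_deriv S = Some Sd"
| "letter_deriv P = Some Pd"
| "letter_deriv Sd = Some Sdd"
| "letter_deriv Pd = None"
| "letter_deriv Sdd = None"

definition word_deriv :: "letter list \<Rightarrow> bpoly" where
  "word_deriv w =
     (\<Sum>j<length w. case letter_deriv (w ! j) of None \<Rightarrow> 0 | Some c \<Rightarrow> br (w[j := c]))"

lemma word_deriv_rotate1: "word_deriv (rotate1 w) = word_deriv w"
proof (cases w)
  case (Cons a v)
  let ?g = "\<lambda>w j. case letter_deriv (w ! j) of None \<Rightarrow> 0 | Some c \<Rightarrow> br (w[j := c])"
  have 1: "br (v[j := c] @ [a]) = br (a # v[j := c])" for j c
    using bracelet_rotate1[of "a # v[j := c]"] by (simp add: br_def)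
  have 2: "br (v @ [c]) = br (c # v)" for c
    using bracelet_rotate1[of "c # v"] by (simp add: br_def)
  have "word_deriv (rotate1 w) = (\<Sum>j<length v. ?g (v @ [a]) j) + ?g (v @ [a]) (length v)"
    by (simp add: word_deriv_def Cons)
  also have "(\<Sum>j<length v. ?g (v @ [a]) j) = (\<Sum>j<length v. ?g (a # v) (Suc j))"
    by (rule sum.cong) (auto simp: nth_append list_update_append 1 split: option.split)
  also have "?g (v @ [a]) (length v) = ?g (a # v) 0"
    by (auto simp: 2 split: option.split)
  finally show ?thesis
    by (simp add: word_deriv_def Cons sum.lessThan_Suc_shift add.commute del: sum.lessThan_Suc)
qed simp

lemma word_deriv_rev: "word_deriv (rev w) = word_deriv w"
proof -
  let ?g = "\<lambda>w j. case letter_deriv (w ! j) of None \<Rightarrow> 0 | Some c \<Rightarrow> br (w[j := c])"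
  have "(\<Sum>j<length w. ?g (rev w) j) = (\<Sum>j<length w. ?g (rev w) (length w - Suc j))"
    by (rule sum.nat_diff_reindex[symmetric])
  also have "\<dots> = (\<Sum>j<length w. ?g w j)"
  proof (rule sum.cong)
    fix j assume j: "j \<in> {..<length w}"
    have "br ((rev w)[length w - Suc j := c]) = br (w[j := c])" for c
    proof -
      have "(rev w)[length w - Suc j := c] = rev (w[j := c])"
        using j by (simp add: rev_update)
      then show ?thesis by (simp add: br_def bracelet_rev)
    qed
    then show "?g (rev w) (length w - Suc j) = ?g w j"
      using j by (auto simp: rev_nth split: option.split)
  qed simp
  finally show ?thesis by (simp add: word_deriv_def)
qed

lift_definition bracelet_deriv :: "letter bracelet \<Rightarrow> bpoly" is word_deriv
  by (rule bracelet_equiv_rotate1I[rotated 2])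
    (simp_all add: word_deriv_rotate1 word_deriv_rev)

definition monomial_deriv :: "monomial \<Rightarrow> bpoly" where
  "monomial_deriv m =
     (\<Sum>\<beta>\<in>#m. bracelet_deriv \<beta> * Poly_Mapping.single (m - {#\<beta>#}) 1)"

definition derivation :: "bpoly \<Rightarrow> bpoly" where
  "derivation f = lin_ext monomial_deriv f"


section \<open>The trace\<close>

definition fit :: "letter list \<Rightarrow> bool" where
  "fit w \<longleftrightarrow> w = [] \<or>
     (set w \<subseteq> letters \<and> bracelet w \<in> frakb \<and>
      (\<forall>i<length w. w ! i = S \<longrightarrow> (\<exists>j. i < j \<and> j < length w \<and> w ! j = N)))"

text \<open>\<open>tau_rule \<delta> l r\<close> is the rule sending \<open>l\<close> to \<open>r\<close>, for arbitrary words \<open>u\<close> and \<open>v\<close> over the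
  original alphabet; that \<open>l\<close> is built from bracelets in \<open>frakb_bar\<close> is required in
  \<open>is_tau\<close>. The words directly following a letter \<open>Pd\<close> are fit, except in the rule
  \<open>pp_split\<close>, where neither is.\<close>

inductive tau_rule :: "complex \<Rightarrow> bpoly \<Rightarrow> bpoly \<Rightarrow> bool" for \<delta> :: complex where
  ss_same:
    "set u \<subseteq> letters \<Longrightarrow>
     tau_rule \<delta> (br (Sdd # u)) (cpoly (2 * \<delta>) * br (S # u))"
| ss:
    "set u \<subseteq> letters \<Longrightarrow> set v \<subseteq> letters \<Longrightarrow>
     tau_rule \<delta> (br (Sd # u @ Sd # v))
       (2 * (br (S # u @ S # rev v) + br (S # u) * br (S # v)))"
| s_s:
    "set u \<subseteq> letters \<Longrightarrow> set v \<subseteq> letters \<Longrightarrow>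
     tau_rule \<delta> (br (Sd # u) * br (Sd # v))
       (2 * (br (S # u @ S # v) + br (S # u @ S # rev v)))"
| ps:
    "set u \<subseteq> letters \<Longrightarrow> set v \<subseteq> letters \<Longrightarrow> fit u \<Longrightarrow>
     tau_rule \<delta> (br (Pd # u @ Sd # v))
       (br (P # u @ S # rev v) + br (P # u) * br (S # v))"
| p_s:
    "set u \<subseteq> letters \<Longrightarrow> set v \<subseteq> letters \<Longrightarrow> fit u \<Longrightarrow>
     tau_rule \<delta> (br (Pd # u) * br (Sd # v))
       (br (P # u @ S # v) + br (P # u @ S # rev v))"
| pp_fit:
    "set u \<subseteq> letters \<Longrightarrow> set v \<subseteq> letters \<Longrightarrow> fit u \<Longrightarrow> fit v \<Longrightarrow>
     tau_rule \<delta> (br (Pd # u @ Pd # v)) (br (N # u @ S # rev v))"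
| pp_split:
    "set u \<subseteq> letters \<Longrightarrow> set v \<subseteq> letters \<Longrightarrow> count_list u S > count_list u N \<Longrightarrow>
     tau_rule \<delta> (br (Pd # u @ Pd # v)) (br (N # u) * br (S # v))"
| p_p:
    "set u \<subseteq> letters \<Longrightarrow> set v \<subseteq> letters \<Longrightarrow> fit u \<Longrightarrow> fit v \<Longrightarrow>
     tau_rule \<delta> (br (Pd # u) * br (Pd # v)) (br (N # u @ S # rev v))"

definition is_tau :: "complex \<Rightarrow> (bpoly \<Rightarrow> bpoly) \<Rightarrow> bool" where
  "is_tau \<delta> T \<longleftrightarrow>
     (\<forall>f\<in>poly_bar_2. T f \<in> poly_alg) \<and>
     (\<forall>f\<in>poly_bar_2. \<forall>g\<in>poly_bar_2. T (f + g) = T f + T g) \<and>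
     (\<forall>a\<in>poly_alg. \<forall>f\<in>poly_bar_2. T (a * f) = a * T f) \<and>
     (\<forall>l r. tau_rule \<delta> l r \<and> l \<in> poly_bar_2 \<longrightarrow> T l = r)"

text \<open>The second conjunct only makes the function unique outside the domain of the trace.\<close>

definition tau :: "complex \<Rightarrow> bpoly \<Rightarrow> bpoly" where
  "tau \<delta> = (THE T. is_tau \<delta> T \<and> (\<forall>f. f \<notin> poly_bar_2 \<longrightarrow> T f = 0))"


section \<open>From monomials to the centraliser\<close>

definition partner :: "diagram \<Rightarrow> node \<Rightarrow> node" where
  "partner b x = (THE y. y \<noteq> x \<and> {x, y} \<in> b)"

primrec flip_node :: "node \<Rightarrow> node" where
  "flip_node (Up i) = Lo i"
| "flip_node (Lo i) = Up i"

primrec is_upper :: "node \<Rightarrow> bool" where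
  "is_upper (Up i) = True"
| "is_upper (Lo i) = False"

definition line_label :: "diagram \<Rightarrow> node \<Rightarrow> letter" where
  "line_label b x =
     (if is_upper x \<and> is_upper (partner b x) then N
      else if \<not> is_upper x \<and> \<not> is_upper (partner b x) then S
      else P)"

text \<open>Follow the line starting at \<open>x\<close>, then cross over at the identified node at its other end.\<close>

definition loop_step :: "diagram \<Rightarrow> node \<Rightarrow> node" where
  "loop_step b x = flip_node (partner b x)"

definition loop_word :: "diagram \<Rightarrow> node \<Rightarrow> letter list" where
  "loop_word b x =
     map (\<lambda>k. line_label b ((loop_step b ^^ k) x))
       [0..<(LEAST l. 0 < l \<and> (loop_step b ^^ l) x = x)]"

primrec node_index :: "node \<Rightarrow> nat" where
  "node_index (Up i) = i"
| "node_index (Lo i) = i"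

text \<open>The vertex sets of the closed loops obtained by identifying \<open>Up i\<close> with \<open>Lo i\<close>.\<close>

definition diagram_loops :: "nat \<Rightarrow> diagram \<Rightarrow> nat set set" where
  "diagram_loops n b = components {..<n} ((\<lambda>e. node_index ` e) ` b)"

text \<open>The bracelet of a loop does not depend on the vertex at which the reading starts.\<close>

definition loop_bracelet :: "diagram \<Rightarrow> nat set \<Rightarrow> letter bracelet" where
  "loop_bracelet b C = the_elem ((\<lambda>i. bracelet (loop_word b (Up i))) ` C)"

definition diagram_monomial :: "nat \<Rightarrow> diagram \<Rightarrow> monomial" where
  "diagram_monomial n b = image_mset (loop_bracelet b) (mset_set (diagram_loops n b))"

definition monic_monomials :: "nat \<Rightarrow> monomial set" where
  "monic_monomials n = {\<zeta>. set_mset \<zeta> \<subseteq> frakb \<and> mdeg \<zeta> = n}"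

definition e_mono :: "nat \<Rightarrow> complex \<Rightarrow> monomial \<Rightarrow> brauer" where
  "e_mono n \<delta> \<zeta> = (THE x. \<exists>b\<in>diagrams n. diagram_monomial n b = \<zeta> \<and> x = gamma_elt n \<delta> b)"

definition e_map :: "nat \<Rightarrow> complex \<Rightarrow> bpoly \<Rightarrow> brauer" where
  "e_map n \<delta> f = lin_ext (e_mono n \<delta>) f"

definition is_Delta :: "nat \<Rightarrow> complex \<Rightarrow> (bpoly \<Rightarrow> bpoly) \<Rightarrow> bool" where
  "is_Delta n \<delta> D \<longleftrightarrow>
     (\<forall>f\<in>poly_alg_deg n. D f \<in> poly_alg_deg n) \<and>
     (\<forall>f\<in>poly_alg_deg n. \<forall>g\<in>poly_alg_deg n. D (f + g) = D f + D g) \<and>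
     (\<forall>c. \<forall>f\<in>poly_alg_deg n. D (cscale c f) = cscale c (D f)) \<and>
     (\<forall>\<zeta>\<in>monic_monomials n.
        brauer_mult n \<delta> (A_elt n) (e_mono n \<delta> \<zeta>) = e_map n \<delta> (D (Poly_Mapping.single \<zeta> 1)))"

text \<open>As for \<open>tau\<close>, the second conjunct fixes the values outside the domain.\<close>

definition Delta :: "nat \<Rightarrow> complex \<Rightarrow> bpoly \<Rightarrow> bpoly" where
  "Delta n \<delta> = (THE D. is_Delta n \<delta> D \<and> (\<forall>f. f \<notin> poly_alg_deg n \<longrightarrow> D f = 0))"

end

theory Submission
  imports Defs
begin

text \<open>A loop of a diagram is a closed walk that alternately follows a line and crosses over to the
  other row, and its bracelet is read off from the rows visited. So a bracelet lies in \<open>frakb\<close> iff the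
  word is a closed walk on the two rows, and a word is fit iff it leads from the lower row back to
  the lower row. Multiplying a diagram \<open>b\<close> by \<open>d\<^sub>i\<^sub>j\<close> from below cuts the walks at the lower nodes \<open>i\<close>
  and \<open>j\<close> and reconnects them; since \<open>A\<^sub>n\<close> commutes with permutations, \<open>\<Delta>\<close> sends the monomial of
  \<open>b\<close> to the sum over all pairs \<open>i < j\<close> of the monomials of \<open>d\<^sub>i\<^sub>j b\<close>, with a factor \<open>\<delta>\<close> if
  \<open>i\<close> and \<open>j\<close> are the ends of one arc.

  The second derivative of the monomial of \<open>b\<close> is the sum of its dotted versions over the ordered
  pairs of lines with a lower end. Each rule of the trace is exactly the sum of the reconnections
  over the pairs of lower nodes on the two dotted lines, an \<open>S\<close> having two such nodes and a \<open>P\<close>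
  one. A dotted monomial with two dots determines the diagram with its dotted lines up to
  conjugation, which makes the trace well defined; every unordered pair of lower nodes is counted
  twice, whence the factor \<open>1/2\<close>.\<close>

subsection \<open>Linear combinations\<close>

text \<open>\<open>tau\<close> and \<open>Delta\<close> are given by definite descriptions, so each
  needs existence as well as uniqueness before anything can be computed. For the trace, existence is
  the obstacle: a bracelet has many spellings, and several rules, or one rule in several ways, may
  apply to the same monomial. Comparing the rules pairwise is avoided by attaching to a monomial a
  value that refers to diagrams and to no spelling; each rule is shown to compute this value, and
  consistency becomes a matter of conjugacy. The delicate point there is the row in which a walk
  starts. A word containing \<open>N\<close> or \<open>S\<close> can be walked from one row only,
  but a word in \<open>P\<close> and \<open>Pd\<close> can be walked from both, and the two walks
  run in opposite directions. A rotation must then undo the reversal, which is where the limit of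
  two dots enters. For \<open>Delta\<close>, uniqueness rests on the sums over different conjugacy
  classes having disjoint supports. Explicit calculations are done with loops listed as cyclic
  sequences of nodes, where the choice between the two nodes of an index encodes the direction of
  travel.\<close>

lemma lookup_cscale [simp]: "Poly_Mapping.lookup (cscale c f) m = c * Poly_Mapping.lookup f m"
  by (simp add: cscale_def map.rep_eq when_def)

lemma cscale_add: "cscale c (f + g) = cscale c f + cscale c g"
  by (rule poly_mapping_eqI) (simp add: lookup_add algebra_simps)

lemma cscale_add_left: "cscale (c + d) f = cscale c f + cscale d f"
  by (rule poly_mapping_eqI) (simp add: lookup_add algebra_simps)

lemma cscale_cscale [simp]: "cscale c (cscale d f) = cscale (c * d) f"
  by (rule poly_mapping_eqI) simp

lemma cscale_0 [simp]: "cscale 0 f = 0" "cscale c 0 = 0"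
  by (rule poly_mapping_eqI, simp)+

lemma cscale_1 [simp]: "cscale 1 f = f"
  by (rule poly_mapping_eqI) simp

lemma cscale_single [simp]: "cscale c (Poly_Mapping.single m d) = Poly_Mapping.single m (c * d)"
  by (rule poly_mapping_eqI) (simp add: lookup_single when_def)

lemma cscale_sum: "cscale c (sum f A) = (\<Sum>x\<in>A. cscale c (f x))"
  by (rule poly_mapping_eqI) (simp add: lookup_sum sum_distrib_left)

lemma cscale_eq_mult: "cscale c (f :: bpoly) = Poly_Mapping.single 0 c * f"
  unfolding cscale_def by (rule mult_map_scale_conv_mult)

lemma poly_mapping_expand:
  fixes f :: "'a \<Rightarrow>\<^sub>0 'b::comm_monoid_add"
  shows "f = (\<Sum>m\<in>Poly_Mapping.keys f. Poly_Mapping.single m (Poly_Mapping.lookup f m))"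
  by (rule poly_mapping_eqI) (simp add: lookup_sum lookup_single when_def in_keys_iff)

lemma lin_ext_superset:
  assumes "finite A" "Poly_Mapping.keys f \<subseteq> A"
  shows "lin_ext g f = (\<Sum>m\<in>A. cscale (Poly_Mapping.lookup f m) (g m))"
  unfolding lin_ext_def using assms
  by (intro sum.mono_neutral_left) (auto simp: in_keys_iff)

lemma lin_ext_add: "lin_ext g (f + h) = lin_ext g f + lin_ext g h"
proof -
  let ?A = "Poly_Mapping.keys f \<union> Poly_Mapping.keys h"
  have *: "finite ?A" "Poly_Mapping.keys f \<subseteq> ?A" "Poly_Mapping.keys h \<subseteq> ?A"
    "Poly_Mapping.keys (f + h) \<subseteq> ?A"
    using keys_add[of f h] by auto
  show ?thesis
    unfolding lin_ext_superset[OF *(1,2)] lin_ext_superset[OF *(1,3)] lin_ext_superset[OF *(1,4)]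
    by (simp add: lookup_add cscale_add_left sum.distrib)
qed

lemma lin_ext_0 [simp]: "lin_ext g 0 = 0"
  by (simp add: lin_ext_def)

lemma lin_ext_sum: "lin_ext g (sum f A) = (\<Sum>x\<in>A. lin_ext g (f x))"
  by (induction A rule: infinite_finite_induct) (simp_all add: lin_ext_add)

lemma lin_ext_single [simp]: "lin_ext g (Poly_Mapping.single m c) = cscale c (g m)"
  by (cases "c = 0") (simp_all add: lin_ext_def)

lemma lin_ext_cscale: "lin_ext g (cscale c f) = cscale c (lin_ext g f)"
proof -
  have "Poly_Mapping.keys (cscale c f) \<subseteq> Poly_Mapping.keys f"
    by (auto simp: in_keys_iff)
  from lin_ext_superset[OF finite_keys this] show ?thesis
    by (simp add: lin_ext_def cscale_sum)
qed

text \<open>Serves the uniqueness of both \<open>tau\<close> and \<open>Delta\<close>, which are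
  pinned down only on a subspace spanned by monomials. Homogeneity is asked on single monomials
  alone, since the axioms of the trace give it there through multiplication by undotted
  polynomials.\<close>

lemma linear_on_monomials:
  assumes D: "D = {f. \<forall>m\<in>Poly_Mapping.keys f. Q m}"
    and add: "\<And>f g. f \<in> D \<Longrightarrow> g \<in> D \<Longrightarrow> T (f + g) = T f + T g"
    and scale: "\<And>c m. Q m \<Longrightarrow> T (Poly_Mapping.single m c) = cscale c (T (Poly_Mapping.single m 1))"
    and f: "f \<in> D"
  shows "T f = lin_ext (\<lambda>m. T (Poly_Mapping.single m 1)) f"
proof -
  have T0: "T 0 = 0"
    using add[of 0 0] by (simp add: D)
  have "finite A \<Longrightarrow> (\<forall>m\<in>A. Q m) \<Longrightarrow>
     (\<Sum>m\<in>A. Poly_Mapping.single m (c m)) \<in> D \<and>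
     T (\<Sum>m\<in>A. Poly_Mapping.single m (c m)) = (\<Sum>m\<in>A. cscale (c m) (T (Poly_Mapping.single m 1)))" for A c
  proof (induction A rule: finite_induct)
    case empty then show ?case by (simp add: D T0)
  next
    case (insert x A)
    let ?s = "\<Sum>m\<in>A. Poly_Mapping.single m (c m)"
    have s: "?s \<in> D" "Poly_Mapping.single x (c x) \<in> D"
      using insert by (auto simp: D split: if_splits)
    then have "Poly_Mapping.single x (c x) + ?s \<in> D"
      using keys_add[of "Poly_Mapping.single x (c x)" ?s] by (auto simp: D)
    moreover have "T (Poly_Mapping.single x (c x)) = cscale (c x) (T (Poly_Mapping.single x 1))"
      using insert.prems by (intro scale) simp
    ultimately show ?case using insert s by (simp add: add)
  qed
  note * = this
  have "\<forall>m\<in>Poly_Mapping.keys f. Q m" using f by (simp add: D)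
  from *[OF finite_keys this, of "Poly_Mapping.lookup f", THEN conjunct2]
  show ?thesis by (simp only: lin_ext_def poly_mapping_expand[of f, symmetric])
qed

subsection \<open>Words as walks between the two rows\<close>

text \<open>Reading a loop, one sits in the upper (\<open>True\<close>) or in the lower (\<open>False\<close>) row; \<open>lab a c\<close> is the
  label of a line along which the position passes from row \<open>a\<close> to row \<open>c\<close>, after crossing over at its end.\<close>

definition lab :: "bool \<Rightarrow> bool \<Rightarrow> letter" where
  "lab a c = (if a \<and> \<not> c then N else if \<not> a \<and> c then S else P)"

text \<open>Dots are erased letter by letter, so one predicate serves the words over both
  alphabets.\<close>

primrec path :: "bool \<Rightarrow> letter list \<Rightarrow> bool \<Rightarrow> bool" where
  "path a [] b \<longleftrightarrow> a = b"
| "path a (x # w) b \<longleftrightarrow> (\<exists>c. undot x = lab a c \<and> path c w b)"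

lemma lab_eq_iff: "lab a b = lab a c \<longleftrightarrow> b = c" "lab b a = lab c a \<longleftrightarrow> b = c"
  by (auto simp: lab_def)

text \<open>Walking a line backwards: a position is recorded after crossing over, so seen from the
  other direction the two rows are negated as well as interchanged.\<close>

lemma lab_Not: "lab (\<not> b) (\<not> a) = lab a b"
  by (auto simp: lab_def)

lemma lab_simps [simp]: "lab True False = N" "lab False True = S" "lab a a = P"
  "lab a c = N \<longleftrightarrow> a \<and> \<not> c" "lab a c = S \<longleftrightarrow> \<not> a \<and> c" "lab a c = P \<longleftrightarrow> a = c"
  "N = lab a c \<longleftrightarrow> a \<and> \<not> c" "S = lab a c \<longleftrightarrow> \<not> a \<and> c" "P = lab a c \<longleftrightarrow> a = c"
  by (auto simp: lab_def)

lemma path_append: "path a (u @ v) b \<longleftrightarrow> (\<exists>c. path a u c \<and> path c v b)"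
  by (induction u arbitrary: a) auto

lemma path_rev: "path a (rev w) b \<longleftrightarrow> path (\<not> b) w (\<not> a)"
proof (induction w arbitrary: b)
  case (Cons x w)
  have "path a (rev (x # w)) b \<longleftrightarrow> (\<exists>c. path a (rev w) c \<and> undot x = lab c b)"
    by (auto simp: path_append)
  also have "\<dots> \<longleftrightarrow> (\<exists>c. path (\<not> c) w (\<not> a) \<and> undot x = lab (\<not> b) (\<not> c))"
    by (simp add: Cons lab_Not)
  also have "\<dots> \<longleftrightarrow> path (\<not> b) (x # w) (\<not> a)"
    by (auto simp: ex_bool_eq)
  finally show ?case .
qed auto

lemma path_det: "path a w b \<Longrightarrow> path a w c \<Longrightarrow> b = c"
  by (induction w arbitrary: a) (auto simp: lab_eq_iff)

lemma path_inj: "path a w c \<Longrightarrow> path b w c \<Longrightarrow> a = b"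
  using path_det[of "\<not> c" "rev w" "\<not> a" "\<not> b"] by (simp add: path_rev)

lemma path_undot [simp]: "path a (map undot w) b = path a w b"
proof -
  have *: "undot (undot x) = undot x" for x by (cases x) auto
  show ?thesis by (induction w arbitrary: a) (simp_all add: *)
qed

lemma path_P: "set (map undot w) \<subseteq> {P} \<Longrightarrow> path a w a"
  by (induction w) auto

text \<open>\<open>N\<close> can only be left from the upper row and \<open>S\<close> only from the
  lower one, and a \<open>P\<close> keeps two walks in opposite rows.\<close>

lemma path_ex_NS:
  assumes "path a w b" "path (\<not> a) w c"
  shows "set (map undot w) \<subseteq> {P}"
  using assms
proof (induction w arbitrary: a)
  case (Cons x w)
  then obtain d e where "undot x = lab a d" "path d w b" "undot x = lab (\<not> a) e" "path e w c"
    by auto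
  then show ?case using Cons.IH[of a] by (auto simp: lab_def image_subset_iff split: if_splits)
qed auto

text \<open>Each \<open>S\<close> moves up and each \<open>N\<close> moves down. This turns the
  counting conditions on bracelets and in the rule \<open>pp_split\<close> into conditions on the
  ends of a walk.\<close>

lemma path_count:
  assumes "path a w b"
  shows "count_list (map undot w) S + of_bool a = count_list (map undot w) N + of_bool b"
  using assms
proof (induction w arbitrary: a)
  case (Cons x w)
  then obtain d where d: "undot x = lab a d" "path d w b" by auto
  from Cons.IH[OF this(2)] this(1) show ?case by (cases a; cases d) auto
qed auto

lemma path_up_S: "path False w True \<Longrightarrow> S \<in> set (map undot w)"
  by (induction w) (force simp: lab_def split: if_splits)+

lemma path_down_N: "path True w False \<Longrightarrow> N \<in> set (map undot w)"
  by (induction w) (force simp: lab_def split: if_splits)+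

text \<open>The starting row is left open because rotating the word moves the start to another point
  of the walk.\<close>

definition closed_word :: "letter list \<Rightarrow> bool" where
  "closed_word w \<longleftrightarrow> (\<exists>a. path a w a)"

lemma closed_rotate1 [simp]: "closed_word (rotate1 w) = closed_word w"
  by (cases w) (auto simp: closed_word_def path_append)

lemma closed_rev [simp]: "closed_word (rev w) = closed_word w"
  by (auto simp: closed_word_def path_rev ex_bool_eq)

lemma closed_undot [simp]: "closed_word (map undot w) = closed_word w"
  by (simp add: closed_word_def)

lemma closed_bracelet_equiv: "bracelet_equiv w w' \<Longrightarrow> closed_word w = closed_word w'"
  by (rule bracelet_equiv_rotate1I) simp_all

lemma bracelet_eq_iff: "bracelet w = bracelet w' \<longleftrightarrow> bracelet_equiv w w'"
  by (simp add: bracelet.abs_eq_iff)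

lemma bracelet_equiv_set: "bracelet_equiv w w' \<Longrightarrow> set w = set w'"
  by (rule bracelet_equiv_rotate1I) simp_all

lemma bracelet_equiv_map:
  assumes "bracelet_equiv w w'" shows "bracelet_equiv (map f w) (map f w')"
  using assms unfolding bracelet_equiv_def by (metis rev_map rotate_map)

section \<open>Alternation, membership in \<open>frakb\<close> and fitness in terms of walks\<close>

lemma split_nth2:
  assumes "i < j" "j < length w"
  obtains x y z where "w = x @ w ! i # y @ w ! j # z" "length x = i" "length y = j - Suc i"
proof -
  have 1: "w = take i w @ w ! i # drop (Suc i) w"
    using assms by (intro id_take_nth_drop) simp
  have 2: "drop (Suc i) w = take (j - Suc i) (drop (Suc i) w) @ w ! j # drop (Suc j) w"
    using id_take_nth_drop[of "j - Suc i" "drop (Suc i) w"] assms by simp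
  show ?thesis
    by (rule that[of "take i w" "take (j - Suc i) (drop (Suc i) w)" "drop (Suc j) w"])
      (use 1 2 assms in auto)
qed

text \<open>Factorisations instead of indices, so that alternation can be compared with
  \<open>path_append\<close>.\<close>

lemma alternating_iff:
  "alternating a c w \<longleftrightarrow>
     (\<forall>x y z. w = x @ a # y @ a # z \<longrightarrow> c \<in> set y \<and> c \<in> set x \<union> set z)"
proof
  assume A: "alternating a c w"
  show "\<forall>x y z. w = x @ a # y @ a # z \<longrightarrow> c \<in> set y \<and> c \<in> set x \<union> set z"
  proof (intro allI impI)
    fix x y z assume w: "w = x @ a # y @ a # z"
    let ?i = "length x" and ?j = "length x + Suc (length y)"
    have "w ! ?i = a" "w ! ?j = a" "?i < ?j" "?j < length w"
      by (simp_all add: w nth_append)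
    then obtain k k' where k: "?i < k" "k < ?j" "w ! k = c"
      and k': "k' < length w" "k' < ?i \<or> ?j < k'" "w ! k' = c"
      using A[unfolded alternating_def, rule_format, of ?i ?j] by blast
    have "y ! (k - Suc ?i) = c" "k - Suc ?i < length y"
      using k by (auto simp: w nth_append nth_Cons' split: if_splits)
    then have 1: "c \<in> set y" by (metis nth_mem)
    have "c \<in> set x \<union> set z"
    proof (cases "k' < ?i")
      case True
      then have "x ! k' = c" using k' by (simp add: w nth_append)
      then show ?thesis using True nth_mem by fastforce
    next
      case False
      with k' have "?j < k'" by simp
      then have "z ! (k' - Suc ?j) = c" "k' - Suc ?j < length z"
        using k' by (auto simp: w nth_append nth_Cons' split: if_splits)
      then show ?thesis using nth_mem by fastforce
    qed
    with 1 show "c \<in> set y \<and> c \<in> set x \<union> set z" by simp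
  qed
next
  assume R: "\<forall>x y z. w = x @ a # y @ a # z \<longrightarrow> c \<in> set y \<and> c \<in> set x \<union> set z"
  show "alternating a c w"
    unfolding alternating_def
  proof (intro allI impI)
    fix i j assume A: "i < j \<and> j < length w \<and> w ! i = a \<and> w ! j = a"
    then obtain x y z where w: "w = x @ a # y @ a # z" "length x = i" "length y = j - Suc i"
      using split_nth2[of i j w] by metis
    with R have c: "c \<in> set y" "c \<in> set x \<union> set z" by blast+
    have "\<exists>k>i. k < j \<and> w ! k = c"
    proof -
      from c(1) obtain k where "k < length y" "y ! k = c" by (metis in_set_conv_nth)
      then show ?thesis using w A by (intro exI[of _ "Suc i + k"]) (auto simp: nth_append)
    qed
    moreover have "\<exists>k<length w. (k < i \<or> j < k) \<and> w ! k = c"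
      using c(2)
    proof
      assume "c \<in> set x"
      then obtain k where "k < length x" "x ! k = c" by (metis in_set_conv_nth)
      then show ?thesis using w by (intro exI[of _ k]) (auto simp: nth_append)
    next
      assume "c \<in> set z"
      then obtain k where "k < length z" "z ! k = c" by (metis in_set_conv_nth)
      then show ?thesis using w A
        by (intro exI[of _ "Suc j + k"]) (auto simp: nth_append nth_Cons' )
    qed
    ultimately show "(\<exists>k>i. k < j \<and> w ! k = c) \<and> (\<exists>k<length w. (k < i \<or> j < k) \<and> w ! k = c)"
      by blast
  qed
qed

lemma map_undot_letters: "set w \<subseteq> letters \<Longrightarrow> map undot w = w"
  by (induction w) (auto simp: letters_def)

text \<open>A walk stays in its row along letters \<open>P\<close>; the first other letter is
  therefore dictated by the starting row.\<close>

lemma path_first_letter: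
  assumes "set w \<subseteq> letters" "path a w b" "\<not> set w \<subseteq> {P}"
  obtains y z where "w = y @ (if a then N else S) # z" "set y \<subseteq> {P}"
proof -
  have "\<exists>y z. w = y @ (if a then N else S) # z \<and> set y \<subseteq> {P}"
    using assms
  proof (induction w)
    case (Cons x w)
    have "undot x = x" using Cons.prems(1) by (auto simp: letters_def)
    with Cons.prems(2) obtain c where c: "x = lab a c" "path c w b" by auto
    show ?case
    proof (cases "c = a")
      case True
      then have "x = P" using c by simp
      then have "\<not> set w \<subseteq> {P}" using Cons.prems by simp
      then obtain y z where "w = y @ (if a then N else S) # z" "set y \<subseteq> {P}"
        using Cons.IH Cons.prems(1) c True by auto
      with \<open>x = P\<close> show ?thesis by (intro exI[of _ "x # y"] exI[of _ z]) auto
    next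
      case False
      with c show ?thesis by (intro exI[of _ "[]"] exI[of _ w]) auto
    qed
  qed simp
  with that show ?thesis by blast
qed

text \<open>Between two \<open>N\<close> the walk has to climb back, and between two
  \<open>S\<close> to descend; around the cycle the same holds for the outer part. Conversely
  alternation makes a walk possible, and equal counts close it.\<close>

lemma closed_iff_alternating:
  assumes "set w \<subseteq> letters"
  shows "closed_word w \<longleftrightarrow> count_list w N = count_list w S \<and> alternating N S w \<and> alternating S N w"
proof
  assume "closed_word w"
  then obtain a where p: "path a w a" by (auto simp: closed_word_def)
  have w: "map undot w = w" using assms by (rule map_undot_letters)
  have "count_list w N = count_list w S"
    using path_count[OF p] by (simp add: w)
  moreover have "alternating N S w"
    unfolding alternating_iff
  proof (intro allI impI)
    fix x y z assume eq: "w = x @ N # y @ N # z"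
    with assms have u: "map undot x = x" "map undot y = y" "map undot z = z"
      by (auto intro!: map_undot_letters)
    from p eq have *: "path a x True" "path False y True" "path False z a"
      by (auto simp: path_append)
    \<comment> \<open>The part of the cycle outside the two \<open>N\<close>, read across the end of
      the word.\<close>
    then have "path False (z @ x) True" by (auto simp: path_append)
    from path_up_S[OF this] path_up_S[OF *(2)] show "S \<in> set y \<and> S \<in> set x \<union> set z"
      by (auto simp: u simp del: set_map)
  qed
  moreover have "alternating S N w"
    unfolding alternating_iff
  proof (intro allI impI)
    fix x y z assume eq: "w = x @ S # y @ S # z"
    with assms have u: "map undot x = x" "map undot y = y" "map undot z = z"
      by (auto intro!: map_undot_letters)
    from p eq have *: "path a x False" "path True y False" "path True z a"
      by (auto simp: path_append)
    then have "path True (z @ x) False" by (auto simp: path_append)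
    from path_down_N[OF this] path_down_N[OF *(2)] show "N \<in> set y \<and> N \<in> set x \<union> set z"
      by (auto simp: u simp del: set_map)
  qed
  ultimately show "count_list w N = count_list w S \<and> alternating N S w \<and> alternating S N w"
    by blast
next
  assume A: "count_list w N = count_list w S \<and> alternating N S w \<and> alternating S N w"
  \<comment> \<open>The linear half of alternation suffices for an open walk, which is built from
    the last letter to the first.\<close>
  have key: "set w \<subseteq> letters \<Longrightarrow> (\<forall>x y z. w = x @ N # y @ N # z \<longrightarrow> S \<in> set y) \<Longrightarrow>
      (\<forall>x y z. w = x @ S # y @ S # z \<longrightarrow> N \<in> set y) \<Longrightarrow> \<exists>a b. path a w b" for w
  proof (induction w)
    case (Cons c w)
    have "\<forall>x y z. w = x @ N # y @ N # z \<longrightarrow> S \<in> set y"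
      using Cons.prems(2) by (metis append_Cons)
    moreover have "\<forall>x y z. w = x @ S # y @ S # z \<longrightarrow> N \<in> set y"
      using Cons.prems(3) by (metis append_Cons)
    ultimately obtain a b where p: "path a w b" using Cons by auto
    show ?case
    proof (cases "set w \<subseteq> {P}")
      \<comment> \<open>A word in \<open>P\<close> alone can be walked from either row, so any
        letter may precede it.\<close>
      case True
      then have "path False w False" "path True w True"
        using Cons.prems(1) by (simp_all add: path_P map_undot_letters)
      then show ?thesis by (cases c) (auto intro: exI[of _ True] exI[of _ False] simp: lab_def)
    next
      case False
      obtain y z where yz: "w = y @ (if a then N else S) # z" "set y \<subseteq> {P}"
        using path_first_letter[OF _ p False] Cons.prems(1) by auto
      \<comment> \<open>\<open>c\<close> cannot repeat the first letter of \<open>w\<close> other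
        than \<open>P\<close>, since only letters \<open>P\<close> stand between the two.\<close>
      have "c \<noteq> (if a then N else S)"
      proof
        assume "c = (if a then N else S)"
        then have "c # w = [] @ c # y @ c # z" "c = N \<or> c = S" using yz by auto
        then have "S \<in> set y \<or> N \<in> set y" using Cons.prems(2,3) by blast
        with yz(2) show False by auto
      qed
      then consider "c = P" | "a" "c = S" | "\<not> a" "c = N"
        using Cons.prems(1) by (auto simp: letters_def split: if_splits)
      then have "path a (c # w) b \<or> path (\<not> a) (c # w) b"
        using p by cases (auto simp: ex_bool_eq)
      then show ?thesis by blast
    qed
  qed (use path.simps(1) in blast)
  have "\<forall>x y z. w = x @ N # y @ N # z \<longrightarrow> S \<in> set y" "\<forall>x y z. w = x @ S # y @ S # z \<longrightarrow> N \<in> set y"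
    using A unfolding alternating_iff by blast+
  from key[OF assms this] obtain a b where p: "path a w b" by blast
  from path_count[OF p] A have "a = b" by (simp add: map_undot_letters[OF assms] of_bool_def split: if_splits)
  with p show "closed_word w" by (auto simp: closed_word_def)
qed

text \<open>\<open>frakb\<close> asks for one alternating representative; the walk description is
  invariant under rotation and reversal, so any representative can be tested.\<close>

lemma bracelet_in_frakb_iff: "bracelet w \<in> frakb \<longleftrightarrow> w \<noteq> [] \<and> set w \<subseteq> letters \<and> closed_word w"
proof
  assume "bracelet w \<in> frakb"
  then obtain w' where w': "bracelet_equiv w w'" "w' \<noteq> []" "set w' \<subseteq> letters" "closed_word w'"
    unfolding frakb_def using closed_iff_alternating by (auto simp: bracelet_eq_iff)
  then show "w \<noteq> [] \<and> set w \<subseteq> letters \<and> closed_word w"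
    using closed_bracelet_equiv bracelet_equiv_set by (metis set_empty)
next
  assume "w \<noteq> [] \<and> set w \<subseteq> letters \<and> closed_word w"
  then show "bracelet w \<in> frakb"
    unfolding frakb_def using closed_iff_alternating by blast
qed

lemma bracelet_in_frakb_bar_iff: "bracelet w \<in> frakb_bar \<longleftrightarrow> w \<noteq> [] \<and> closed_word w"
proof -
  have letters: "set (map undot w) \<subseteq> letters" for w
  proof -
    have "undot x \<in> letters" for x by (cases x) (auto simp: letters_def)
    then show ?thesis by auto
  qed
  show ?thesis
  proof
    assume "bracelet w \<in> frakb_bar"
    then obtain w' where w': "bracelet_equiv w w'" "w' \<noteq> []" "closed_word (map undot w')"
      unfolding frakb_bar_def by (auto simp: bracelet_eq_iff bracelet_in_frakb_iff simp del: closed_undot)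
    then show "w \<noteq> [] \<and> closed_word w"
      using closed_bracelet_equiv bracelet_equiv_set by (metis set_empty closed_undot)
  next
    assume "w \<noteq> [] \<and> closed_word w"
    then have "bracelet (map undot w) \<in> frakb"
      using letters[of w] by (simp add: bracelet_in_frakb_iff)
    then show "bracelet w \<in> frakb_bar" unfolding frakb_bar_def by blast
  qed
qed

text \<open>A walk back to the lower row must follow every \<open>S\<close> by a later
  \<open>N\<close>, whereas a walk from the upper row back to it ends, up to letters
  \<open>P\<close>, with an \<open>S\<close> unless it consists of \<open>P\<close> alone.\<close>

lemma fit_iff: "fit w \<longleftrightarrow> set w \<subseteq> letters \<and> path False w False"
proof (cases "w = []")
  case True
  then show ?thesis by (simp add: fit_def)
next
  case ne: False
  show ?thesis
  proof
    assume "fit w"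
    with ne have l: "set w \<subseteq> letters" and c: "closed_word w"
      and n: "\<And>i. i < length w \<Longrightarrow> w ! i = S \<Longrightarrow> \<exists>j. i < j \<and> j < length w \<and> w ! j = N"
      by (auto simp: fit_def bracelet_in_frakb_iff)
    from c obtain a where p: "path a w a" by (auto simp: closed_word_def)
    have "path False w False"
    proof (cases "a \<and> \<not> set w \<subseteq> {P}")
      case False
      then show ?thesis using p path_P[of w False] l by (cases a) (auto simp: map_undot_letters)
    next
      case True
      \<comment> \<open>Reversal moves the walk to the lower row, which shows that the last letter
        of \<open>w\<close> other than \<open>P\<close> is \<open>S\<close>.\<close>
      from p True have "path False (rev w) False" by (simp add: path_rev)
      with path_first_letter[of "rev w" False False] l True
      obtain y z where yz: "rev w = y @ S # z" "set y \<subseteq> {P}" by auto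
      then have w: "w = rev z @ S # rev y" by (metis rev_append rev.simps(2) rev_rev_ident append_assoc append_Cons append_Nil)
      have "w ! length z = S" "length z < length w" by (simp_all add: w nth_append)
      from n[OF this(2,1)] obtain j where j: "length z < j" "j < length w" "w ! j = N" by blast
      then have "rev y ! (j - Suc (length z)) = N" "j - Suc (length z) < length y"
        by (auto simp: w nth_append nth_Cons' split: if_splits)
      then have "N \<in> set (rev y)" by (metis nth_mem length_rev)
      with yz show ?thesis by auto
    qed
    with l show "set w \<subseteq> letters \<and> path False w False" by simp
  next
    assume A: "set w \<subseteq> letters \<and> path False w False"
    have "\<exists>j>i. j < length w \<and> w ! j = N" if "i < length w" "w ! i = S" for i
    proof -
      from that have w: "w = take i w @ S # drop (Suc i) w" by (metis id_take_nth_drop)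
      have "path False (take i w @ S # drop (Suc i) w) False" using A w by simp
      then have "path True (drop (Suc i) w) False"
        by (auto simp: path_append)
      from path_down_N[OF this] have "N \<in> set (drop (Suc i) w)"
        using A set_drop_subset[of "Suc i" w] by (subst (asm) map_undot_letters) auto
      then obtain k where "k < length (drop (Suc i) w)" "drop (Suc i) w ! k = N"
        by (metis in_set_conv_nth)
      then show ?thesis by (intro exI[of _ "Suc i + k"]) auto
    qed
    then show "fit w" using A ne
      by (auto simp: fit_def bracelet_in_frakb_iff closed_word_def)
  qed
qed

subsection \<open>Diagrams from cyclic walks\<close>

lemma flip_flip [simp]: "flip_node (flip_node x) = x"
  by (cases x) auto

lemma flip_eq_iff [simp]: "flip_node x = flip_node y \<longleftrightarrow> x = y"
  by (metis flip_flip)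

lemma flip_neq [simp]: "flip_node x \<noteq> x" "x \<noteq> flip_node x"
  by (cases x, auto)+

lemma node_index_flip [simp]: "node_index (flip_node x) = node_index x"
  by (cases x) auto

lemma is_upper_flip [simp]: "is_upper (flip_node x) = (\<not> is_upper x)"
  by (cases x) auto

lemma node_eq_iff: "x = y \<longleftrightarrow> node_index x = node_index y \<and> is_upper x = is_upper y"
  by (cases x; cases y) auto

lemma node_index_eq_iff: "node_index x = node_index y \<longleftrightarrow> x = y \<or> x = flip_node y"
  by (cases x; cases y) auto

lemma nodes_iff: "x \<in> nodes n \<longleftrightarrow> node_index x < n"
  by (cases x) (auto simp: nodes_def)

text \<open>The letter taken from the line as a set, independent of the direction of travel;
  \<open>line_label\<close> reads it from one end.\<close>

definition elab :: "node set \<Rightarrow> letter" where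
  "elab e = (if e \<subseteq> range Up then N else if e \<subseteq> range Lo then S else P)"

lemma in_range_Up: "x \<in> range Up \<longleftrightarrow> is_upper x" and in_range_Lo: "x \<in> range Lo \<longleftrightarrow> \<not> is_upper x"
  by (cases x; auto)+

lemma elab_pair: "elab {x, y} = lab (is_upper x) (\<not> is_upper y)"
  by (auto simp: elab_def in_range_Up in_range_Lo lab_def)

lemma undot_elab [simp]: "undot (elab e) = elab e"
  by (simp add: elab_def)

lemma elab_letters [simp]: "elab e \<in> letters"
  by (simp add: elab_def letters_def)

text \<open>A line from \<open>x\<close> to \<open>flip_node y\<close> is followed by crossing over to \<open>y\<close>. So a cyclic list of nodes
  with distinct indices describes the loop through these nodes, with one line between
  cyclically consecutive ones.\<close>

primrec chain :: "node \<Rightarrow> node list \<Rightarrow> node \<Rightarrow> node set list" where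
  "chain x [] z = [{x, flip_node z}]"
| "chain x (y # w) z = {x, flip_node y} # chain y w z"

primrec cyc :: "node list \<Rightarrow> node set list" where
  "cyc [] = []"
| "cyc (x # u) = chain x u x"

text \<open>An open stretch of a loop walked backwards: each index is then left through its other
  node.\<close>

definition rf :: "node list \<Rightarrow> node list" where
  "rf w = map flip_node (rev w)"

text \<open>Backwards around a loop with the first index kept in front, so that \<open>cyc\<close>
  is reversed exactly and not merely up to rotation.\<close>

primrec rv :: "node list \<Rightarrow> node list" where
  "rv [] = []"
| "rv (x # u) = flip_node x # rf u"

lemma rf_simps [simp]: "rf [] = []" "rf (x # w) = rf w @ [flip_node x]" "rf (u @ v) = rf v @ rf u"
  "rf (rf w) = w" "length (rf w) = length w"
  by (simp_all add: rf_def rev_map comp_def)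

lemma mset_index_rf [simp]: "image_mset node_index (mset (rf w)) = image_mset node_index (mset w)"
  by (simp add: rf_def image_mset.compositionality comp_def)

lemma chain_append: "chain x (u @ y # v) z = chain x u y @ chain y v z"
  by (induction u arbitrary: x) auto

lemma chain_rf: "chain (flip_node z) (rf w) (flip_node x) = rev (chain x w z)"
  by (induction w arbitrary: x) (auto simp: chain_append)

lemma chain_zip: "chain x w z = map (\<lambda>(x, y). {x, flip_node y}) (zip (x # w) (w @ [z]))"
  by (induction w arbitrary: x) auto

lemma length_chain [simp]: "length (chain x w z) = Suc (length w)"
  by (induction w arbitrary: x) auto

lemma cyc_zip: "cyc w = map (\<lambda>(x, y). {x, flip_node y}) (zip w (rotate1 w))"
  by (cases w) (auto simp: chain_zip)

lemma length_cyc [simp]: "length (cyc w) = length w"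
  by (cases w) auto

lemma cyc_eq_Nil [simp]: "cyc w = [] \<longleftrightarrow> w = []"
  using length_cyc[of w] by (metis length_0_conv)

lemma cyc_rotate1: "cyc (rotate1 w) = rotate1 (cyc w)"
proof (cases w)
  case (Cons x u)
  then show ?thesis by (cases u) (auto simp: chain_append)
qed simp

lemma cyc_rotate: "cyc (rotate k w) = rotate k (cyc w)"
  by (induction k) (auto simp: cyc_rotate1)

lemma cyc_rv: "cyc (rv w) = rev (cyc w)"
  by (cases w) (auto simp: chain_rf)

text \<open>The rows of the listed nodes are themselves the walk; the labelling may only add dots to
  the letters of the lines.\<close>

lemma path_chain:
  assumes "\<And>e. e \<in> set (chain x w z) \<Longrightarrow> undot (L e) = elab e"
  shows "path (is_upper x) (map L (chain x w z)) (is_upper z)"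
  using assms by (induction w arbitrary: x) (auto simp: elab_pair)

lemma closed_cyc:
  assumes "\<And>e. e \<in> set (cyc w) \<Longrightarrow> undot (L e) = elab e"
  shows "closed_word (map L (cyc w))"
proof (cases w)
  case (Cons x u)
  have "path (is_upper x) (map L (chain x u x)) (is_upper x)"
    using assms by (intro path_chain) (simp add: Cons)
  then show ?thesis by (auto simp: closed_word_def Cons)
qed (simp add: closed_word_def)

text \<open>The counterpart of \<open>bracelet_equiv\<close> for node lists: reversing the direction
  also exchanges the node at each index.\<close>

definition requiv :: "node list \<Rightarrow> node list \<Rightarrow> bool" where
  "requiv w w' \<longleftrightarrow> (\<exists>k. w' = rotate k w \<or> w' = rotate k (rv w))"

lemma requiv_cyc: "requiv w w' \<Longrightarrow> bracelet_equiv (cyc w) (cyc w')"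
  by (auto simp: requiv_def bracelet_equiv_def cyc_rotate cyc_rv)

lemma mset_rotate1 [simp]: "mset (rotate1 w) = mset w"
  by (cases w) auto

lemma mset_rotate [simp]: "mset (rotate k w) = mset w"
  by (induction k) auto

lemma mset_index_rv: "image_mset node_index (mset (rv w)) = image_mset node_index (mset w)"
  by (cases w) auto

lemma requiv_index: "requiv w w' \<Longrightarrow> image_mset node_index (mset w') = image_mset node_index (mset w)"
  by (auto simp: requiv_def mset_index_rv)

lemma requiv_refl [simp]: "requiv w w"
  unfolding requiv_def by (intro exI[of _ 0]) simp

text \<open>All loops of a diagram, each index occurring through the one of its two nodes by which
  the loop leaves it. The equation of multisets states distinctness and completeness
  together.\<close>

definition config :: "nat \<Rightarrow> node list list \<Rightarrow> bool" where
  "config n ws \<longleftrightarrow> [] \<notin> set ws \<and> image_mset node_index (mset (concat ws)) = mset [0..<n]"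

definition diag :: "node list list \<Rightarrow> diagram" where
  "diag ws = set (concat (map cyc ws))"

text \<open>The labelling is a parameter so that dotted monomials arise from the same loops by
  relabelling lines.\<close>

definition cmono :: "(node set \<Rightarrow> letter) \<Rightarrow> node list list \<Rightarrow> monomial" where
  "cmono L ws = mset (map (\<lambda>w. bracelet (map L (cyc w))) ws)"

lemma cmono_simps [simp]: "cmono L [] = {#}" "cmono L (w # ws) = add_mset (bracelet (map L (cyc w))) (cmono L ws)"
  by (simp_all add: cmono_def)

lemma diag_simps [simp]: "diag [] = {}" "diag (w # ws) = set (cyc w) \<union> diag ws"
  by (simp_all add: diag_def)

lemma list_all2_requiv:
  assumes "list_all2 requiv ws ws'"
  shows "config n ws = config n ws'" "diag ws = diag ws'" "cmono L ws = cmono L ws'"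
proof -
  have *: "image_mset node_index (mset (concat ws)) = image_mset node_index (mset (concat ws'))
     \<and> ([] \<in> set ws \<longleftrightarrow> [] \<in> set ws') \<and> diag ws = diag ws' \<and> cmono L ws = cmono L ws'"
    using assms
  proof (induction rule: list_all2_induct)
    case (Cons w ws w' ws')
    have "set (cyc w) = set (cyc w')" "w = [] \<longleftrightarrow> w' = []"
      using bracelet_equiv_set[OF requiv_cyc[OF Cons(1)]] by (auto dest: arg_cong[where f="\<lambda>x. x = {}"])
    moreover have "bracelet (map L (cyc w)) = bracelet (map L (cyc w'))"
      unfolding bracelet_eq_iff by (intro bracelet_equiv_map requiv_cyc Cons)
    ultimately show ?case using Cons requiv_index[OF Cons(1)] by auto
  qed simp
  then show "config n ws = config n ws'" "diag ws = diag ws'" "cmono L ws = cmono L ws'"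
    by (auto simp: config_def)
qed

lemma config_permute:
  assumes "mset ws = mset ws'"
  shows "config n ws = config n ws'" "diag ws = diag ws'" "cmono L ws = cmono L ws'"
proof -
  have "mset (concat ws) = mset (concat ws')"
    using assms by (metis mset_concat mset_map sum_mset_sum_list)
  then show "config n ws = config n ws'" "diag ws = diag ws'" "cmono L ws = cmono L ws'"
    using assms by (auto simp: config_def diag_def cmono_def dest: mset_eq_setD)
qed

text \<open>The graph of the successor map along the loops. For a configuration it is a permutation,
  and this is what makes \<open>diag\<close> a perfect matching.\<close>

definition nextpairs :: "node list list \<Rightarrow> (node \<times> node) list" where
  "nextpairs ws = concat (map (\<lambda>w. zip w (rotate1 w)) ws)"

lemma nextpairs_fst: "map fst (nextpairs ws) = concat ws"
  by (induction ws) (auto simp: nextpairs_def)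

lemma nextpairs_snd: "mset (map snd (nextpairs ws)) = mset (concat ws)"
  by (induction ws) (auto simp: nextpairs_def)

lemma diag_nextpairs: "diag ws = (\<lambda>(x, y). {x, flip_node y}) ` set (nextpairs ws)"
  by (induction ws) (auto simp: nextpairs_def cyc_zip)

lemma nextpairs_ex:
  "x \<in> set (concat ws) \<Longrightarrow> \<exists>y. (x, y) \<in> set (nextpairs ws)"
  "x \<in> set (concat ws) \<Longrightarrow> \<exists>y. (y, x) \<in> set (nextpairs ws)"
proof -
  assume x: "x \<in> set (concat ws)"
  have "x \<in> set (map fst (nextpairs ws))" using x by (simp only: nextpairs_fst)
  then show "\<exists>y. (x, y) \<in> set (nextpairs ws)" by force
  have "x \<in> set (map snd (nextpairs ws))" using x mset_eq_setD[OF nextpairs_snd] by metis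
  then show "\<exists>y. (y, x) \<in> set (nextpairs ws)" by force
qed

lemma nextpairs_in:
  assumes "(x, y) \<in> set (nextpairs ws)" shows "x \<in> set (concat ws)" "y \<in> set (concat ws)"
proof -
  have "x \<in> set (map fst (nextpairs ws))" using assms by force
  then show "x \<in> set (concat ws)" by (simp only: nextpairs_fst)
  have "y \<in> set (map snd (nextpairs ws))" using assms by force
  then show "y \<in> set (concat ws)" using mset_eq_setD[OF nextpairs_snd] by metis
qed

context
  fixes n ws
  assumes cfg: "config n ws"
begin

lemma config_distinct: "distinct (map node_index (concat ws))" "distinct (concat ws)"
  and config_index: "node_index ` set (concat ws) = {..<n}"
proof -
  have m: "mset (map node_index (concat ws)) = mset [0..<n]"
    using cfg by (simp add: config_def)
  then show 1: "distinct (map node_index (concat ws))"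
    using mset_eq_imp_distinct_iff distinct_upt by blast
  then show "distinct (concat ws)" by (simp add: distinct_map)
  from mset_eq_setD[OF m] show "node_index ` set (concat ws) = {..<n}" by auto
qed

lemma config_inj:
  "x \<in> set (concat ws) \<Longrightarrow> y \<in> set (concat ws) \<Longrightarrow> node_index x = node_index y \<Longrightarrow> x = y"
  using config_distinct(1) by (metis distinct_map inj_on_eq_iff)

lemma config_no_flip: "x \<in> set (concat ws) \<Longrightarrow> flip_node x \<notin> set (concat ws)"
  using config_inj[of x "flip_node x"] by auto

lemma nextpairs_unique:
  "(x, y) \<in> set (nextpairs ws) \<Longrightarrow> (x, y') \<in> set (nextpairs ws) \<Longrightarrow> y = y'"
  "(x, y) \<in> set (nextpairs ws) \<Longrightarrow> (x', y) \<in> set (nextpairs ws) \<Longrightarrow> x = x'"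
proof -
  have d: "distinct (map fst (nextpairs ws))" "distinct (map snd (nextpairs ws))"
    using config_distinct(2) mset_eq_imp_distinct_iff[OF nextpairs_snd[of ws]]
    by (simp_all add: nextpairs_fst)
  show "(x, y) \<in> set (nextpairs ws) \<Longrightarrow> (x, y') \<in> set (nextpairs ws) \<Longrightarrow> y = y'"
    using d(1) by (rule eq_key_imp_eq_value)
  show "(x, y) \<in> set (nextpairs ws) \<Longrightarrow> (x', y) \<in> set (nextpairs ws) \<Longrightarrow> x = x'"
    using d(2) inj_onD[of snd "set (nextpairs ws)" "(x, y)" "(x', y)"] by (simp add: distinct_map)
qed

lemma diag_diagrams: "diag ws \<in> diagrams n"
proof -
  have 1: "e \<subseteq> nodes n \<and> card e = 2" if "e \<in> diag ws" for e
  proof -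
    from that obtain x y where xy: "e = {x, flip_node y}" "(x, y) \<in> set (nextpairs ws)"
      by (auto simp: diag_nextpairs)
    note in_ws = nextpairs_in[OF xy(2)]
    then have "node_index x < n" "node_index y < n" using config_index by blast+
    moreover have "x \<noteq> flip_node y" using in_ws config_no_flip by auto
    ultimately show ?thesis by (simp add: xy nodes_iff)
  qed
  have 2: "\<exists>!e. e \<in> diag ws \<and> z \<in> e" if z: "z \<in> nodes n" for z
  proof -
    have "node_index z \<in> node_index ` set (concat ws)"
      using z by (simp only: config_index) (simp add: nodes_iff)
    then obtain x where "x \<in> set (concat ws)" "node_index z = node_index x" by blast
    \<comment> \<open>Either the loop leaves the index through \<open>z\<close>, and the line at
      \<open>z\<close> leads to the successor, or it arrives at \<open>z\<close>, and the line comes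
      from the predecessor.\<close>
    then consider "z \<in> set (concat ws)" | "flip_node z \<in> set (concat ws)"
      by (metis node_index_eq_iff flip_flip)
    then show ?thesis
    proof cases
      case 1
      then obtain y where y: "(z, y) \<in> set (nextpairs ws)" using nextpairs_ex by blast
      show ?thesis
      proof (rule ex1I)
        show "{z, flip_node y} \<in> diag ws \<and> z \<in> {z, flip_node y}"
          using y by (force simp: diag_nextpairs)
        fix e assume "e \<in> diag ws \<and> z \<in> e"
        then obtain x' y' where xy': "e = {x', flip_node y'}" "(x', y') \<in> set (nextpairs ws)" "z \<in> e"
          by (auto simp: diag_nextpairs)
        have "z \<noteq> flip_node y'"
          using nextpairs_in[OF xy'(2)] config_no_flip 1 by auto
        then have "z = x'" using xy' by auto
        then show "e = {z, flip_node y}" using xy' y nextpairs_unique(1) by blast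
      qed
    next
      case 2
      then obtain y where y: "(y, flip_node z) \<in> set (nextpairs ws)" using nextpairs_ex by blast
      show ?thesis
      proof (rule ex1I)
        show "{y, z} \<in> diag ws \<and> z \<in> {y, z}"
          using y by (force simp: diag_nextpairs)
        fix e assume "e \<in> diag ws \<and> z \<in> e"
        then obtain x' y' where xy': "e = {x', flip_node y'}" "(x', y') \<in> set (nextpairs ws)" "z \<in> e"
          by (auto simp: diag_nextpairs)
        have "z \<noteq> x'"
          using nextpairs_in[OF xy'(2)] config_no_flip[OF 2] by auto
        then have "y' = flip_node z" using xy' by auto
        then show "e = {y, z}" using xy' y nextpairs_unique(2) by auto
      qed
    qed
  qed
  show ?thesis using 1 2 by (simp add: diagrams_def)
qed

end

lemma diagram_unique:
  assumes "b \<in> diagrams n" "e \<in> b" "e' \<in> b" "z \<in> e" "z \<in> e'" shows "e = e'"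
proof -
  have "z \<in> nodes n" using assms by (auto simp: diagrams_def)
  then show ?thesis using assms unfolding diagrams_def by blast
qed

lemma diagram_pair:
  assumes "b \<in> diagrams n" "{x, y} \<in> b" shows "x \<noteq> y" "node_index x < n" "node_index y < n"
  using assms by (auto simp: diagrams_def nodes_iff)

lemma diagram_edge:
  assumes "b \<in> diagrams n" "x \<in> nodes n" obtains y where "{x, y} \<in> b" "x \<noteq> y"
proof -
  from assms obtain e where e: "e \<in> b" "x \<in> e" "card e = 2" by (auto simp: diagrams_def)
  then obtain y where "e = {x, y}" "x \<noteq> y" by (auto simp: card_2_iff)
  with that e show ?thesis by blast
qed

lemma diagram_edge':
  assumes "b \<in> diagrams n" "e \<in> b" "x \<in> e" obtains y where "e = {x, y}" "x \<noteq> y"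
proof -
  from assms have "card e = 2" by (auto simp: diagrams_def)
  then show ?thesis using assms(3) that by (auto simp: card_2_iff)
qed

lemma partner_eq:
  assumes "b \<in> diagrams n" "{x, y} \<in> b" shows "partner b x = y"
  unfolding partner_def
proof (rule the_equality)
  show "y \<noteq> x \<and> {x, y} \<in> b" using diagram_pair[OF assms] assms(2) by auto
  fix z assume "z \<noteq> x \<and> {x, z} \<in> b"
  then show "z = y" using diagram_unique[OF assms(1), of "{x, y}" "{x, z}" x] assms(2)
    by (auto simp: doubleton_eq_iff)
qed

lemma diagrams_subset_eq:
  assumes "b \<in> diagrams n" "b' \<in> diagrams n" "b \<subseteq> b'" shows "b = b'"
proof
  show "b' \<subseteq> b"
  proof
    fix e assume e: "e \<in> b'"
    then have "e \<subseteq> nodes n" "e \<noteq> {}"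
      using assms(2) by (auto simp: diagrams_def)
    then obtain z where z: "z \<in> e" "z \<in> nodes n" by blast
    then obtain y where "{z, y} \<in> b" using diagram_edge[OF assms(1)] by blast
    with assms(3) diagram_unique[OF assms(2) e _ z(1), of "{z, y}"] show "e \<in> b" by auto
  qed
qed fact

lemma elab_line_label:
  assumes "b \<in> diagrams n" "{x, y} \<in> b" shows "line_label b x = elab {x, y}"
  using partner_eq[OF assms] by (auto simp: line_label_def elab_pair)

section \<open>The loops and the monomial of a configuration\<close>

lemma loop_word_config:
  assumes cfg: "config n (w # ws)"
  shows "loop_word (diag (w # ws)) (hd w) = map elab (cyc w)"
proof -
  define b where "b = diag (w # ws)"
  have b: "b \<in> diagrams n" unfolding b_def using cfg by (rule diag_diagrams)
  let ?l = "length w"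
  have w: "w \<noteq> []" using cfg by (auto simp: config_def)
  have d: "distinct w" using config_distinct(2)[OF cfg] by simp
  have cyc_nth: "cyc w ! k = {w ! k, flip_node (w ! (Suc k mod ?l))}" if "k < ?l" for k
    using that by (simp add: cyc_zip nth_rotate1)
  have edge: "{w ! k, flip_node (w ! (Suc k mod ?l))} \<in> b" if "k < ?l" for k
    using nth_mem[of k "cyc w"] that by (simp add: cyc_nth b_def)
  have step: "loop_step b (w ! k) = w ! (Suc k mod ?l)" if "k < ?l" for k
    using partner_eq[OF b edge[OF that]] by (simp add: loop_step_def)
  have iter: "(loop_step b ^^ k) (hd w) = w ! (k mod ?l)" for k
  proof (induction k)
    case 0 then show ?case using w by (simp add: hd_conv_nth)
  next
    case (Suc k) then show ?case using w step[of "k mod ?l"] by (simp add: mod_Suc_eq)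
  qed
  \<comment> \<open>The nodes of \<open>w\<close> are distinct, so the first return takes exactly
    \<open>length w\<close> steps.\<close>
  have "(LEAST l. 0 < l \<and> (loop_step b ^^ l) (hd w) = hd w) = ?l"
  proof (rule Least_equality)
    show "0 < ?l \<and> (loop_step b ^^ ?l) (hd w) = hd w" using w iter[of ?l] by (simp add: hd_conv_nth)
    fix l assume l: "0 < l \<and> (loop_step b ^^ l) (hd w) = hd w"
    then have "w ! (l mod ?l) = w ! 0" using w iter[of l] by (simp add: hd_conv_nth)
    then have "l mod ?l = 0" using d w by (simp add: nth_eq_iff_index_eq)
    then show "?l \<le> l" using l by (auto simp: mod_eq_0_iff_dvd dest: dvd_imp_le)
  qed
  then have "loop_word b (hd w) = map (\<lambda>k. line_label b (w ! (k mod ?l))) [0..<?l]"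
    by (simp add: loop_word_def iter)
  also have "\<dots> = map elab (cyc w)"
  proof (rule nth_equalityI)
    fix k assume "k < length (map (\<lambda>k. line_label b (w ! (k mod ?l))) [0..<?l])"
    then have "k < ?l" by simp
    then show "map (\<lambda>k. line_label b (w ! (k mod ?l))) [0..<?l] ! k = map elab (cyc w) ! k"
      using elab_line_label[OF b edge] by (simp add: cyc_nth)
  qed simp
  finally show ?thesis by (simp add: b_def)
qed

text \<open>\<open>loop_bracelet\<close> reads every loop from an upper node, whereas the list may
  leave that index through its lower node; a reversal then brings the required node to the
  front.\<close>

lemma requiv_hd:
  assumes "x \<in> set w \<or> flip_node x \<in> set w" obtains w' where "requiv w w'" "w' \<noteq> []" "hd w' = x"
proof -
  have *: "\<exists>k. rotate k w \<noteq> [] \<and> hd (rotate k w) = x" if "x \<in> set w" for w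
  proof -
    from that obtain u v where "w = u @ x # v" by (auto dest: split_list)
    then show ?thesis by (intro exI[of _ "length u"]) (simp add: rotate_append)
  qed
  from assms show ?thesis
  proof
    assume "x \<in> set w"
    from *[OF this] that show ?thesis unfolding requiv_def by blast
  next
    assume "flip_node x \<in> set w"
    then have "x \<in> set (rv w)" by (cases w) (auto simp: rf_def image_iff intro: bexI[of _ "flip_node x"])
    from *[OF this] that show ?thesis unfolding requiv_def by blast
  qed
qed

text \<open>Edges never leave a block and a root reaches its whole block, so no analysis of paths is
  left when loops of a diagram and stacked products are computed.\<close>

lemma components_eq:
  assumes part: "\<Union>Q = V" "\<And>C D. C \<in> Q \<Longrightarrow> D \<in> Q \<Longrightarrow> C \<inter> D \<noteq> {} \<Longrightarrow> C = D" "{} \<notin> Q"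
    and edges: "\<And>x y. {x, y} \<in> E \<Longrightarrow> \<exists>C\<in>Q. x \<in> C \<and> y \<in> C"
    and conn: "\<And>C. C \<in> Q \<Longrightarrow> \<exists>r\<in>C. \<forall>y\<in>C. (r, y) \<in> {(x, y). {x, y} \<in> E}\<^sup>*"
  shows "components V E = Q"
proof -
  let ?R = "{(x, y). {x, y} \<in> E}\<^sup>*"
  have sym: "(y, x) \<in> ?R" if "(x, y) \<in> ?R" for x y
  proof -
    have "sym {(x, y). {x, y} \<in> E}" by (auto simp: sym_def insert_commute)
    from sym_rtrancl[OF this] that show ?thesis by (auto simp: sym_def)
  qed
  have inside: "y \<in> C" if "C \<in> Q" "x \<in> C" "(x, y) \<in> ?R" for x y C
    using that(3)
  proof (induction rule: rtrancl_induct)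
    case (step y z)
    then obtain D where "D \<in> Q" "y \<in> D" "z \<in> D" using edges by blast
    with step part(2)[of C D] that(1) show ?case by blast
  qed (use that in auto)
  have cls: "?R `` {x} = C" if C: "C \<in> Q" "x \<in> C" for x C
  proof -
    from conn[OF C(1)] obtain r where r: "r \<in> C" "\<forall>y\<in>C. (r, y) \<in> ?R" by blast
    then have "(x, y) \<in> ?R" if "y \<in> C" for y
      using sym C(2) that by (meson rtrancl_trans)
    with inside[OF C] show ?thesis by blast
  qed
  show ?thesis
  proof
    show "components V E \<subseteq> Q"
    proof
      fix X assume "X \<in> components V E"
      then obtain x where x: "x \<in> V" "X = ?R `` {x}" by (auto simp: components_def quotient_def)
      then obtain C where "C \<in> Q" "x \<in> C" using part(1) by blast
      with cls x show "X \<in> Q" by simp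
    qed
    show "Q \<subseteq> components V E"
    proof
      fix C assume C: "C \<in> Q"
      then obtain x where "x \<in> C" using part(3) by (metis ex_in_conv)
      with C cls part(1) have "x \<in> V" "C = ?R `` {x}" by auto
      then show "C \<in> components V E" by (auto simp: components_def quotient_def)
    qed
  qed
qed

lemma rtrancl_chain:
  assumes "\<And>e. e \<in> set (chain x w z) \<Longrightarrow> node_index ` e \<in> E" "y \<in> set (x # w)"
  shows "(node_index x, node_index y) \<in> {(i, j). {i, j} \<in> E}\<^sup>*"
  using assms
proof (induction w arbitrary: x)
  case (Cons a w)
  have 1: "(node_index x, node_index a) \<in> {(i, j). {i, j} \<in> E}"
    using Cons.prems(1)[of "{x, flip_node a}"] by simp
  show ?case
  proof (cases "y = x")
    case False
    then have "(node_index a, node_index y) \<in> {(i, j). {i, j} \<in> E}\<^sup>*"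
      using Cons by (intro Cons.IH) auto
    with 1 show ?thesis by (rule converse_rtrancl_into_rtrancl)
  qed simp
qed simp

text \<open>\<open>mset_set\<close> forgets multiplicities; nothing is lost because different loops
  have disjoint non-empty index sets.\<close>

lemma diagram_loops_config:
  assumes cfg: "config n ws"
  shows "mset_set (diagram_loops n (diag ws)) = mset (map (\<lambda>w. node_index ` set w) ws)"
proof -
  have ne: "w \<noteq> []" if "w \<in> set ws" for w using cfg that by (auto simp: config_def)
  have disj: "distinct (map (\<lambda>w. node_index ` set w) ws) \<and>
     (\<forall>C\<in>(\<lambda>w. node_index ` set w) ` set ws. \<forall>D\<in>(\<lambda>w. node_index ` set w) ` set ws. C \<inter> D \<noteq> {} \<longrightarrow> C = D)"
    if "distinct (map node_index (concat ws))" "[] \<notin> set ws" for ws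
    using that
  proof (induction ws)
    case (Cons w ws)
    have *: "node_index ` set w \<inter> node_index ` set v = {}" if "v \<in> set ws" for v
      using Cons.prems(1) that by fastforce
    have "node_index ` set w \<noteq> {}" using Cons.prems(2) by auto
    with * have 1: "node_index ` set w \<notin> (\<lambda>w. node_index ` set w) ` set ws"
      by (metis (no_types, lifting) Int_absorb imageE)
    have "distinct (map node_index (concat ws))" "[] \<notin> set ws" using Cons.prems by auto
    note 2 = Cons.IH[OF this]
    have 3: "\<forall>D\<in>(\<lambda>w. node_index ` set w) ` set ws.
        node_index ` set w \<inter> D = {} \<and> D \<inter> node_index ` set w = {}"
      using * by (metis (no_types, lifting) Int_commute imageE)
    show ?case
      using 1 2 3 unfolding list.map distinct.simps list.set image_insert ball_simps set_map by simp
  qed simp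
  have "[] \<notin> set ws" using ne by blast
  note disj = disj[OF config_distinct(1)[OF cfg] this]
  have "diagram_loops n (diag ws) = (\<lambda>w. node_index ` set w) ` set ws"
    unfolding diagram_loops_def
  proof (rule components_eq)
    show "\<Union> ((\<lambda>w. node_index ` set w) ` set ws) = {..<n}"
      using config_index[OF cfg] by (simp add: image_Union image_UN)
    show "C = D" if "C \<in> (\<lambda>w. node_index ` set w) ` set ws" "D \<in> (\<lambda>w. node_index ` set w) ` set ws"
      "C \<inter> D \<noteq> {}" for C D
      using disj that by blast
    show "{} \<notin> (\<lambda>w. node_index ` set w) ` set ws" using ne by auto
    show "\<exists>C\<in>(\<lambda>w. node_index ` set w) ` set ws. i \<in> C \<and> j \<in> C"
      if ij: "{i, j} \<in> (`) node_index ` diag ws" for i j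
    proof -
      from ij obtain w x y where w: "w \<in> set ws" "(x, y) \<in> set (zip w (rotate1 w))"
        "{i, j} = node_index ` {x, flip_node y}"
        by (auto simp: diag_def cyc_zip)
      then have "x \<in> set w" "y \<in> set w" by (auto dest: set_zip_leftD set_zip_rightD)
      moreover have "(i = node_index x \<or> i = node_index y) \<and> (j = node_index x \<or> j = node_index y)"
        using w(3) by auto
      ultimately show ?thesis using w(1) by blast
    qed
    show "\<exists>r\<in>C. \<forall>y\<in>C. (r, y) \<in> {(x, y). {x, y} \<in> (`) node_index ` diag ws}\<^sup>*"
      if "C \<in> (\<lambda>w. node_index ` set w) ` set ws" for C
    proof -
      from that obtain w where w: "w \<in> set ws" "C = node_index ` set w" by blast
      with ne obtain x u where xu: "w = x # u" by (cases w) auto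
      have e: "node_index ` e \<in> (`) node_index ` diag ws" if "e \<in> set (chain x u x)" for e
        using w(1) that by (force simp: diag_def xu)
      show ?thesis using rtrancl_chain[of x u x, OF e] w xu
        by (intro bexI[of _ "node_index x"]) auto
    qed
  qed
  then show ?thesis using disj by (simp add: mset_set_set flip: set_map)
qed

text \<open>The bracelet of a loop is read through every index of it, so each of these readings is
  matched with the list read from a suitable start in a suitable direction.\<close>

lemma diagram_monomial_config:
  assumes cfg: "config n ws"
  shows "diagram_monomial n (diag ws) = cmono elab ws"
proof -
  have "loop_bracelet (diag ws) (node_index ` set w) = bracelet (map elab (cyc w))" if w: "w \<in> set ws" for w
  proof -
    have const: "bracelet (loop_word (diag ws) (Up i)) = bracelet (map elab (cyc w))" if i: "i \<in> node_index ` set w" for i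
    proof -
      from w obtain us vs where ws: "ws = us @ w # vs" by (auto dest: split_list)
      have "Up i \<in> set w \<or> flip_node (Up i) \<in> set w"
        using i by (metis (no_types, lifting) imageE node_index.simps(1) node_index_eq_iff flip_flip)
      then obtain w' where w': "requiv w w'" "w' \<noteq> []" "hd w' = Up i" by (rule requiv_hd)
      \<comment> \<open>The loop in question is moved to the front and turned to start at
        \<open>Up i\<close>; neither changes the diagram.\<close>
      let ?ws = "w' # us @ vs"
      have "list_all2 requiv (w # us @ vs) ?ws" using w'(1) by (simp add: list.rel_refl)
      note 1 = list_all2_requiv[OF this]
      have "mset ws = mset (w # us @ vs)" by (simp add: ws)
      note 2 = config_permute[OF this]
      have "config n ?ws" "diag ws = diag ?ws" using 1 2 cfg by simp_all
      with loop_word_config[OF this(1)] w'(3) have "loop_word (diag ws) (Up i) = map elab (cyc w')" by simp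
      then show ?thesis
        using bracelet_equiv_map[OF requiv_cyc[OF w'(1)], of elab] by (simp flip: bracelet_eq_iff)
    qed
    have "(\<lambda>i. bracelet (loop_word (diag ws) (Up i))) ` (node_index ` set w) = {bracelet (map elab (cyc w))}"
    proof -
      have "w \<noteq> []" using w cfg by (auto simp: config_def)
      then have "node_index ` set w \<noteq> {}" by simp
      then show ?thesis by (simp add: const image_constant_conv cong: image_cong_simp)
    qed
    then show ?thesis by (simp add: loop_bracelet_def)
  qed
  then show ?thesis
    unfolding diagram_monomial_def diagram_loops_config[OF cfg] cmono_def
    by (auto intro!: arg_cong[where f=mset] simp flip: mset_map)
qed

text \<open>Dots are placed by changing the label of a line; that this dots a single letter of a
  single word rests on no line occurring twice.\<close>

lemma distinct_edges:
  assumes cfg: "config n ws" shows "distinct (concat (map cyc ws))"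
proof -
  have eq: "concat (map cyc ws) = map (\<lambda>(x, y). {x, flip_node y}) (nextpairs ws)"
    by (induction ws) (simp_all add: nextpairs_def cyc_zip)
  have "distinct (map fst (nextpairs ws))" using config_distinct(2)[OF cfg] by (simp add: nextpairs_fst)
  then have "distinct (nextpairs ws)" by (simp add: distinct_map)
  moreover have "inj_on (\<lambda>(x, y). {x, flip_node y}) (set (nextpairs ws))"
  proof (rule inj_onI, clarify)
    fix x y x' y' assume A: "(x, y) \<in> set (nextpairs ws)" "(x', y') \<in> set (nextpairs ws)"
      "{x, flip_node y} = {x', flip_node y'}"
    have "x \<noteq> flip_node y'"
      using nextpairs_in[OF A(1)] nextpairs_in[OF A(2)] config_no_flip[OF cfg] by auto
    then have "x = x'" "flip_node y = flip_node y'" using A(3) by (auto simp: doubleton_eq_iff)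
    then show "x = x' \<and> y = y'" by simp
  qed
  ultimately show ?thesis by (simp add: eq distinct_map)
qed

section \<open>Every diagram comes from a configuration\<close>

lemma max_nat_ex:
  fixes f :: "'a \<Rightarrow> nat"
  assumes "Q a" "\<And>x. Q x \<Longrightarrow> f x \<le> n"
  obtains x where "Q x" "\<And>y. Q y \<Longrightarrow> f y \<le> f x"
proof -
  have "\<exists>x. Q x \<and> (\<forall>y. Q y \<longrightarrow> f y \<le> f x)"
    using ex_has_greatest_nat[of Q a f "Suc n"] assms by (auto simp: less_Suc_eq_le)
  with that show ?thesis by blast
qed

text \<open>A longest walk with distinct indices outside \<open>K\<close> cannot be prolonged, so
  its next line leads back to a visited index, and the matching property leaves only the first
  one.\<close>

lemma diagram_loop_ex:
  assumes b: "b \<in> diagrams n" and i: "i < n" "i \<notin> K"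
    and K: "\<And>x y. {x, y} \<in> b \<Longrightarrow> node_index x \<in> K \<Longrightarrow> node_index y \<in> K"
  obtains w where "w \<noteq> []" "set (cyc w) \<subseteq> b" "distinct (map node_index w)"
    "node_index ` set w \<subseteq> {..<n} - K"
proof -
  define Q where "Q w \<longleftrightarrow> w \<noteq> [] \<and> distinct (map node_index w) \<and> node_index ` set w \<subseteq> {..<n} - K \<and>
    (\<forall>k. Suc k < length w \<longrightarrow> {w ! k, flip_node (w ! Suc k)} \<in> b)" for w
  have "Q [Up i]" using i by (simp add: Q_def)
  moreover have "length w \<le> n" if "Q w" for w
  proof -
    have "length (map node_index w) = card (node_index ` set w)"
      using that distinct_card[of "map node_index w"] by (simp add: Q_def)
    also have "\<dots> \<le> card {..<n}" using that by (intro card_mono) (auto simp: Q_def)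
    finally show ?thesis by simp
  qed
  ultimately obtain w where w: "Q w" and max: "\<And>v. Q v \<Longrightarrow> length v \<le> length w"
    using max_nat_ex[of Q "[Up i]" length n] by metis
  define l where "l = length w"
  have ne: "w \<noteq> []" "0 < l" and d: "distinct (map node_index w)" and sub: "node_index ` set w \<subseteq> {..<n} - K"
    and edge: "\<And>k. Suc k < l \<Longrightarrow> {w ! k, flip_node (w ! Suc k)} \<in> b"
    using w by (auto simp: Q_def l_def)
  have idx: "j = k" if "j < l" "k < l" "node_index (w ! j) = node_index (w ! k)" for j k
    using d that by (simp add: l_def distinct_conv_nth) metis
  let ?z = "w ! (l - 1)"
  have z: "?z \<in> set w" using ne by (simp add: l_def)
  then have zn: "node_index ?z < n" "node_index ?z \<notin> K" using sub by auto
  then obtain y' where y': "{?z, y'} \<in> b" "?z \<noteq> y'"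
    using diagram_edge[OF b, of ?z] by (auto simp: nodes_iff)
  define y where "y = flip_node y'"
  have yn: "node_index y < n" "node_index y \<notin> K"
    using diagram_pair[OF b y'(1)] K[of y' ?z] y'(1) zn by (auto simp: y_def insert_commute)
  have "node_index y \<in> node_index ` set w"
  proof (rule ccontr)
    assume new: "node_index y \<notin> node_index ` set w"
    have "Q (w @ [y])"
      unfolding Q_def
    proof (intro conjI allI impI)
      fix k assume "Suc k < length (w @ [y])"
      then consider "Suc k < l" | "Suc k = l" by (fastforce simp: l_def)
      then show "{(w @ [y]) ! k, flip_node ((w @ [y]) ! Suc k)} \<in> b"
        using edge[of k] y'(1) by cases (auto simp: nth_append l_def[symmetric] y_def)
    qed (use d sub new yn in auto)
    from max[OF this] show False by simp
  qed
  then obtain k where k: "k < l" "node_index y = node_index (w ! k)"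
    by (auto simp: l_def in_set_conv_nth)
  have unique: "v = v'" if "{u, v} \<in> b" "{u, v'} \<in> b" for u v v'
    using partner_eq[OF b that(1)] partner_eq[OF b that(2)] by simp
  have "y = w ! 0"
  proof -
    \<comment> \<open>Either the walk arrives so as to leave again through \<open>w ! k\<close>, and
      then \<open>k = 0\<close>, because the line from a preceding node would otherwise end in the
      same place; or it runs into the node \<open>w ! k\<close> itself, whose line would be walked
      backwards, which is impossible.\<close>
    from k(2) consider "y = w ! k" | "y' = w ! k" by (auto simp: node_index_eq_iff y_def)
    then show ?thesis
    proof cases
      case 1
      show ?thesis
      proof (cases k)
        case (Suc m)
        then have "{w ! m, flip_node (w ! k)} \<in> b" using edge k(1) by simp
        then have "{y', w ! m} \<in> b" using 1 by (simp add: y_def insert_commute flip: 1)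
        then have "w ! m = ?z" using unique[of y'] y'(1) by (simp add: insert_commute)
        then have "m = l - 1" using idx[of m "l - 1"] k(1) Suc ne by simp
        with Suc k(1) ne show ?thesis by simp
      qed (use 1 in simp)
    next
      case 2
      show ?thesis
      proof (cases "Suc k < l")
        case True
        then have "{y', flip_node (w ! Suc k)} \<in> b" using edge 2 by simp
        then have eq: "flip_node (w ! Suc k) = ?z" using unique[of y'] y'(1) by (simp add: insert_commute)
        then have "node_index (w ! Suc k) = node_index ?z" by (metis node_index_flip)
        then have "Suc k = l - 1" using idx[of "Suc k" "l - 1"] True by simp
        with eq show ?thesis by simp
      next
        case False
        then have "k = l - 1" using k(1) by simp
        with 2 y'(2) show ?thesis by simp
      qed
    qed
  qed
  have "set (cyc w) \<subseteq> b"
  proof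
    fix e assume "e \<in> set (cyc w)"
    then obtain k where k: "k < l" "e = cyc w ! k" by (auto simp: in_set_conv_nth l_def)
    then have e: "e = {w ! k, flip_node (w ! (Suc k mod l))}"
      by (simp add: cyc_zip nth_rotate1 l_def)
    show "e \<in> b"
    proof (cases "Suc k < l")
      case True
      then show ?thesis using edge e by simp
    next
      case False
      then have "Suc k = l" using k(1) by simp
      then have "k = l - 1" "Suc k mod l = 0" by auto
      then show ?thesis using e y'(1) \<open>y = w ! 0\<close> by (simp add: y_def flip: \<open>y = w ! 0\<close>)
    qed
  qed
  with ne d sub that show ?thesis by blast
qed

text \<open>A family of disjoint loops with the most indices covers all of them: its lines are all
  the lines at its indices, so \<open>diagram_loop_ex\<close> would find a further loop among the
  rest.\<close>

lemma config_ex: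
  assumes b: "b \<in> diagrams n" obtains ws where "config n ws" "diag ws = b"
proof -
  define Q where "Q ws \<longleftrightarrow> [] \<notin> set ws \<and> distinct (map node_index (concat ws)) \<and>
    node_index ` set (concat ws) \<subseteq> {..<n} \<and> diag ws \<subseteq> b" for ws
  have len: "length (concat ws) = card (node_index ` set (concat ws))" if "Q ws" for ws
    using that distinct_card[of "map node_index (concat ws)"] by (simp add: Q_def del: set_concat)
  have "Q []" by (simp add: Q_def)
  moreover have "length (concat ws) \<le> n" if "Q ws" for ws
  proof -
    have "card (node_index ` set (concat ws)) \<le> card {..<n}"
      using that unfolding Q_def by (intro card_mono) auto
    with len[OF that] show ?thesis by simp
  qed
  ultimately obtain ws where ws: "Q ws" and max: "\<And>vs. Q vs \<Longrightarrow> length (concat vs) \<le> length (concat ws)"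
    using max_nat_ex[of Q "[]" "\<lambda>ws. length (concat ws)" n] by metis
  let ?K = "node_index ` set (concat ws)"
  have "?K = {..<n}"
  proof (rule ccontr)
    assume "?K \<noteq> {..<n}"
    then obtain i where i: "i < n" "i \<notin> ?K" using ws unfolding Q_def by blast
    have closed_word: "node_index y \<in> ?K" if xy: "{x, y} \<in> b" "node_index x \<in> ?K" for x y
    proof -
      from xy(2) obtain z where z: "z \<in> set (concat ws)" "x = z \<or> x = flip_node z"
        by (metis imageE node_index_eq_iff)
      have "\<exists>e\<in>diag ws. x \<in> e \<and> node_index ` e \<subseteq> ?K"
        using z(2)
      proof
        assume "x = z"
        obtain z' where z': "(z, z') \<in> set (nextpairs ws)" using nextpairs_ex z(1) by blast
        then have "{z, flip_node z'} \<in> diag ws" by (force simp: diag_nextpairs)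
        with nextpairs_in[OF z'] \<open>x = z\<close> show ?thesis
          by (intro bexI[of _ "{z, flip_node z'}"]) auto
      next
        assume "x = flip_node z"
        obtain z' where z': "(z', z) \<in> set (nextpairs ws)" using nextpairs_ex z(1) by blast
        then have "{z', flip_node z} \<in> diag ws" by (force simp: diag_nextpairs)
        with nextpairs_in[OF z'] \<open>x = flip_node z\<close> show ?thesis
          by (intro bexI[of _ "{z', flip_node z}"]) auto
      qed
      then obtain e where e: "e \<in> diag ws" "x \<in> e" "node_index ` e \<subseteq> ?K" by blast
      then have "e = {x, y}" using diagram_unique[OF b, of e "{x, y}" x] xy(1) ws by (auto simp: Q_def)
      with e(3) show ?thesis by auto
    qed
    obtain w where w: "w \<noteq> []" "set (cyc w) \<subseteq> b" "distinct (map node_index w)"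
      "node_index ` set w \<subseteq> {..<n} - ?K"
    proof (rule diagram_loop_ex[OF b i])
      show "node_index y \<in> ?K" if "{x, y} \<in> b" "node_index x \<in> ?K" for x y
        using that by (rule closed_word)
    qed blast
    have "Q (w # ws)"
      unfolding Q_def
    proof (intro conjI)
      show "distinct (map node_index (concat (w # ws)))" using w ws by (auto simp: Q_def)
      show "node_index ` set (concat (w # ws)) \<subseteq> {..<n}"
        using w(4) ws unfolding Q_def by (simp only: concat.simps set_append image_Un) blast
    qed (use w ws in \<open>auto simp: Q_def\<close>)
    from max[OF this] w(1) show False by simp
  qed
  then have "set (map node_index (concat ws)) = set [0..<n]" by auto
  then have "mset (map node_index (concat ws)) = mset [0..<n]"
    using ws by (intro set_eq_iff_mset_eq_distinct[THEN iffD1]) (auto simp: Q_def)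
  then have cfg: "config n ws" using ws by (simp add: config_def Q_def)
  show ?thesis
    by (rule that[OF cfg]) (use diagrams_subset_eq[OF diag_diagrams[OF cfg] b] ws in \<open>simp add: Q_def\<close>)
qed

subsection \<open>Realising words by diagrams\<close>

text \<open>The walk prescribes the row of each node and the indices are free. Only the row of the
  end \<open>z\<close> enters, so a closed walk can be lifted before its first node is
  known.\<close>

lemma lift_path:
  assumes "path a w (is_upper z)" "w \<noteq> []" "length ks = length w"
  shows "\<exists>x u. map node_index (x # u) = ks \<and> is_upper x = a \<and> map elab (chain x u z) = map undot w"
  using assms
proof (induction w arbitrary: a ks)
  case (Cons c w)
  then obtain k ks' where ks: "ks = k # ks'" "length ks' = length w" by (cases ks) auto
  let ?x = "if a then Up k else Lo k"
  from Cons.prems obtain a' where a': "undot c = lab a a'" "path a' w (is_upper z)" by auto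
  show ?case
  proof (cases "w = []")
    case True
    then show ?thesis using a' ks by (intro exI[of _ ?x] exI[of _ "[]"]) (simp add: elab_pair)
  next
    case False
    from Cons.IH[OF a'(2) this ks(2)] obtain y u where
      "map node_index (y # u) = ks'" "is_upper y = a'" "map elab (chain y u z) = map undot w" by blast
    then show ?thesis using a' ks by (intro exI[of _ ?x] exI[of _ "y # u"]) (simp add: elab_pair)
  qed
qed simp

lemma chain_elab_cong:
  "is_upper z = is_upper z' \<Longrightarrow> map elab (chain x u z) = map elab (chain x u z')"
  by (induction u arbitrary: x) (auto simp: elab_pair)

text \<open>The walk starts in the lower row whenever the word permits this; so a fit word following the
  first line is read from the lower row to the lower row.\<close>

definition lifts :: "node list \<Rightarrow> letter list \<Rightarrow> bool" where
  "lifts v w \<longleftrightarrow> map elab (cyc v) = map undot w \<and> (is_upper (hd v) \<longleftrightarrow> \<not> path False w False)"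

lemma lift_word:
  assumes "closed_word w" "w \<noteq> []" "length ks = length w"
  shows "\<exists>v. map node_index v = ks \<and> lifts v w"
proof -
  define a where "a \<longleftrightarrow> \<not> path False w False"
  from assms(1) have a: "path a w a" by (cases a) (auto simp: closed_word_def a_def ex_bool_eq)
  \<comment> \<open>A placeholder in the right row, exchanged for the first node by
    \<open>chain_elab_cong\<close>.\<close>
  define z where "z = (if a then Up 0 else Lo 0)"
  have "path a w (is_upper z)" using a by (cases a) (simp_all add: z_def)
  from lift_path[OF this assms(2,3)] obtain x u where
    xu: "map node_index (x # u) = ks" "is_upper x = a" "map elab (chain x u z) = map undot w" by blast
  then have "map elab (chain x u x) = map undot w"
    using chain_elab_cong[of x z] by (simp add: z_def)
  with xu(1,2) show ?thesis by (intro exI[of _ "x # u"]) (simp add: lifts_def a_def)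
qed

lemma lift_words:
  assumes "\<And>w. w \<in> set Ws \<Longrightarrow> closed_word w \<and> w \<noteq> []" "length ks = length (concat Ws)"
  shows "\<exists>ws. map node_index (concat ws) = ks \<and> list_all2 lifts ws Ws"
  using assms
proof (induction Ws arbitrary: ks)
  case (Cons w Ws)
  let ?ks = "take (length w) ks" and ?ks' = "drop (length w) ks"
  have "closed_word w" "w \<noteq> []" "length ?ks = length w" using Cons.prems by auto
  from lift_word[OF this] obtain v where v: "map node_index v = ?ks" "lifts v w" by blast
  have "length ?ks' = length (concat Ws)" using Cons.prems by simp
  then obtain ws where "map node_index (concat ws) = ?ks'" "list_all2 lifts ws Ws"
    using Cons.IH Cons.prems(1) by (metis list.set_intros(2))
  with v show ?case by (intro exI[of _ "v # ws"]) simp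
qed simp

lemma config_lift:
  assumes "\<And>w. w \<in> set Ws \<Longrightarrow> closed_word w \<and> w \<noteq> []"
  obtains n ws where "config n ws" "list_all2 lifts ws Ws"
proof -
  from lift_words[of Ws "[0..<length (concat Ws)]"] assms obtain ws where
    ws: "map node_index (concat ws) = [0..<length (concat Ws)]" "list_all2 lifts ws Ws"
    by auto
  have "[] \<notin> set ws"
  proof
    assume "[] \<in> set ws"
    then obtain i where i: "i < length ws" "ws ! i = []" by (auto simp: in_set_conv_nth)
    with ws(2) have "lifts [] (Ws ! i)" "Ws ! i \<in> set Ws"
      by (auto simp: list_all2_conv_all_nth dest: spec[of _ i])
    then show False using assms[of "Ws ! i"] by (simp add: lifts_def)
  qed
  moreover have "image_mset node_index (mset (concat ws)) = mset [0..<length (concat Ws)]"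
    using ws(1) by (metis mset_map)
  ultimately show ?thesis using ws(2) that by (simp add: config_def)
qed

subsection \<open>Diagrams with the same monomial are conjugate\<close>

primrec relab :: "(nat \<Rightarrow> nat) \<Rightarrow> node \<Rightarrow> node" where
  "relab \<sigma> (Up i) = Up (\<sigma> i)"
| "relab \<sigma> (Lo i) = Lo (\<sigma> i)"

definition conjd :: "(nat \<Rightarrow> nat) \<Rightarrow> diagram \<Rightarrow> diagram" where
  "conjd \<sigma> b = (\<lambda>e. relab \<sigma> ` e) ` b"

lemma relab_flip: "relab \<sigma> (flip_node x) = flip_node (relab \<sigma> x)"
  by (cases x) auto

lemma is_upper_relab [simp]: "is_upper (relab \<sigma> x) = is_upper x"
  by (cases x) auto

lemma node_index_relab [simp]: "node_index (relab \<sigma> x) = \<sigma> (node_index x)"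
  by (cases x) auto

lemma relab_inj: "inj \<sigma> \<Longrightarrow> inj (relab \<sigma>)"
  by (auto simp: inj_def node_eq_iff)

lemma elab_relab: "elab (relab \<sigma> ` e) = elab e"
  by (auto simp: elab_def in_range_Up in_range_Lo image_subset_iff subset_iff)

lemma chain_relab: "chain (relab \<sigma> x) (map (relab \<sigma>) w) (relab \<sigma> z) = map ((`) (relab \<sigma>)) (chain x w z)"
  by (induction w arbitrary: x) (simp_all add: relab_flip)

lemma cyc_relab: "cyc (map (relab \<sigma>) w) = map ((`) (relab \<sigma>)) (cyc w)"
  by (cases w) (simp_all add: chain_relab)

lemma rv_rotate1: "rotate1 (rv (rotate1 w)) = rv w"
proof (cases w)
  case (Cons x u) then show ?thesis by (cases u) auto
qed simp

lemma rv_rotate: "\<exists>k'. rv (rotate k w) = rotate k' (rv w)"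
proof -
  have "rotate k (rv (rotate k w)) = rv w"
  proof (induction k arbitrary: w)
    case (Suc k)
    have "rotate (Suc k) (rv (rotate (Suc k) w)) = rotate k (rotate1 (rv (rotate1 (rotate k w))))"
      by (simp add: rotate1_rotate_swap)
    then show ?case by (simp add: rv_rotate1 Suc)
  qed simp
  then show ?thesis by (metis rotate_inverse)
qed

lemma rv_rv: "rv (rv w) = w"
  by (cases w) auto

lemma requiv_trans: "requiv u v \<Longrightarrow> requiv v w \<Longrightarrow> requiv u w"
  unfolding requiv_def by (metis rotate_rotate rv_rotate rv_rv)

text \<open>Being a rotation of one's own reversal is a property of the cyclic word, so a mark may
  be brought to the front before it is checked.\<close>

lemma rev_rotate_transfer:
  assumes "rev (rotate j w) = rotate k (rotate j w)" shows "\<exists>k. rev w = rotate k w"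
proof -
  obtain j' where "rev (rotate j w) = rotate j' (rev w)" using rev_rotate_ex by blast
  then have "rotate j' (rev w) = rotate (k + j) w" using assms by (simp add: rotate_rotate)
  then show ?thesis by (metis rotate_inverse rotate_rotate)
qed

lemma only_P_replicate: "set w \<subseteq> {P} \<Longrightarrow> w = replicate (length w) P"
  by (intro replicate_eqI) auto

text \<open>For three marks this fails, and a bracelet with three dots would no longer determine the
  dotted diagram up to conjugation.\<close>

lemma two_marks_symmetric:
  assumes "set w \<subseteq> {P, Pd}" "count_list w Pd \<le> 2"
  shows "\<exists>k. rev w = rotate k w"
proof (cases "Pd \<in> set w")
  case False
  then have "w = replicate (length w) P" using assms(1) by (intro only_P_replicate) auto
  then show ?thesis by (metis rev_replicate rotate0 id_apply)
next
  case True
  then obtain x y where w: "w = x @ Pd # y" by (auto dest: split_list)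
  define v where "v = y @ x"
  have r: "rotate (length x) w = Pd # v" by (simp add: w v_def rotate_append)
  have v: "set v \<subseteq> {P, Pd}" "count_list v Pd \<le> 1" using assms by (auto simp: w v_def)
  have "\<exists>k. rev (Pd # v) = rotate k (Pd # v)"
  proof (cases "Pd \<in> set v")
    case False
    then have "v = replicate (length v) P" using v(1) by (intro only_P_replicate) auto
    then have "rev v = v" by (metis rev_replicate)
    then show ?thesis by (intro exI[of _ 1]) simp
  next
    case True
    then obtain p q where pq: "v = p @ Pd # q" by (auto dest: split_list)
    with v have "Pd \<notin> set p" "Pd \<notin> set q" by (auto simp: count_list_0_iff)
    with v(1) pq have "set p \<subseteq> {P}" "set q \<subseteq> {P}" by auto
    then have "p = replicate (length p) P" "q = replicate (length q) P" by (simp_all only: only_P_replicate[symmetric])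
    then have "rev p = p" "rev q = q" by (metis rev_replicate)+
    then have "rev (Pd # v) = q @ (Pd # p @ [Pd])" by (simp add: pq)
    also have "\<dots> = rotate (length (Pd # p @ [Pd])) ((Pd # p @ [Pd]) @ q)"
      by (rule rotate_append[symmetric])
    finally have "rev (Pd # v) = rotate (length (Pd # p @ [Pd])) (Pd # v)"
      by (simp only: pq append_Cons append_assoc append_Nil)
    then show ?thesis by blast
  qed
  then show ?thesis using rev_rotate_transfer[of "length x" w] r by metis
qed

lemma chain_upper_det:
  assumes "map elab (chain x u z) = map elab (chain y v t)" "is_upper x = is_upper y"
  shows "map is_upper u = map is_upper v"
  using assms
proof (induction u arbitrary: x y v)
  case Nil
  then have "length v = 0" by (metis length_chain length_map list.size(3) nat.inject)
  then show ?case by simp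
next
  case (Cons a u)
  then obtain c v' where v: "v = c # v'" by (cases v) (auto dest: arg_cong[where f=length])
  with Cons have "is_upper a = is_upper c" by (simp add: elab_pair lab_eq_iff)
  with Cons v show ?case by auto
qed

lemma chain_upper_const:
  assumes "set (map elab (chain x u z)) \<subseteq> {P}" shows "map is_upper u = replicate (length u) (is_upper x)"
  using assms by (induction u arbitrary: x) (auto simp: elab_pair)

lemma is_upper_rf: "map is_upper (rf t) = rev (map Not (map is_upper t))"
  by (simp add: rf_def rev_map comp_def)

lemma rotate_replicate: "rotate k (replicate m x) = replicate m x"
  by (rule replicate_eqI) auto

text \<open>Equal bracelets match the letters after a rotation and possibly a reversal, but a
  conjugation needs equal rows as well. One equal row forces all others. Opposite rows are possible
  only for words in \<open>P\<close> and \<open>Pd\<close>; a further reversal then exchanges the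
  rows, and having at most two marks lets a rotation restore the word.\<close>

lemma word_align:
  assumes ne: "w \<noteq> []" "w' \<noteq> []"
    and eq: "bracelet_equiv (map L' (cyc w')) (map L (cyc w))"
    and L: "\<And>e. e \<in> set (cyc w) \<Longrightarrow> undot (L e) = elab e"
    and L': "\<And>e. e \<in> set (cyc w') \<Longrightarrow> undot (L' e) = elab e"
    and two: "count_list (map L (cyc w)) Pd \<le> 2"
  shows "\<exists>v. requiv w' v \<and> map L' (cyc v) = map L (cyc w) \<and> map is_upper v = map is_upper w"
proof -
  let ?W = "map L (cyc w)"
  from eq obtain k where "?W = rotate k (map L' (cyc w')) \<or> ?W = rotate k (rev (map L' (cyc w')))"
    by (auto simp: bracelet_equiv_def)
  then have "?W = map L' (cyc (rotate k w')) \<or> ?W = map L' (cyc (rotate k (rv w')))"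
    by (simp add: cyc_rotate cyc_rv rotate_map rev_map)
  moreover have "requiv w' (rotate k w')" "requiv w' (rotate k (rv w'))" by (auto simp: requiv_def)
  ultimately obtain v where v: "requiv w' v" "map L' (cyc v) = ?W" by metis
  have "length (map L' (cyc v)) = length ?W" by (simp only: v(2))
  then have "length v = length w" by simp
  with ne obtain x u y t where xu: "w = x # u" "v = y # t" "length t = length u"
    by (cases w; cases v) auto
  have set_v: "set (cyc v) = set (cyc w')"
    using bracelet_equiv_set[OF requiv_cyc[OF v(1)]] by simp
  have Wu: "map undot ?W = map elab (cyc w)" using L by simp
  have "map undot (map L' (cyc v)) = map elab (cyc v)" using L' set_v by simp
  then have ev: "map elab (cyc v) = map elab (cyc w)" using v(2) Wu by simp
  show ?thesis
  proof (cases "is_upper x = is_upper y")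
    case True
    with chain_upper_det[of y t y x u x] ev xu have "map is_upper v = map is_upper w" by simp
    with v show ?thesis by blast
  next
    case False
    have "path (is_upper x) (map elab (cyc w)) (is_upper x)" "path (is_upper y) (map elab (cyc v)) (is_upper y)"
      using xu by (simp_all add: path_chain)
    then have "set (map undot (map elab (cyc w))) \<subseteq> {P}"
      using False ev by (intro path_ex_NS[of "is_upper x" _ "is_upper x" "is_upper y"]) auto
    then have P: "set (map elab (cyc w)) \<subseteq> {P}" by (simp add: comp_def)
    have PPd: "undot c = P \<Longrightarrow> c \<in> {P, Pd}" for c by (cases c) auto
    have "set ?W \<subseteq> {P, Pd}"
    proof
      fix c assume "c \<in> set ?W"
      then obtain e where e: "e \<in> set (cyc w)" "c = L e" by auto
      then have "elab e = P" using P by auto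
      then have "undot c = P" using L[OF e(1)] e(2) by simp
      then show "c \<in> {P, Pd}" by (rule PPd)
    qed
    from two_marks_symmetric[OF this two] obtain k where "rev ?W = rotate k ?W" by blast
    then obtain k' where k': "rotate k' (rev ?W) = ?W" using rotate_inverse[of k ?W] by auto
    let ?v = "rotate k' (rv v)"
    have "requiv w' ?v" using v(1) by (rule requiv_trans) (auto simp: requiv_def)
    moreover have "map L' (cyc ?v) = ?W"
    proof -
      have "map L' (cyc ?v) = rotate k' (rev (map L' (cyc v)))"
        by (simp only: cyc_rotate cyc_rv rotate_map rev_map)
      then show ?thesis by (simp only: v(2) k')
    qed
    moreover have "map is_upper ?v = map is_upper w"
    proof -
      have "map is_upper u = replicate (length u) (is_upper x)"
        by (rule chain_upper_const[of _ _ x]) (use P xu in simp)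
      then have 1: "map is_upper w = replicate (length w) (is_upper x)" by (simp add: xu)
      have "map is_upper t = replicate (length t) (is_upper y)"
        by (rule chain_upper_const[of _ _ y]) (use P xu ev in simp)
      \<comment> \<open>\<open>rv\<close> flips every node, and all nodes of \<open>v\<close> lie in
        the row opposite to that of \<open>x\<close>.\<close>
      then have "map is_upper (rv v) = replicate (length w) (is_upper x)"
        using xu False by (simp add: is_upper_rf map_replicate)
      then have "map is_upper ?v = replicate (length w) (is_upper x)"
        by (simp only: rotate_map[symmetric] rotate_replicate)
      with 1 show ?thesis by simp
    qed
    ultimately show ?thesis by blast
  qed
qed

lemma permutation_of_lists:
  assumes "distinct xs" "distinct ys" "set xs = {..<n}" "set ys = {..<n}"
  obtains \<sigma> where "\<sigma> permutes {..<n}" "map \<sigma> xs = ys"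
proof -
  have len: "length xs = length ys" using assms by (metis distinct_card)
  define \<sigma> where "\<sigma> i = (if i < n then the (map_of (zip xs ys) i) else i)" for i
  have m: "map \<sigma> xs = ys"
  proof (rule nth_equalityI)
    fix k assume k: "k < length (map \<sigma> xs)"
    then have "xs ! k < n" using assms(3) nth_mem[of k xs] by auto
    then show "map \<sigma> xs ! k = ys ! k"
      using k len assms(1) by (simp add: \<sigma>_def map_of_zip_nth)
  qed (simp add: len)
  have "bij_betw \<sigma> {..<n} {..<n}"
    using assms m by (metis bij_betw_def distinct_map list.set_map)
  then have "\<sigma> permutes {..<n}" by (rule bij_imp_permutes) (simp add: \<sigma>_def)
  with m that show ?thesis by blast
qed

lemma map_eqI_index_upper:
  assumes "map \<sigma> (map node_index w) = map node_index v" "map is_upper v = map is_upper w"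
  shows "v = map (relab \<sigma>) w"
  using assms
proof (induction w arbitrary: v)
  case (Cons x w)
  then show ?case by (cases v) (auto simp: node_eq_iff)
qed simp

text \<open>Once the loops are put in matching order and aligned, the two lists have equal rows
  position by position, and reading off the indices gives the permutation.\<close>

lemma conjugate_configs:
  assumes cfg: "config n ws" "config n ws'"
    and eq: "cmono L ws = cmono L' ws'"
    and L: "\<And>e. e \<in> diag ws \<Longrightarrow> undot (L e) = elab e"
    and L': "\<And>e. e \<in> diag ws' \<Longrightarrow> undot (L' e) = elab e"
    and two: "\<And>w. w \<in> set ws \<Longrightarrow> count_list (map L (cyc w)) Pd \<le> 2"
  obtains \<sigma> where "\<sigma> permutes {..<n}" "diag ws' = conjd \<sigma> (diag ws)"
    "\<And>e. e \<in> diag ws \<Longrightarrow> L' (relab \<sigma> ` e) = L e"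
proof -
  let ?f = "\<lambda>w. bracelet (map L (cyc w))" and ?g = "\<lambda>w. bracelet (map L' (cyc w))"
  have "mset (map ?f ws) = mset (map ?g ws')" using eq by (simp add: cmono_def)
  then obtain p where p: "p permutes {..<length (map ?g ws')}" "permute_list p (map ?g ws') = map ?f ws"
    by (rule mset_eq_permutation)
  define ws1 where "ws1 = permute_list p ws'"
  have 1: "mset ws1 = mset ws'" "map ?g ws1 = map ?f ws"
    using p by (simp_all add: ws1_def permute_list_map)
  define Q where "Q w v \<longleftrightarrow> map L' (cyc v) = map L (cyc w) \<and> map is_upper v = map is_upper w" for w v
  \<comment> \<open>The relational composition collects the aligned words of all loops into one list
    \<open>ws2\<close>.\<close>
  have "list_all2 (Q OO requiv\<inverse>\<inverse>) ws ws1"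
    unfolding list_all2_conv_all_nth
  proof (intro conjI allI impI)
    show len: "length ws = length ws1" using arg_cong[OF 1(2), of length] by simp
    fix k assume k: "k < length ws"
    then have in_ws: "ws ! k \<in> set ws" "ws1 ! k \<in> set ws'"
      using len 1(1) by (auto simp flip: mset_eq_setD[OF 1(1)])
    have "?g (ws1 ! k) = ?f (ws ! k)"
      using arg_cong[OF 1(2), of "\<lambda>x. x ! k"] k len by simp
    then have be: "bracelet_equiv (map L' (cyc (ws1 ! k))) (map L (cyc (ws ! k)))"
      by (simp add: bracelet_eq_iff)
    have "ws ! k \<noteq> []" "ws1 ! k \<noteq> []" using in_ws cfg by (auto simp: config_def)
    then have "\<exists>v. requiv (ws1 ! k) v \<and> map L' (cyc v) = map L (cyc (ws ! k)) \<and> map is_upper v = map is_upper (ws ! k)"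
      by (rule word_align[OF _ _ be]) (use in_ws L L' two in \<open>auto simp: diag_def\<close>)
    then show "(Q OO requiv\<inverse>\<inverse>) (ws ! k) (ws1 ! k)" by (auto simp: Q_def)
  qed
  then obtain ws2 where ws2: "list_all2 Q ws ws2" "list_all2 requiv ws1 ws2"
    unfolding list.rel_compp list.rel_conversep by blast
  have cfg2: "config n ws2"
    using cfg(2) config_permute(1)[OF 1(1)] list_all2_requiv(1)[OF ws2(2)] by blast
  have diag2: "diag ws2 = diag ws'"
    using config_permute(2)[OF 1(1)] list_all2_requiv(2)[OF ws2(2)] by (rule trans[OF sym, rotated])
  obtain \<sigma> where \<sigma>: "\<sigma> permutes {..<n}" "map \<sigma> (map node_index (concat ws)) = map node_index (concat ws2)"
  proof (rule permutation_of_lists)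
    show "distinct (map node_index (concat ws))" "distinct (map node_index (concat ws2))"
      using config_distinct(1)[OF cfg(1)] config_distinct(1)[OF cfg2] by simp_all
    show "set (map node_index (concat ws)) = {..<n}" "set (map node_index (concat ws2)) = {..<n}"
      using config_index[OF cfg(1)] config_index[OF cfg2] by (simp_all only: set_map)
  qed
  have aux: "length v = length w" if "Q w v" for v w
    using arg_cong[of _ _ length, OF conjunct2[OF that[unfolded Q_def]]] by simp
  have "list_all2 (\<lambda>w v. v = map (relab \<sigma>) w) ws ws2"
    using ws2(1) \<sigma>(2)
  proof (induction rule: list_all2_induct)
    case (Cons w ws v ws2)
    have "map \<sigma> (map node_index w) = map node_index v" and rest: "map \<sigma> (map node_index (concat ws)) = map node_index (concat ws2)"
      using Cons.prems aux[OF Cons.hyps(1)] by (simp_all add: append_eq_append_conv)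
    then have "v = map (relab \<sigma>) w"
      using Cons.hyps(1) by (intro map_eqI_index_upper) (simp_all add: Q_def)
    then show ?case using Cons.IH[OF rest] by simp
  qed simp
  then have rel: "ws2 = map (map (relab \<sigma>)) ws"
    by (induction rule: list_all2_induct) simp_all
  show ?thesis
  proof (rule that[OF \<sigma>(1)])
    have "diag ws2 = conjd \<sigma> (diag ws)"
      by (simp add: rel diag_def conjd_def cyc_relab image_UN)
    then show "diag ws' = conjd \<sigma> (diag ws)" by (simp only: diag2)
    fix e assume "e \<in> diag ws"
    then obtain w where w: "w \<in> set ws" "e \<in> set (cyc w)" by (auto simp: diag_def)
    have "Q w (map (relab \<sigma>) w)"
      using ws2(1) w(1) by (simp add: rel list.rel_map list_all2_same)
    then have "map (\<lambda>e. L' (relab \<sigma> ` e)) (cyc w) = map L (cyc w)"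
      by (simp add: Q_def cyc_relab comp_def)
    with w(2) show "L' (relab \<sigma> ` e) = L e" by simp
  qed
qed

subsection \<open>Multiplication by one arc pair\<close>

text \<open>Below \<open>b\<close>, the upper arc of \<open>d\<^sub>i\<^sub>j\<close> joins the lines of \<open>b\<close> ending in the lower nodes \<open>i\<close>
  and \<open>j\<close> to one line, and the lower arc replaces their ends. If these lines are one and the same
  arc, nothing remains of it but a closed_word loop.\<close>

definition dact :: "nat \<Rightarrow> nat \<Rightarrow> diagram \<Rightarrow> diagram" where
  "dact i j b = {e \<in> b. Lo i \<notin> e \<and> Lo j \<notin> e} \<union> {{Lo i, Lo j}} \<union>
     ({\<Union>{e \<in> b. Lo i \<in> e \<or> Lo j \<in> e} - {Lo i, Lo j}} - {{}})"

lemma dact_commute: "dact i j b = dact j i b"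
proof -
  have "{Lo i, Lo j} = {Lo j, Lo i}" by auto
  moreover have "{e \<in> b. Lo i \<notin> e \<and> Lo j \<notin> e} = {e \<in> b. Lo j \<notin> e \<and> Lo i \<notin> e}"
    "{e \<in> b. Lo i \<in> e \<or> Lo j \<in> e} = {e \<in> b. Lo j \<in> e \<or> Lo i \<in> e}" by auto
  ultimately show ?thesis unfolding dact_def by metis
qed

lemma dact_same:
  assumes b: "b \<in> diagrams n" and e: "{Lo i, Lo j} \<in> b" shows "dact i j b = b"
proof -
  have *: "Lo i \<in> x \<or> Lo j \<in> x \<longleftrightarrow> x = {Lo i, Lo j}" if "x \<in> b" for x
    using diagram_unique[OF b that e] by blast
  have "{x \<in> b. Lo i \<in> x \<or> Lo j \<in> x} = {{Lo i, Lo j}}"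
  proof
    show "{x \<in> b. Lo i \<in> x \<or> Lo j \<in> x} \<subseteq> {{Lo i, Lo j}}" using * by blast
  qed (simp add: e)
  moreover have "{x \<in> b. Lo i \<notin> x \<and> Lo j \<notin> x} = b - {{Lo i, Lo j}}"
    using * by blast
  ultimately have "dact i j b = (b - {{Lo i, Lo j}}) \<union> {{Lo i, Lo j}} \<union> ({\<Union>{{Lo i, Lo j}} - {Lo i, Lo j}} - {{}})"
    by (simp only: dact_def)
  also have "\<dots> = (b - {{Lo i, Lo j}}) \<union> {{Lo i, Lo j}}" by simp
  finally show ?thesis using e by blast
qed

context
  fixes n b i j x y
  assumes b: "b \<in> diagrams n" and e1: "{Lo i, x} \<in> b" and e2: "{Lo j, y} \<in> b"
    and ij: "i \<noteq> j" and x: "x \<noteq> Lo j"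
begin

lemma dact_distinct: "y \<noteq> Lo i" "x \<noteq> y" "x \<noteq> Lo i" "y \<noteq> Lo j" "{Lo i, x} \<noteq> {Lo j, y}"
proof -
  show 1: "y \<noteq> Lo i"
    using diagram_unique[OF b e1 e2, of "Lo i"] ij x by (auto simp: doubleton_eq_iff)
  show "x \<noteq> y"
    using diagram_unique[OF b e1 e2, of x] ij 1 by (auto simp: doubleton_eq_iff)
  show "x \<noteq> Lo i" "y \<noteq> Lo j" using diagram_pair[OF b e1] diagram_pair[OF b e2] by auto
  show "{Lo i, x} \<noteq> {Lo j, y}" using ij x by (auto simp: doubleton_eq_iff)
qed

lemma dact_diff: "dact i j b = (b - {{Lo i, x}, {Lo j, y}}) \<union> {{Lo i, Lo j}, {x, y}}"
proof -
  have 1: "Lo i \<in> e \<longleftrightarrow> e = {Lo i, x}" if "e \<in> b" for e using diagram_unique[OF b that e1] by blast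
  have 2: "Lo j \<in> e \<longleftrightarrow> e = {Lo j, y}" if "e \<in> b" for e using diagram_unique[OF b that e2] by blast
  have "{e \<in> b. Lo i \<in> e \<or> Lo j \<in> e} = {{Lo i, x}, {Lo j, y}}"
  proof
    show "{e \<in> b. Lo i \<in> e \<or> Lo j \<in> e} \<subseteq> {{Lo i, x}, {Lo j, y}}" using 1 2 by blast
  qed (simp add: e1 e2)
  moreover have "{e \<in> b. Lo i \<notin> e \<and> Lo j \<notin> e} = b - {{Lo i, x}, {Lo j, y}}"
    using 1 2 by blast
  moreover have "\<Union>{{Lo i, x}, {Lo j, y}} - {Lo i, Lo j} = {x, y}"
    using dact_distinct x by auto
  ultimately have "dact i j b = (b - {{Lo i, x}, {Lo j, y}}) \<union> {{Lo i, Lo j}} \<union> ({{x, y}} - {{}})"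
    by (simp only: dact_def)
  then show ?thesis by (simp add: insert_commute)
qed

text \<open>A perfect matching is never properly contained in another one, so after rebuilding loops
  it is enough to see the two new lines and to check that every other line is an old one.\<close>

lemma dact_eqI:
  assumes b': "b' \<in> diagrams n" and sub: "b' \<subseteq> b \<union> {{Lo i, Lo j}, {x, y}}"
    and new: "{Lo i, Lo j} \<in> b'" "{x, y} \<in> b'"
  shows "dact i j b = b'"
  unfolding dact_diff
proof
  show "b' \<subseteq> (b - {{Lo i, x}, {Lo j, y}}) \<union> {{Lo i, Lo j}, {x, y}}"
  proof
    fix e assume e: "e \<in> b'"
    have "e = {Lo i, Lo j}" if "Lo i \<in> e \<or> Lo j \<in> e"
      using that diagram_unique[OF b' e new(1)] by auto
    then show "e \<in> (b - {{Lo i, x}, {Lo j, y}}) \<union> {{Lo i, Lo j}, {x, y}}" using sub e by auto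
  qed
  show "(b - {{Lo i, x}, {Lo j, y}}) \<union> {{Lo i, Lo j}, {x, y}} \<subseteq> b'"
  proof
    fix e assume "e \<in> (b - {{Lo i, x}, {Lo j, y}}) \<union> {{Lo i, Lo j}, {x, y}}"
    then consider "e \<in> {{Lo i, Lo j}, {x, y}}" | "e \<in> b" "e \<noteq> {Lo i, x}" "e \<noteq> {Lo j, y}" by auto
    then show "e \<in> b'"
    proof cases
      case 2
      have "e \<subseteq> nodes n" "card e = 2" using b 2(1) unfolding diagrams_def by blast+
      then obtain z where z: "z \<in> e" "z \<in> nodes n" by (metis card.empty ex_in_conv subsetD zero_neq_numeral)
      have nz: "z \<noteq> Lo i" "z \<noteq> x" "z \<noteq> Lo j" "z \<noteq> y"
        using 2 z diagram_unique[OF b 2(1) e1, of z] diagram_unique[OF b 2(1) e2, of z] by auto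
      obtain t where t: "{z, t} \<in> b'" using diagram_edge[OF b' z(2)] by blast
      then have "{z, t} \<in> b" using sub nz by (auto simp: doubleton_eq_iff)
      then have "e = {z, t}" using diagram_unique[OF b 2(1) _ z(1)] by simp
      with t show ?thesis by simp
    qed (use new in auto)
  qed
qed

lemma dact_diff_diagrams: "(b - {{Lo i, x}, {Lo j, y}}) \<union> {{Lo i, Lo j}, {x, y}} \<in> diagrams n"
proof -
  let ?b = "(b - {{Lo i, x}, {Lo j, y}}) \<union> {{Lo i, Lo j}, {x, y}}"
  note d = dact_distinct
  have lt: "i < n" "j < n" "node_index x < n" "node_index y < n"
    using diagram_pair[OF b e1] diagram_pair[OF b e2] by auto
  have 1: "e \<subseteq> nodes n \<and> card e = 2" if "e \<in> ?b" for e
  proof (cases "e \<in> b")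
    case True then show ?thesis using b by (simp add: diagrams_def)
  next
    case False
    with that have "e = {Lo i, Lo j} \<or> e = {x, y}" by auto
    then show ?thesis using lt ij d(2) by (auto simp: nodes_iff)
  qed
  have old: "e = e'" if "e \<in> b" "e' \<in> b" "z \<in> e" "z \<in> e'" for e e' z
    using diagram_unique[OF b] that by blast
  have 2: "\<exists>!e. e \<in> ?b \<and> z \<in> e" if z: "z \<in> nodes n" for z
  proof -
    consider "z = Lo i \<or> z = Lo j" | "z = x \<or> z = y" | "z \<noteq> Lo i" "z \<noteq> Lo j" "z \<noteq> x" "z \<noteq> y" by blast
    then show ?thesis
    proof cases
      case 1
      show ?thesis
      proof (rule ex1I[of _ "{Lo i, Lo j}"])
        fix e assume "e \<in> ?b \<and> z \<in> e"
        then show "e = {Lo i, Lo j}" using 1 d x old[of e "{Lo i, x}" "Lo i"] old[of e "{Lo j, y}" "Lo j"] e1 e2 by auto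
      qed (use 1 in auto)
    next
      case 2
      show ?thesis
      proof (rule ex1I[of _ "{x, y}"])
        fix e assume "e \<in> ?b \<and> z \<in> e"
        then show "e = {x, y}" using 2 d x old[of e "{Lo i, x}" x] old[of e "{Lo j, y}" y] e1 e2 by auto
      qed (use 2 in auto)
    next
      case 3
      obtain t where t: "{z, t} \<in> b" using diagram_edge[OF b z] by blast
      show ?thesis
      proof (rule ex1I[of _ "{z, t}"])
        show "{z, t} \<in> ?b \<and> z \<in> {z, t}" using t 3 by (auto simp: doubleton_eq_iff)
        fix e assume "e \<in> ?b \<and> z \<in> e"
        then show "e = {z, t}" using 3 old[of e "{z, t}" z] t by auto
      qed
    qed
  qed
  show ?thesis using 1 2 by (simp add: diagrams_def)
qed

end

lemma dact_cases:
  assumes b: "b \<in> diagrams n" and ij: "i < n" "j < n"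
  obtains "{Lo i, Lo j} \<in> b"
  | x y where "{Lo i, x} \<in> b" "{Lo j, y} \<in> b" "x \<noteq> Lo j"
proof -
  obtain x where x: "{Lo i, x} \<in> b" using diagram_edge[OF b, of "Lo i"] ij by (auto simp: nodes_iff)
  obtain y where y: "{Lo j, y} \<in> b" using diagram_edge[OF b, of "Lo j"] ij by (auto simp: nodes_iff)
  from that x y show ?thesis by (cases "x = Lo j") auto
qed

lemma dact_diagrams:
  assumes b: "b \<in> diagrams n" and ij: "i < n" "j < n" "i \<noteq> j"
  shows "dact i j b \<in> diagrams n"
proof (rule dact_cases[OF b ij(1,2)])
  assume "{Lo i, Lo j} \<in> b" then show ?thesis using dact_same[OF b] b by simp
next
  fix x y assume "{Lo i, x} \<in> b" "{Lo j, y} \<in> b" "x \<noteq> Lo j"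
  then show ?thesis using dact_diff[OF b _ _ ij(3)] dact_diff_diagrams[OF b _ _ ij(3)] by simp
qed

section \<open>Equivariance under conjugation\<close>

lemma conjd_config:
  assumes cfg: "config n ws" and \<sigma>: "\<sigma> permutes {..<n}"
  shows "config n (map (map (relab \<sigma>)) ws)" "diag (map (map (relab \<sigma>)) ws) = conjd \<sigma> (diag ws)"
    "cmono elab (map (map (relab \<sigma>)) ws) = cmono elab ws"
proof -
  have "image_mset node_index (mset (concat (map (map (relab \<sigma>)) ws)))
      = image_mset \<sigma> (image_mset node_index (mset (concat ws)))"
    by (simp add: map_concat[symmetric] image_mset.compositionality comp_def)
  also have "\<dots> = image_mset \<sigma> (mset_set {..<n})"
    using cfg by (simp add: config_def lessThan_atLeast0)
  also have "\<dots> = mset_set {..<n}"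
    using \<sigma> by (subst image_mset_mset_set) (auto simp: permutes_image permutes_inj_on)
  finally show "config n (map (map (relab \<sigma>)) ws)"
    using cfg by (auto simp: config_def lessThan_atLeast0)
  show "diag (map (map (relab \<sigma>)) ws) = conjd \<sigma> (diag ws)"
    by (simp add: diag_def conjd_def cyc_relab image_UN)
  show "cmono elab (map (map (relab \<sigma>)) ws) = cmono elab ws"
    by (simp add: cmono_def cyc_relab elab_relab comp_def)
qed

lemma conjd_diagrams:
  assumes "b \<in> diagrams n" "\<sigma> permutes {..<n}"
  shows "conjd \<sigma> b \<in> diagrams n" "diagram_monomial n (conjd \<sigma> b) = diagram_monomial n b"
proof -
  obtain ws where ws: "config n ws" "diag ws = b" using config_ex[OF assms(1)] by blast
  note c = conjd_config[OF ws(1) assms(2)]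
  show "conjd \<sigma> b \<in> diagrams n" using diag_diagrams[OF c(1)] c(2) ws(2) by simp
  show "diagram_monomial n (conjd \<sigma> b) = diagram_monomial n b"
    using diagram_monomial_config[OF c(1)] diagram_monomial_config[OF ws(1)] c(2,3) ws(2) by simp
qed

lemma conjd_edge_iff:
  assumes "inj \<sigma>" shows "{relab \<sigma> x, relab \<sigma> y} \<in> conjd \<sigma> b \<longleftrightarrow> {x, y} \<in> b"
proof -
  have "inj ((`) (relab \<sigma>))" using relab_inj[OF assms] by (simp add: inj_image_eq_iff inj_def)
  from inj_image_mem_iff[OF this, of "{x, y}" b] show ?thesis by (simp add: conjd_def)
qed

lemma dact_conjd:
  assumes b: "b \<in> diagrams n" and \<sigma>: "\<sigma> permutes {..<n}" and ij: "i < n" "j < n" "i \<noteq> j"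
  shows "dact (\<sigma> i) (\<sigma> j) (conjd \<sigma> b) = conjd \<sigma> (dact i j b)"
proof (rule dact_cases[OF b ij(1,2)])
  have inj: "inj \<sigma>" using \<sigma> by (rule permutes_inj)
  have b': "conjd \<sigma> b \<in> diagrams n" using conjd_diagrams[OF b \<sigma>] by simp
  note iff = conjd_edge_iff[OF inj, of _ _ b]
  {
    assume "{Lo i, Lo j} \<in> b"
    then show ?thesis using dact_same[OF b] dact_same[OF b', of "\<sigma> i" "\<sigma> j"] iff[of "Lo i" "Lo j"] by simp
  next
    fix x y assume xy: "{Lo i, x} \<in> b" "{Lo j, y} \<in> b" "x \<noteq> Lo j"
    have *: "{Lo (\<sigma> i), relab \<sigma> x} \<in> conjd \<sigma> b" "{Lo (\<sigma> j), relab \<sigma> y} \<in> conjd \<sigma> b"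
      using iff[of "Lo i" x] iff[of "Lo j" y] xy by simp_all
    have "\<sigma> i \<noteq> \<sigma> j" using inj ij(3) by (auto dest: injD)
    moreover have "relab \<sigma> x \<noteq> Lo (\<sigma> j)"
      using injD[OF relab_inj[OF inj], of x "Lo j"] xy(3) by auto
    ultimately have "dact (\<sigma> i) (\<sigma> j) (conjd \<sigma> b) = (conjd \<sigma> b - {{Lo (\<sigma> i), relab \<sigma> x}, {Lo (\<sigma> j), relab \<sigma> y}})
        \<union> {{Lo (\<sigma> i), Lo (\<sigma> j)}, {relab \<sigma> x, relab \<sigma> y}}"
      using dact_diff[OF b' *] by simp
    also have "\<dots> = conjd \<sigma> ((b - {{Lo i, x}, {Lo j, y}}) \<union> {{Lo i, Lo j}, {x, y}})"
    proof -
      have "inj ((`) (relab \<sigma>))" using relab_inj[OF inj] by (simp add: inj_image_eq_iff inj_def)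
      then show ?thesis by (simp add: conjd_def image_Un image_set_diff)
    qed
    finally show ?thesis using dact_diff[OF b xy(1,2) ij(3) xy(3)] by simp
  }
qed

text \<open>After passing to conjugacy sums, the contribution of \<open>d_diagram n i j\<close> to
  the product with \<open>A_elt n\<close>.\<close>

definition actV :: "complex \<Rightarrow> nat \<Rightarrow> nat \<Rightarrow> nat \<Rightarrow> diagram \<Rightarrow> bpoly" where
  "actV \<delta> n i j b = Poly_Mapping.single (diagram_monomial n (dact i j b)) (if {Lo i, Lo j} \<in> b then \<delta> else 1)"

lemma actV_commute: "actV \<delta> n i j b = actV \<delta> n j i b"
  unfolding actV_def by (metis dact_commute insert_commute)

lemma actV_conjd:
  assumes b: "b \<in> diagrams n" and \<sigma>: "\<sigma> permutes {..<n}" and ij: "i < n" "j < n" "i \<noteq> j"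
  shows "actV \<delta> n (\<sigma> i) (\<sigma> j) (conjd \<sigma> b) = actV \<delta> n i j b"
  using dact_conjd[OF assms] conjd_diagrams(2)[OF dact_diagrams[OF b ij] \<sigma>]
    conjd_edge_iff[OF permutes_inj[OF \<sigma>], of "Lo i" "Lo j" b]
  by (simp add: actV_def)

definition los :: "node set \<Rightarrow> nat set" where
  "los e = {i. Lo i \<in> e}"

lemma los_pair [simp]: "los {Lo i, x} = insert i (los {x})" "los {Up i, x} = los {x}"
  "los {Lo i} = {i}" "los {Up i} = {}" "los {} = {}"
  by (auto simp: los_def)

text \<open>This turns out to be the trace of the monomial of \<open>b\<close> with dots on the lines \<open>e\<^sub>1\<close> and \<open>e\<^sub>2\<close>.\<close>

definition pairV :: "complex \<Rightarrow> nat \<Rightarrow> diagram \<Rightarrow> node set \<Rightarrow> node set \<Rightarrow> bpoly" where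
  "pairV \<delta> n b e1 e2 = (\<Sum>i\<in>los e1. \<Sum>j\<in>los e2. if i = j then 0 else actV \<delta> n i j b)"

lemma pairV_commute: "pairV \<delta> n b e1 e2 = pairV \<delta> n b e2 e1"
  unfolding pairV_def by (subst sum.swap) (auto intro!: sum.cong simp: actV_commute)

lemma pairV_conjd:
  assumes b: "b \<in> diagrams n" and \<sigma>: "\<sigma> permutes {..<n}" and e: "e1 \<in> b" "e2 \<in> b"
  shows "pairV \<delta> n (conjd \<sigma> b) (relab \<sigma> ` e1) (relab \<sigma> ` e2) = pairV \<delta> n b e1 e2"
proof -
  have inj: "inj \<sigma>" using \<sigma> by (rule permutes_inj)
  have los: "los (relab \<sigma> ` e) = \<sigma> ` los e" for e
  proof -
    have "Lo i = relab \<sigma> x \<longleftrightarrow> (\<exists>k. x = Lo k \<and> i = \<sigma> k)" for i x by (cases x) auto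
    then show ?thesis by (auto simp: los_def image_iff)
  qed
  have lt: "i < n" if "i \<in> los e" "e \<in> b" for i e
    using that b by (auto simp: los_def diagrams_def nodes_iff dest!: subsetD)
  have inj_los: "inj_on \<sigma> A" for A using inj by (rule inj_on_subset) simp
  show ?thesis
    unfolding pairV_def los
    by (auto simp: sum.reindex[OF inj_los] inj_eq[OF inj] intro!: sum.cong actV_conjd[OF b \<sigma>] lt e)
qed

subsection \<open>The effect on words\<close>

text \<open>What remains of \<open>chain a u z\<close> after its first line. The far end of that
  line depends on whether \<open>u\<close> is empty, hence \<open>hd (u @ [z])\<close> in the
  equations about it.\<close>

primrec tch :: "node list \<Rightarrow> node \<Rightarrow> node set list" where
  "tch [] z = []"
| "tch (y # w) z = chain y w z"

lemma chain_tch: "chain a u z = {a, flip_node (hd (u @ [z]))} # tch u z"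
  by (cases u) auto

text \<open>The shape of a reconnection that reverses one stretch: back along \<open>v\<close>,
  across the new line between the far ends, forward along \<open>u\<close>.\<close>

lemma chain_rf_append:
  "chain (flip_node p) (rf v @ u) z =
     rev (tch v p) @ {flip_node (hd (v @ [p])), flip_node (hd (u @ [z]))} # tch u z"
proof (cases v)
  case Nil then show ?thesis using chain_tch[of "flip_node p" u z] by simp
next
  case (Cons y w)
  then show ?thesis
    using chain_tch[of "flip_node y" u z] chain_rf[of p w y] by (simp add: chain_append)
qed

text \<open>The letter of the line joining the other ends of two lines with letters \<open>c\<close> and \<open>d\<close>, each of
  which has a lower end.\<close>

definition join :: "letter \<Rightarrow> letter \<Rightarrow> letter" where
  "join c d = (if c = S \<and> d = S then S else if c = P \<and> d = P then N else P)"

lemma elab_join: "elab {x, y} = join (elab {Lo i, x}) (elab {Lo j, y})"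
  by (cases "is_upper x"; cases "is_upper y") (simp_all add: elab_pair join_def)

lemma actV_single:
  assumes cfg: "config n ws" "config n ws'" and e: "{Lo i, x} \<in> diag ws" "{Lo j, y} \<in> diag ws"
    and ij: "i \<noteq> j" and x: "x \<noteq> Lo j"
    and sub: "diag ws' \<subseteq> diag ws \<union> {{Lo i, Lo j}, {x, y}}"
    and new: "{Lo i, Lo j} \<in> diag ws'" "{x, y} \<in> diag ws'"
  shows "actV \<delta> n i j (diag ws) = Poly_Mapping.single (cmono elab ws') 1"
proof -
  note b = diag_diagrams[OF cfg(1)]
  have "dact i j (diag ws) = diag ws'"
    by (rule dact_eqI[OF b e ij x diag_diagrams[OF cfg(2)] sub new])
  moreover have "{Lo i, Lo j} \<notin> diag ws"
    using diagram_unique[OF b e(1), of "{Lo i, Lo j}" "Lo i"] x ij by (auto simp: doubleton_eq_iff)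
  ultimately show ?thesis by (simp add: actV_def diagram_monomial_config[OF cfg(2)])
qed

lemma config_neq:
  assumes "config n ws" "x \<in> set w" "y \<in> set w'" "w \<in> set ws" "w' \<in> set ws"
  shows "x \<noteq> flip_node y"
  using config_no_flip[OF assms(1), of y] assms by auto

text \<open>For nodes on different loops, the new lower arc enters the loop of \<open>j\<close> at
  its end, that loop is walked backwards, and the joined line leads on into the loop of
  \<open>i\<close>.\<close>

lemma actV_merge:
  assumes cfg: "config n ((Lo i # u) # (Lo j # v) # ws)"
    and c: "map elab (chain (Lo i) u (Lo i)) = c # U" and d: "map elab (chain (Lo j) v (Lo j)) = d # V"
  shows "actV \<delta> n i j (diag ((Lo i # u) # (Lo j # v) # ws)) =
    Poly_Mapping.single (add_mset (bracelet (S # rev V @ join c d # U)) (cmono elab ws)) 1"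
proof -
  let ?ws = "(Lo i # u) # (Lo j # v) # ws" and ?ws' = "(Lo i # Up j # rf v @ u) # ws"
  let ?x = "flip_node (hd (u @ [Lo i]))" and ?y = "flip_node (hd (v @ [Lo j]))"
  have cfg': "config n ?ws'" using cfg by (simp add: config_def ac_simps add_mset_commute)
  have new: "cyc (Lo i # Up j # rf v @ u) = {Lo i, Lo j} # rev (tch v (Lo j)) @ {?y, ?x} # tch u (Lo i)"
    using chain_rf_append[of "Lo j" v u "Lo i"] by simp
  have old: "cyc (Lo i # u) = {Lo i, ?x} # tch u (Lo i)" "cyc (Lo j # v) = {Lo j, ?y} # tch v (Lo j)"
    by (simp_all only: cyc.simps chain_tch[symmetric])
  have "distinct (map node_index (concat ?ws))" by (rule config_distinct[OF cfg])
  then have ij: "i \<noteq> j" by auto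
  have "Lo j \<noteq> flip_node (hd (u @ [Lo i]))"
    by (rule config_neq[OF cfg, where w = "Lo j # v" and w' = "Lo i # u"]) (cases u; auto)+
  then have x: "?x \<noteq> Lo j" by simp
  have "actV \<delta> n i j (diag ?ws) = Poly_Mapping.single (cmono elab ?ws') 1"
    by (rule actV_single[OF cfg cfg' _ _ ij x, where y = ?y]) (use old new in \<open>auto simp: insert_commute\<close>)
  also have "map elab (cyc (Lo i # Up j # rf v @ u)) = S # rev V @ join c d # U"
  proof -
    have "c = elab {Lo i, ?x}" "U = map elab (tch u (Lo i))" "d = elab {Lo j, ?y}" "V = map elab (tch v (Lo j))"
      using c d unfolding chain_tch[of _ u] chain_tch[of _ v] by simp_all
    then show ?thesis unfolding new
      using elab_join[of ?x ?y i j] by (simp add: elab_pair rev_map insert_commute)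
  qed
  then have "cmono elab ?ws' = add_mset (bracelet (S # rev V @ join c d # U)) (cmono elab ws)"
    by (simp only: cmono_simps)
  finally show ?thesis .
qed

text \<open>Both lower nodes are left in the direction of travel, so the stretch between them is
  reversed and the loop stays in one piece.\<close>

lemma actV_same:
  assumes cfg: "config n ((Lo i # u @ Lo j # v) # ws)"
    and c: "map elab (chain (Lo i) u (Lo j)) = c # U" and d: "map elab (chain (Lo j) v (Lo i)) = d # V"
  shows "actV \<delta> n i j (diag ((Lo i # u @ Lo j # v) # ws)) =
    Poly_Mapping.single (add_mset (bracelet (S # rev U @ join c d # V)) (cmono elab ws)) 1"
proof -
  let ?ws = "(Lo i # u @ Lo j # v) # ws" and ?ws' = "(Lo i # Up j # rf u @ v) # ws"
  let ?x = "flip_node (hd (u @ [Lo j]))" and ?y = "flip_node (hd (v @ [Lo i]))"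
  have cfg': "config n ?ws'" using cfg by (simp add: config_def ac_simps add_mset_commute)
  have new: "cyc (Lo i # Up j # rf u @ v) = {Lo i, Lo j} # rev (tch u (Lo j)) @ {?x, ?y} # tch v (Lo i)"
    using chain_rf_append[of "Lo j" u v "Lo i"] by simp
  have old: "cyc (Lo i # u @ Lo j # v) = {Lo i, ?x} # tch u (Lo j) @ {Lo j, ?y} # tch v (Lo i)"
    using chain_tch[of "Lo i" u "Lo j"] chain_tch[of "Lo j" v "Lo i"] by (simp add: chain_append)
  have "distinct (map node_index (concat ?ws))" by (rule config_distinct[OF cfg])
  then have ij: "i \<noteq> j" by auto
  have "Lo j \<noteq> flip_node (hd (u @ [Lo j]))"
    by (rule config_neq[OF cfg, where w = "Lo i # u @ Lo j # v" and w' = "Lo i # u @ Lo j # v"]) (cases u; auto)+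
  then have x: "?x \<noteq> Lo j" by simp
  have "actV \<delta> n i j (diag ?ws) = Poly_Mapping.single (cmono elab ?ws') 1"
    by (rule actV_single[OF cfg cfg' _ _ ij x, where y = ?y]) (use old new in auto)
  also have "map elab (cyc (Lo i # Up j # rf u @ v)) = S # rev U @ join c d # V"
  proof -
    have "c = elab {Lo i, ?x}" "U = map elab (tch u (Lo j))" "d = elab {Lo j, ?y}" "V = map elab (tch v (Lo i))"
      using c d unfolding chain_tch[of _ u] chain_tch[of _ v] by simp_all
    then show ?thesis unfolding new
      using elab_join[of ?x ?y i j] by (simp add: elab_pair rev_map)
  qed
  then have "cmono elab ?ws' = add_mset (bracelet (S # rev U @ join c d # V)) (cmono elab ws)"
    by (simp only: cmono_simps)
  finally show ?thesis .
qed

lemma chain_not_Nil [simp]: "chain a u z \<noteq> []"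
  by (cases u) auto

lemma chain_last: "chain a u z = butlast (chain a u z) @ [{last (a # u), flip_node z}]"
  by (induction u arbitrary: a) auto

lemma butlast_chain: "butlast (chain a u z) = butlast (chain a u t)"
  by (induction u arbitrary: a) auto

text \<open>Listing \<open>Up j\<close> means that the loop arrives at \<open>Lo j\<close>, while
  \<open>Lo i\<close> is left. Both cut lines are the ends of the first stretch, whence the letters
  \<open>c\<close> and \<open>d\<close> there, and the loop falls into two.\<close>

lemma actV_opp:
  assumes cfg: "config n ((Lo i # u @ Up j # v) # ws)"
    and c: "map elab (chain (Lo i) u (Up j)) = c # U @ [d]" and d: "map elab (chain (Up j) v (Lo i)) = V"
  shows "actV \<delta> n i j (diag ((Lo i # u @ Up j # v) # ws)) =
    Poly_Mapping.single (add_mset (bracelet (S # V)) (add_mset (bracelet (join c d # U)) (cmono elab ws))) 1"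
proof -
  obtain y t where u: "u = y # t" using c by (cases u) auto
  let ?ws = "(Lo i # u @ Up j # v) # ws" and ?ws' = "(Lo i # Up j # v) # u # ws"
  let ?x = "flip_node y" and ?y = "last u"
  let ?B = "butlast (chain y t (Up j))"
  have cfg': "config n ?ws'" using cfg by (simp add: config_def u ac_simps add_mset_commute)
  have new: "cyc (Lo i # Up j # v) = {Lo i, Lo j} # chain (Up j) v (Lo i)" "cyc u = ?B @ [{?y, ?x}]"
    using chain_last[of y t y] butlast_chain[of y t y "Up j"] by (simp_all add: u)
  have old: "cyc (Lo i # u @ Up j # v) = {Lo i, ?x} # ?B @ {Lo j, ?y} # chain (Up j) v (Lo i)"
    using chain_last[of y t "Up j"] by (simp add: u chain_append insert_commute)
  have "distinct (map node_index (concat ?ws))" by (rule config_distinct[OF cfg])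
  then have ij: "i \<noteq> j" by auto
  have "Up j \<noteq> y"
    using \<open>distinct _\<close> by (auto simp: u)
  then have x: "?x \<noteq> Lo j" by (cases y) auto
  have 0: "actV \<delta> n i j (diag ?ws) = Poly_Mapping.single (cmono elab ?ws') 1"
    by (rule actV_single[OF cfg cfg' _ _ ij x, where y = ?y]) (use old new in \<open>auto simp: insert_commute\<close>)
  have 1: "map elab (cyc (Lo i # Up j # v)) = S # V"
    unfolding new using d by (simp add: elab_pair)
  have 2: "map elab (cyc u) = U @ [join c d]"
  proof -
    have "c = elab {Lo i, ?x}" "map elab (chain y t (Up j)) = U @ [d]" using c by (simp_all add: u)
    moreover from this(2) have "map elab ?B = U" "d = elab {Lo j, ?y}"
      by (subst (asm) chain_last; simp add: u insert_commute)+
    ultimately show ?thesis unfolding new using elab_join[of ?x ?y i j] by (simp add: insert_commute)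
  qed
  have "bracelet (U @ [join c d]) = bracelet (join c d # U)"
    using bracelet_rotate1[of "join c d # U"] by simp
  with 0 show ?thesis by (simp only: cmono_simps 1 2)
qed

lemma actV_arc:
  assumes cfg: "config n ((Lo i # Up j # v) # ws)"
  shows "actV \<delta> n i j (diag ((Lo i # Up j # v) # ws)) = Poly_Mapping.single (cmono elab ((Lo i # Up j # v) # ws)) \<delta>"
  using dact_same[OF diag_diagrams[OF cfg], of i j] diagram_monomial_config[OF cfg] by (simp add: actV_def)

text \<open>An arc has two lower ends; reading the loop backwards puts the other one in front, so a
  formula for one end serves for both.\<close>

lemma flip_arc:
  assumes cfg: "config n ((Lo i # Up j # v) # ws)"
  shows "config n ((Lo j # Up i # rf v) # ws)" "diag ((Lo j # Up i # rf v) # ws) = diag ((Lo i # Up j # v) # ws)"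
    "chain (Up i) (rf v) (Lo j) = rev (chain (Up j) v (Lo i))"
proof -
  show c: "chain (Up i) (rf v) (Lo j) = rev (chain (Up j) v (Lo i))"
    using chain_rf[of "Lo i" v "Up j"] by simp
  show "config n ((Lo j # Up i # rf v) # ws)" using cfg by (simp add: config_def ac_simps add_mset_commute)
  show "diag ((Lo j # Up i # rf v) # ws) = diag ((Lo i # Up j # v) # ws)"
    using c by (simp add: insert_commute)
qed

subsection \<open>Dotted diagrams\<close>

text \<open>For \<open>e1 = e2\<close> the sum asks for two dots on one line, which only
  \<open>Sdd\<close> carries.\<close>

definition dotted :: "nat \<Rightarrow> node list list \<Rightarrow> (node set \<Rightarrow> letter) \<Rightarrow> node set \<Rightarrow> node set \<Rightarrow> bool" where
  "dotted n ws L e1 e2 \<longleftrightarrow> config n ws \<and> e1 \<in> diag ws \<and> e2 \<in> diag ws \<and>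
     (\<forall>e\<in>diag ws. undot (L e) = elab e \<and> dots (L e) = of_bool (e = e1) + of_bool (e = e2))"

lemma dots_elab [simp]: "dots (elab e) = 0"
  by (simp add: elab_def)

lemma dotted_two:
  assumes "config n ws" "e1 \<in> diag ws" "e2 \<in> diag ws" "e1 \<noteq> e2"
    "undot c1 = elab e1" "dots c1 = 1" "undot c2 = elab e2" "dots c2 = 1"
  shows "dotted n ws (elab(e1 := c1, e2 := c2)) e1 e2"
  using assms by (auto simp: dotted_def)

lemma dotted_one:
  assumes "config n ws" "e \<in> diag ws" "undot c = elab e" "dots c = 2"
  shows "dotted n ws (elab(e := c)) e e"
  using assms by (auto simp: dotted_def)

lemma mdeg_cmono: "mdeg (cmono L ws) = length (concat ws)"
  by (induction ws) (auto simp: mdeg_def blength.abs_eq)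

lemma config_length: "config n ws \<Longrightarrow> length (concat ws) = n"
proof -
  assume "config n ws"
  then have "size (image_mset node_index (mset (concat ws))) = size (mset [0..<n])" by (simp only: config_def)
  then show ?thesis by simp
qed

lemma count_Pd_dots:
  assumes "distinct es"
  shows "count_list (map L es) Pd \<le> (\<Sum>e\<in>set es. dots (L e))"
  using assms by (induction es) auto

text \<open>The permutation matching the monomials carries labels to labels, so dotted lines go to
  dotted lines, possibly interchanged, and \<open>pairV\<close> is both invariant and symmetric. The
  degree of the monomial recovers \<open>n\<close>.\<close>

lemma dotted_pairV_unique:
  assumes d: "dotted n ws L e1 e2" and d': "dotted n' ws' L' e1' e2'"
    and eq: "cmono L ws = cmono L' ws'"
  shows "pairV \<delta> n (diag ws) e1 e2 = pairV \<delta> n' (diag ws') e1' e2'"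
proof -
  have cfg: "config n ws" "config n' ws'" using d d' by (auto simp: dotted_def)
  have "length (concat ws) = length (concat ws')"
    using arg_cong[OF eq, of mdeg] unfolding mdeg_cmono .
  then have n: "n' = n" using cfg config_length by metis
  let ?b = "diag ws"
  have fin: "finite ?b" by (simp add: diag_def)
  \<comment> \<open>There are two dots in the whole diagram, so no loop carries more than two
    marks.\<close>
  have two: "count_list (map L (cyc w)) Pd \<le> 2" if w: "w \<in> set ws" for w
  proof -
    have sub: "set (cyc w) \<subseteq> ?b" using w by (auto simp: diag_def)
    have "distinct (cyc w)" using distinct_edges[OF cfg(1)] w by (auto simp: distinct_concat_iff)
    from count_Pd_dots[OF this] have "count_list (map L (cyc w)) Pd \<le> (\<Sum>e\<in>set (cyc w). dots (L e))" .
    also have "\<dots> \<le> (\<Sum>e\<in>?b. dots (L e))" using sub fin by (intro sum_mono2) auto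
    also have "\<dots> = (\<Sum>e\<in>?b. of_bool (e = e1) + of_bool (e = e2))"
      using d by (intro sum.cong) (auto simp: dotted_def)
    also have "\<dots> = 2" using d fin by (simp add: dotted_def sum.distrib of_bool_def)
    finally show ?thesis .
  qed
  obtain \<sigma> where \<sigma>: "\<sigma> permutes {..<n}" "diag ws' = conjd \<sigma> ?b"
    "\<And>e. e \<in> ?b \<Longrightarrow> L' (relab \<sigma> ` e) = L e"
    by (rule conjugate_configs[OF cfg(1) cfg(2)[unfolded n] eq _ _ two])
      (use d d' in \<open>auto simp: dotted_def\<close>)
  have inj: "inj ((`) (relab \<sigma>))"
    using relab_inj[OF permutes_inj[OF \<sigma>(1)]] by (simp add: inj_image_eq_iff inj_def)
  have dd: "of_bool (relab \<sigma> ` e = e1') + of_bool (relab \<sigma> ` e = e2') = (of_bool (e = e1) + of_bool (e = e2) :: nat)"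
    if e: "e \<in> ?b" for e
  proof -
    have "relab \<sigma> ` e \<in> diag ws'" using e by (simp add: \<sigma>(2) conjd_def)
    then have "of_bool (relab \<sigma> ` e = e1') + of_bool (relab \<sigma> ` e = e2') = dots (L' (relab \<sigma> ` e))"
      using d' by (simp add: dotted_def)
    also have "\<dots> = of_bool (e = e1) + of_bool (e = e2)" using \<sigma>(3)[OF e] d e by (simp add: dotted_def)
    finally show ?thesis .
  qed
  have e: "e1 \<in> ?b" "e2 \<in> ?b" using d by (auto simp: dotted_def)
  have "relab \<sigma> ` e1 = e1' \<and> relab \<sigma> ` e2 = e2' \<or> relab \<sigma> ` e2 = e1' \<and> relab \<sigma> ` e1 = e2'"
    using dd[OF e(1)] dd[OF e(2)] inj_eq[OF inj, of e1 e2]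
    by (cases "relab \<sigma> ` e1 = e1'"; cases "relab \<sigma> ` e1 = e2'"; cases "relab \<sigma> ` e2 = e1'";
        cases "relab \<sigma> ` e2 = e2'"; cases "e1 = e2") simp_all
  then show ?thesis
  proof (elim disjE conjE)
    assume "relab \<sigma> ` e1 = e1'" "relab \<sigma> ` e2 = e2'"
    then show ?thesis
      using pairV_conjd[OF diag_diagrams[OF cfg(1)] \<sigma>(1) e, of \<delta>] by (simp add: n \<sigma>(2))
  next
    assume "relab \<sigma> ` e2 = e1'" "relab \<sigma> ` e1 = e2'"
    then show ?thesis
      using pairV_conjd[OF diag_diagrams[OF cfg(1)] \<sigma>(1) e(2) e(1), of \<delta>]
        pairV_commute[of \<delta> n ?b e1 e2] by (simp add: n \<sigma>(2))
  qed
qed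

subsection \<open>The rules of the trace\<close>

text \<open>The stretch is longer than its first line, because an \<open>S\<close> leads to the
  upper row and \<open>z\<close> lies in the lower one.\<close>

lemma S_head:
  assumes "map elab (chain x a z) = S # u" "\<not> is_upper z"
  obtains i i' a' where "x = Lo i" "a = Up i' # a'" "map elab (chain (Up i') a' z) = u"
proof (cases a)
  case Nil then show ?thesis using assms by (simp add: elab_pair)
next
  case (Cons y a')
  then show ?thesis using assms that by (cases x; cases y) (auto simp: elab_pair)
qed

lemma P_head:
  assumes "map elab (chain (Lo i) a z) = P # u"
  obtains k where "hd (a @ [z]) = Lo k" "chain (Lo i) a z = {Lo i, Up k} # tch a z" "map elab (tch a z) = u"
proof -
  have "lab False (is_upper (hd (a @ [z]))) = P" "map elab (tch a z) = u"
    using assms by (simp_all add: chain_tch elab_pair)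
  then show ?thesis using that chain_tch[of "Lo i" a z] by (cases "hd (a @ [z])") auto
qed

lemma chain_split:
  assumes "map f (chain x a z) = U @ W" "U \<noteq> []" "W \<noteq> []"
  obtains a1 y a2 where "a = a1 @ y # a2" "map f (chain x a1 y) = U" "map f (chain y a2 z) = W"
proof -
  have "\<exists>a1 y a2. a = a1 @ y # a2 \<and> map f (chain x a1 y) = U \<and> map f (chain y a2 z) = W"
    using assms
  proof (induction U arbitrary: x a)
    case (Cons c U)
    show ?case
    proof (cases a)
      case Nil
      then show ?thesis using Cons.prems by simp
    next
      case (Cons y a')
      note a = Cons
      show ?thesis
      proof (cases "U = []")
        case True
        then show ?thesis using Cons.prems a by (intro exI[of _ "[]"] exI[of _ y] exI[of _ a']) simp
      next
        case False
        have "map f (chain y a' z) = U @ W" "f {x, flip_node y} = c" using Cons.prems(1) a by auto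
        from Cons.IH[OF this(1) False Cons.prems(3)] obtain a1 t a2
          where "a' = a1 @ t # a2" "map f (chain y a1 t) = U" "map f (chain t a2 z) = W" by blast
        then show ?thesis using a \<open>f {x, flip_node y} = c\<close>
          by (intro exI[of _ "y # a1"] exI[of _ t] exI[of _ a2]) simp
      qed
    qed
  qed simp
  then show ?thesis using that by blast
qed

lemma bracelet_swap: "bracelet (u @ v) = bracelet (v @ u)"
proof -
  have "bracelet_equiv (u @ v) (v @ u)"
    unfolding bracelet_equiv_def by (intro exI[of _ "length u"]) (simp add: rotate_append)
  then show ?thesis by (simp add: bracelet_eq_iff)
qed

lemma bracelet_swap2: "bracelet (c # u @ d # v) = bracelet (d # v @ c # u)"
  using bracelet_swap[of "c # u" "d # v"] by simp

lemma bracelet_reverse2: "bracelet (c # rev u @ d # v) = bracelet (d # u @ c # rev v)"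
proof -
  have "bracelet (c # rev u @ d # v) = bracelet (rev v @ (d # u @ [c]))"
    using bracelet_rev[of "c # rev u @ d # v"] by simp
  then show ?thesis using bracelet_swap[of "rev v" "d # u @ [c]"] by simp
qed

lemma bracelet_reverse1: "bracelet (c # rev u) = bracelet (c # u)"
  using bracelet_rev[of "c # rev u"] bracelet_swap[of u "[c]"] by simp

lemma br_mult: "br u * br v = Poly_Mapping.single {#bracelet u, bracelet v#} 1"
  by (simp add: br_def mult_single add_mset_commute)

lemma br_times_single: "br u * Poly_Mapping.single M c = Poly_Mapping.single (add_mset (bracelet u) M) c"
  by (simp add: br_def mult_single)

lemma br_in_poly_bar_2: "br w \<in> poly_bar_2 \<Longrightarrow> closed_word w"
  by (auto simp: poly_bar_2_def br_def bracelet_in_frakb_bar_iff)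

lemma br_mult_in_poly_bar_2: "br u * br v \<in> poly_bar_2 \<Longrightarrow> closed_word u \<and> closed_word v"
  by (auto simp: poly_bar_2_def br_mult bracelet_in_frakb_bar_iff)

lemma mset_frakb_words:
  assumes "set_mset M \<subseteq> frakb"
  obtains Ms where "M = mset (map bracelet Ms)" "\<And>w. w \<in> set Ms \<Longrightarrow> w \<noteq> [] \<and> closed_word w \<and> set w \<subseteq> letters"
proof -
  have "\<exists>Ms. M = mset (map bracelet Ms) \<and> (\<forall>w\<in>set Ms. w \<noteq> [] \<and> closed_word w \<and> set w \<subseteq> letters)"
    using assms
  proof (induction M)
    case (add x M)
    then obtain Ms where Ms: "M = mset (map bracelet Ms)" "\<forall>w\<in>set Ms. w \<noteq> [] \<and> closed_word w \<and> set w \<subseteq> letters" by auto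
    obtain w where w: "x = bracelet w" by (induct x rule: bracelet.abs_induct) blast
    then show ?case using add.prems Ms by (intro exI[of _ "w # Ms"]) (auto simp: bracelet_in_frakb_iff)
  qed (auto intro: exI[of _ "[]"])
  with that show ?thesis by blast
qed

lemma cmono_lifts:
  assumes "list_all2 lifts vs Ms" "\<And>w. w \<in> set Ms \<Longrightarrow> set w \<subseteq> letters"
  shows "cmono elab vs = mset (map bracelet Ms)"
  using assms by (induction rule: list_all2_induct) (simp_all add: lifts_def map_undot_letters)

lemma cmono_upd [simp]: "e \<notin> diag vs \<Longrightarrow> cmono (L(e := c)) vs = cmono L vs"
proof (induction vs)
  case (Cons v vs)
  have "map (L(e := c)) es = map L es" if "e \<notin> set es" for es using that by (intro map_cong) auto
  with Cons show ?case by (simp del: fun_upd_apply)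
qed simp

text \<open>A candidate value of the trace, computed on some dotted diagram and free of any spelling
  of the bracelets; \<open>dotted_pairV_unique\<close> makes it depend on the monomial only.\<close>

definition realises :: "complex \<Rightarrow> monomial \<Rightarrow> bpoly \<Rightarrow> bool" where
  "realises \<delta> m r \<longleftrightarrow> (\<exists>n ws L e1 e2. dotted n ws L e1 e2 \<and> cmono L ws = m \<and> pairV \<delta> n (diag ws) e1 e2 = r)"

context
  fixes M :: monomial and vs and \<delta> :: complex
  assumes M: "M = cmono elab vs"
begin

abbreviation (input) mon :: "monomial \<Rightarrow> bpoly" where "mon m \<equiv> Poly_Mapping.single m 1"

lemma not_in_rest:
  assumes "config n (v # vs)" "e \<in> set (cyc v)" shows "e \<notin> diag vs"
  using distinct_edges[OF assms(1)] assms(2) by (auto simp: diag_def)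

lemma not_in_rest2:
  assumes "config n (v # w # vs)" "e \<in> set (cyc v) \<union> set (cyc w)" shows "e \<notin> diag vs"
  using distinct_edges[OF assms(1)] assms(2) by (auto simp: diag_def)

text \<open>Both ordered pairs of ends of the arc leave the diagram unchanged and close one loop,
  whence \<open>2 * \<delta>\<close>.\<close>

lemma realises_ss_same:
  assumes cfg: "config n (v # vs)" and v: "lifts v (Sdd # u)" and u: "set u \<subseteq> letters"
  shows "realises \<delta> (add_mset (bracelet (Sdd # u)) M) (cpoly (2 * \<delta>) * br (S # u) * mon M)"
proof -
  from v obtain x a where xa: "v = x # a" "map elab (chain x a x) = S # u"
    by (cases v) (auto simp: lifts_def map_undot_letters[OF u])
  have "\<not> is_upper x"
    using xa(2) chain_tch[of x a x] by (cases x) (auto simp: elab_pair)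
  obtain i i' a' where x: "x = Lo i" "a = Up i' # a'" and "map elab (chain (Up i') a' x) = u"
    by (rule S_head[OF xa(2) \<open>\<not> is_upper x\<close>])
  then have u': "map elab (chain (Up i') a' (Lo i)) = u" by simp
  let ?e = "{Lo i, Lo i'}" and ?b = "diag (v # vs)"
  have v': "v = Lo i # Up i' # a'" using xa x by simp
  have cyc: "cyc v = ?e # chain (Up i') a' (Lo i)" by (simp add: v')
  have "distinct (cyc v)" using distinct_edges[OF cfg] by simp
  then have ne: "?e \<notin> set (chain (Up i') a' (Lo i))" by (simp add: cyc)
  have dist: "i \<noteq> i'" using config_distinct(1)[OF cfg] by (auto simp: v')
  have "dotted n (v # vs) (elab(?e := Sdd)) ?e ?e"
    using cfg by (intro dotted_one) (auto simp: cyc elab_pair)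
  moreover have "cmono (elab(?e := Sdd)) (v # vs) = add_mset (bracelet (Sdd # u)) M"
    using not_in_rest[OF cfg, of ?e] ne by (simp add: cyc u' M)
  moreover have "pairV \<delta> n ?b ?e ?e = cpoly (2 * \<delta>) * br (S # u) * mon M"
  proof -
    have "actV \<delta> n i i' ?b = Poly_Mapping.single (cmono elab (v # vs)) \<delta>"
      using actV_arc[of n i i' a' vs \<delta>] cfg by (simp add: v')
    moreover have "cmono elab (v # vs) = add_mset (bracelet (S # u)) M"
      by (simp add: cyc u' M elab_pair)
    moreover have "pairV \<delta> n ?b ?e ?e = actV \<delta> n i i' ?b + actV \<delta> n i i' ?b"
      using dist actV_commute[of \<delta> n i' i ?b] by (simp add: pairV_def)
    ultimately show ?thesis
      by (simp add: cpoly_def br_def mult_single flip: single_add)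
  qed
  ultimately show ?thesis unfolding realises_def by blast
qed

text \<open>The two pairs that use the end \<open>i\<close> of the first arc: for \<open>j\<close>
  the directions agree, for \<open>j'\<close> they are opposite.\<close>

lemma actV_same_word:
  assumes cfg: "config n ((Lo i # Up i' # a @ Lo j # Up j' # c) # vs)"
    and u: "map elab (chain (Up i') a (Lo j)) = u" and w: "map elab (chain (Up j') c (Lo i)) = w"
  shows "actV \<delta> n i j (diag ((Lo i # Up i' # a @ Lo j # Up j' # c) # vs)) = br (S # u @ S # rev w) * mon M"
    "actV \<delta> n i j' (diag ((Lo i # Up i' # a @ Lo j # Up j' # c) # vs)) = br (S # u) * br (S # w) * mon M"
proof -
  have "actV \<delta> n i j (diag ((Lo i # (Up i' # a) @ Lo j # (Up j' # c)) # vs)) =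
      mon (add_mset (bracelet (S # rev u @ join S S # w)) (cmono elab vs))"
    by (rule actV_same) (use cfg u w in \<open>simp_all add: elab_pair\<close>)
  then show "actV \<delta> n i j (diag ((Lo i # Up i' # a @ Lo j # Up j' # c) # vs)) = br (S # u @ S # rev w) * mon M"
    by (simp add: M join_def br_times_single bracelet_reverse2)
  have "actV \<delta> n i j' (diag ((Lo i # (Up i' # a @ [Lo j]) @ Up j' # c) # vs)) =
      mon (add_mset (bracelet (S # w)) (add_mset (bracelet (join S S # u)) (cmono elab vs)))"
    by (rule actV_opp) (use cfg u w in \<open>simp_all add: elab_pair chain_append\<close>)
  then show "actV \<delta> n i j' (diag ((Lo i # Up i' # a @ Lo j # Up j' # c) # vs)) = br (S # u) * br (S # w) * mon M"
    by (simp add: M join_def mult.assoc br_times_single add_mset_commute)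
qed

text \<open>Of the four pairs of lower ends two agree in direction and two are opposite, which
  explains the factor 2 and the two kinds of terms.\<close>

lemma realises_ss:
  assumes cfg: "config n (v # vs)" and v: "lifts v (Sd # u @ Sd # w)"
    and uw: "set u \<subseteq> letters" "set w \<subseteq> letters"
  shows "realises \<delta> (add_mset (bracelet (Sd # u @ Sd # w)) M)
     (2 * (br (S # u @ S # rev w) + br (S # u) * br (S # w)) * mon M)"
proof -
  from v obtain x a where xa: "v = x # a" "map elab (chain x a x) = (S # u) @ (S # w)"
    by (cases v) (auto simp: lifts_def map_undot_letters uw)
  have x: "\<not> is_upper x"
    using xa(2) chain_tch[of x a x] by (cases x) (auto simp: elab_pair)
  obtain a1 y a2 where a: "a = a1 @ y # a2" "map elab (chain x a1 y) = S # u" "map elab (chain y a2 x) = S # w"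
    by (rule chain_split[OF xa(2)]) auto
  obtain j j' c where y: "y = Lo j" "a2 = Up j' # c" "map elab (chain (Up j') c x) = w"
    by (rule S_head[OF a(3) x])
  have "\<not> is_upper y" by (simp add: y)
  obtain i i' d where x': "x = Lo i" "a1 = Up i' # d" "map elab (chain (Up i') d y) = u"
    by (rule S_head[OF a(2) \<open>\<not> is_upper y\<close>])
  have v': "v = Lo i # Up i' # d @ Lo j # Up j' # c" by (simp add: xa a y x')
  let ?e = "{Lo i, Lo i'}" and ?f = "{Lo j, Lo j'}" and ?b = "diag (v # vs)"
  let ?A = "chain (Up i') d (Lo j)" and ?B = "chain (Up j') c (Lo i)"
  have u: "map elab ?A = u" and w: "map elab ?B = w" using x' y by simp_all
  have cyc: "cyc v = ?e # ?A @ ?f # ?B" by (simp add: v' chain_append)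
  have "distinct (cyc v)" using distinct_edges[OF cfg] by simp
  then have ne: "?e \<notin> set ?A" "?e \<notin> set ?B" "?f \<notin> set ?A" "?f \<notin> set ?B" "?e \<noteq> ?f" by (auto simp: cyc)
  have dist: "i \<noteq> i'" "j \<noteq> j'" "i \<noteq> j" "i \<noteq> j'" "i' \<noteq> j" "i' \<noteq> j'"
    using config_distinct(1)[OF cfg] by (auto simp: v')
  have "dotted n (v # vs) (elab(?e := Sd, ?f := Sd)) ?e ?f"
    using cfg ne by (intro dotted_two) (auto simp: cyc elab_pair)
  moreover have "cmono (elab(?e := Sd, ?f := Sd)) (v # vs) = add_mset (bracelet (Sd # u @ Sd # w)) M"
    using not_in_rest[OF cfg, of ?e] not_in_rest[OF cfg, of ?f] ne by (simp add: cyc u w M)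
  moreover have "pairV \<delta> n ?b ?e ?f = 2 * (br (S # u @ S # rev w) + br (S # u) * br (S # w)) * mon M"
  proof -
    have cfg1: "config n ((Lo i # Up i' # d @ Lo j # Up j' # c) # vs)" using cfg v' by simp
    note 1 = actV_same_word[OF cfg1 u w]
    \<comment> \<open>Read backwards from \<open>i'\<close>, the same diagram shows the remaining
      two pairs in the form already computed.\<close>
    have eq: "Lo i' # Up i # rf (d @ Lo j # Up j' # c) = Lo i' # Up i # rf c @ Lo j' # Up j # rf d" by simp
    note fl = flip_arc[OF cfg1, unfolded eq]
    have "map elab (chain (Up i) (rf c) (Lo j')) = rev w" "map elab (chain (Up j) (rf d) (Lo i')) = rev u"
      using chain_rf[of "Lo i" c "Up j'"] chain_rf[of "Lo j" d "Up i'"] u w by (simp_all add: rev_map[symmetric])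
    note 2 = actV_same_word[OF fl(1) this, unfolded fl(2)]
    have b: "bracelet (S # rev w @ S # u) = bracelet (S # u @ S # rev w)" by (rule bracelet_swap2)
    have "pairV \<delta> n ?b ?e ?f = actV \<delta> n i j ?b + actV \<delta> n i j' ?b + (actV \<delta> n i' j ?b + actV \<delta> n i' j' ?b)"
      using dist by (simp add: pairV_def add.commute)
    also have "\<dots> = 2 * (br (S # u @ S # rev w) + br (S # u) * br (S # w)) * mon M"
      using 1 2 by (simp add: v' br_def b bracelet_reverse1 algebra_simps)
    finally show ?thesis .
  qed
  ultimately show ?thesis unfolding realises_def by blast
qed

lemma flip_arc2:
  assumes cfg: "config n (w # (Lo i # Up j # v) # ws)"
  shows "config n (w # (Lo j # Up i # rf v) # ws)"
    "diag (w # (Lo j # Up i # rf v) # ws) = diag (w # (Lo i # Up j # v) # ws)"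
    "chain (Up i) (rf v) (Lo j) = rev (chain (Up j) v (Lo i))"
proof -
  show c: "chain (Up i) (rf v) (Lo j) = rev (chain (Up j) v (Lo i))"
    using chain_rf[of "Lo i" v "Up j"] by simp
  show "config n (w # (Lo j # Up i # rf v) # ws)"
    using cfg by (simp add: config_def ac_simps add_mset_commute)
  show "diag (w # (Lo j # Up i # rf v) # ws) = diag (w # (Lo i # Up j # v) # ws)"
    using c by (simp add: insert_commute)
qed

lemma lifts_Cons:
  assumes "lifts v (c # w)" "set w \<subseteq> letters"
  obtains x a where "v = x # a" "map elab (chain x a x) = undot c # w"
    "path False (c # w) False \<Longrightarrow> \<not> is_upper x"
  using assms by (cases v) (auto simp: lifts_def map_undot_letters)

text \<open>All four pairs merge the loops. Changing the end on one arc reverses one word relative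
  to the other, and changing both reverses the whole bracelet, so each of the two bracelets arises
  twice.\<close>

lemma realises_s_s:
  assumes cfg: "config n (v # v' # vs)" and v: "lifts v (Sd # u)" "lifts v' (Sd # w)"
    and uw: "set u \<subseteq> letters" "set w \<subseteq> letters"
  shows "realises \<delta> (add_mset (bracelet (Sd # u)) (add_mset (bracelet (Sd # w)) M))
     (2 * (br (S # u @ S # w) + br (S # u @ S # rev w)) * mon M)"
proof -
  from v obtain x a y c where xa: "v = x # a" "map elab (chain x a x) = S # u"
    and yc: "v' = y # c" "map elab (chain y c y) = S # w"
    by (cases v; cases v') (auto simp: lifts_def map_undot_letters uw)
  have x: "\<not> is_upper x" "\<not> is_upper y"
    using xa(2) yc(2) chain_tch[of x a x] chain_tch[of y c y] by (cases x; cases y; auto simp: elab_pair)+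
  obtain i i' a' where x': "x = Lo i" "a = Up i' # a'" "map elab (chain (Up i') a' x) = u"
    by (rule S_head[OF xa(2) x(1)])
  obtain j j' c' where y': "y = Lo j" "c = Up j' # c'" "map elab (chain (Up j') c' y) = w"
    by (rule S_head[OF yc(2) x(2)])
  let ?e = "{Lo i, Lo i'}" and ?f = "{Lo j, Lo j'}" and ?b = "diag (v # v' # vs)"
  let ?A = "chain (Up i') a' (Lo i)" and ?B = "chain (Up j') c' (Lo j)"
  have vv: "v = Lo i # Up i' # a'" "v' = Lo j # Up j' # c'" using xa yc x' y' by simp_all
  have u: "map elab ?A = u" and w: "map elab ?B = w" using x' y' by simp_all
  have cyc: "cyc v = ?e # ?A" "cyc v' = ?f # ?B" by (simp_all add: vv)
  have "distinct (cyc v @ cyc v')" using distinct_edges[OF cfg] by auto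
  then have ne: "?e \<notin> set ?A" "?e \<notin> set ?B" "?f \<notin> set ?A" "?f \<notin> set ?B" "?e \<noteq> ?f" by (auto simp: cyc)
  have dist: "i \<noteq> i'" "j \<noteq> j'" "i \<noteq> j" "i \<noteq> j'" "i' \<noteq> j" "i' \<noteq> j'"
    using config_distinct(1)[OF cfg] by (auto simp: vv)
  have "dotted n (v # v' # vs) (elab(?e := Sd, ?f := Sd)) ?e ?f"
    using cfg ne by (intro dotted_two) (auto simp: cyc elab_pair)
  moreover have "cmono (elab(?e := Sd, ?f := Sd)) (v # v' # vs) = add_mset (bracelet (Sd # u)) (add_mset (bracelet (Sd # w)) M)"
    using not_in_rest2[OF cfg, of ?e] not_in_rest2[OF cfg, of ?f] ne by (simp add: cyc u w M)
  moreover have "pairV \<delta> n ?b ?e ?f = 2 * (br (S # u @ S # w) + br (S # u @ S # rev w)) * mon M"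
  proof -
    have merge: "actV \<delta> n i j (diag ((Lo i # Up i' # a) # (Lo j # Up j' # c) # vs)) = br (S # rev w @ S # u) * mon M"
      if "config n ((Lo i # Up i' # a) # (Lo j # Up j' # c) # vs)"
        "map elab (chain (Up i') a (Lo i)) = u" "map elab (chain (Up j') c (Lo j)) = w" for i i' a j j' c u w
    proof -
      have "actV \<delta> n i j (diag ((Lo i # Up i' # a) # (Lo j # Up j' # c) # vs)) =
          mon (add_mset (bracelet (S # rev w @ join S S # u)) (cmono elab vs))"
        by (rule actV_merge) (use that in \<open>simp_all add: elab_pair\<close>)
      then show ?thesis by (simp add: M join_def br_times_single)
    qed
    have cfg1: "config n ((Lo i # Up i' # a') # (Lo j # Up j' # c') # vs)" using cfg vv by simp
    note f1 = flip_arc[OF cfg1]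
    note f2 = flip_arc2[OF cfg1]
    note f12 = flip_arc[OF f2(1), unfolded f2(2)]
    have ra: "map elab (chain (Up i) (rf a') (Lo i')) = rev u" and rc: "map elab (chain (Up j) (rf c') (Lo j')) = rev w"
      using f1(3) f2(3) u w by (simp_all add: rev_map[symmetric])
    have "pairV \<delta> n ?b ?e ?f = actV \<delta> n i j ?b + actV \<delta> n i j' ?b + (actV \<delta> n i' j ?b + actV \<delta> n i' j' ?b)"
      using dist by (simp add: pairV_def add.commute)
    also have "\<dots> = br (S # rev w @ S # u) * mon M + br (S # rev (rev w) @ S # u) * mon M
       + (br (S # rev w @ S # rev u) * mon M + br (S # rev (rev w) @ S # rev u) * mon M)"
      using merge[OF cfg1 u w] merge[OF f2(1) u rc] merge[OF f1(1) ra w] merge[OF f12(1) ra rc]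
      unfolding f1(2) f2(2) f12(2) vv by simp
    also have "\<dots> = 2 * (br (S # u @ S # w) + br (S # u @ S # rev w)) * mon M"
    proof -
      have "bracelet (S # rev w @ S # u) = bracelet (S # u @ S # rev w)"
        "bracelet (S # w @ S # u) = bracelet (S # u @ S # w)" by (rule bracelet_swap2)+
      moreover have "bracelet (S # w @ S # rev u) = bracelet (S # u @ S # rev w)"
        using bracelet_swap2[of S w S "rev u"] bracelet_reverse2[of S u S w] by simp
      moreover have "bracelet (S # rev w @ S # rev u) = bracelet (S # u @ S # w)"
        using bracelet_reverse2[of S w S "rev u"] bracelet_swap2[of S w S u] by simp
      ultimately show ?thesis by (simp add: br_def algebra_simps)
    qed
    finally show ?thesis .
  qed
  ultimately show ?thesis unfolding realises_def by blast
qed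

lemma lower_of_path:
  assumes "path False w c" "map elab (chain (Lo i) a y) = w"
  shows "is_upper y = c"
proof -
  have "path False (map elab (chain (Lo i) a y)) (is_upper y)" using path_chain[of "Lo i" a y elab] by simp
  then show ?thesis using assms path_det by blast
qed

text \<open>Fitness of \<open>u\<close> means that the dotted \<open>P\<close> is walked upwards,
  from its single lower end; this end paired with the two ends of the arc gives the two
  terms.\<close>

lemma realises_ps:
  assumes cfg: "config n (v # vs)" and v: "lifts v (Pd # u @ Sd # w)" and cl: "closed_word (Pd # u @ Sd # w)"
    and uw: "set u \<subseteq> letters" "set w \<subseteq> letters" and fit: "path False u False"
  shows "realises \<delta> (add_mset (bracelet (Pd # u @ Sd # w)) M)
     ((br (P # u @ S # rev w) + br (P # u) * br (S # w)) * mon M)"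
proof -
  obtain p where p: "path p (Pd # u @ Sd # w) p" using cl by (auto simp: closed_word_def)
  \<comment> \<open>The letter \<open>Sd\<close> after \<open>u\<close> can only be left from the
    lower row.\<close>
  then have "path p u False" by (auto simp: path_append)
  then have "p = False" using path_inj fit by blast
  with p have start: "path False (Pd # u @ Sd # w) False" by simp
  from v obtain x a where xa: "v = x # a" "map elab (chain x a x) = (P # u) @ (S # w)" "\<not> is_upper x"
    using start by (cases v) (auto simp: lifts_def map_undot_letters uw)
  then obtain i where x: "x = Lo i" by (cases x) auto
  obtain a1 y a2 where a: "a = a1 @ y # a2" "map elab (chain x a1 y) = P # u" "map elab (chain y a2 x) = S # w"
    by (rule chain_split[OF xa(2)]) auto
  obtain j j' c where y: "y = Lo j" "a2 = Up j' # c" "map elab (chain (Up j') c x) = w"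
    by (rule S_head[OF a(3) xa(3)])
  have a1: "map elab (chain (Lo i) a1 (Lo j)) = P # u" using a(2) by (simp add: x y)
  obtain k where k: "chain (Lo i) a1 (Lo j) = {Lo i, Up k} # tch a1 (Lo j)" "map elab (tch a1 (Lo j)) = u"
    by (rule P_head[OF a1])
  have v': "v = Lo i # a1 @ Lo j # Up j' # c" by (simp add: xa a y x)
  let ?e = "{Lo i, Up k}" and ?f = "{Lo j, Lo j'}" and ?b = "diag (v # vs)"
  let ?A = "tch a1 (Lo j)" and ?B = "chain (Up j') c (Lo i)"
  have w: "map elab ?B = w" using x y by simp
  have cyc: "cyc v = ?e # ?A @ ?f # ?B" by (simp add: v' chain_append k)
  have "distinct (cyc v)" using distinct_edges[OF cfg] by simp
  then have ne: "?e \<notin> set ?A" "?e \<notin> set ?B" "?f \<notin> set ?A" "?f \<notin> set ?B" "?e \<noteq> ?f" by (auto simp: cyc)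
  have dist: "j \<noteq> j'" "i \<noteq> j" "i \<noteq> j'"
    using config_distinct(1)[OF cfg] by (auto simp: v')
  have "dotted n (v # vs) (elab(?e := Pd, ?f := Sd)) ?e ?f"
    using cfg ne by (intro dotted_two) (auto simp: cyc elab_pair)
  moreover have "cmono (elab(?e := Pd, ?f := Sd)) (v # vs) = add_mset (bracelet (Pd # u @ Sd # w)) M"
    using not_in_rest[OF cfg, of ?e] not_in_rest[OF cfg, of ?f] ne by (simp add: cyc k w M)
  moreover have "pairV \<delta> n ?b ?e ?f = (br (P # u @ S # rev w) + br (P # u) * br (S # w)) * mon M"
  proof -
    have "actV \<delta> n i j (diag ((Lo i # a1 @ Lo j # (Up j' # c)) # vs)) =
        mon (add_mset (bracelet (S # rev u @ join P S # w)) (cmono elab vs))"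
      by (rule actV_same) (use cfg a1 w v' in \<open>simp_all add: elab_pair\<close>)
    moreover have "actV \<delta> n i j' (diag ((Lo i # (a1 @ [Lo j]) @ Up j' # c) # vs)) =
        mon (add_mset (bracelet (S # w)) (add_mset (bracelet (join P S # u)) (cmono elab vs)))"
      by (rule actV_opp) (use cfg a1 w v' in \<open>simp_all add: elab_pair chain_append\<close>)
    moreover have "pairV \<delta> n ?b ?e ?f = actV \<delta> n i j ?b + actV \<delta> n i j' ?b"
      using dist by (simp add: pairV_def)
    ultimately show ?thesis
      by (simp add: v' M join_def bracelet_reverse2 distrib_right mult.assoc br_times_single add_mset_commute)
  qed
  ultimately show ?thesis unfolding realises_def by blast
qed

lemma merge_word:
  assumes "config n ((Lo i # a) # (Lo j # c) # vs)"
    "map elab (chain (Lo i) a (Lo i)) = P # u" "map elab (chain (Lo j) c (Lo j)) = d # w"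
  shows "actV \<delta> n i j (diag ((Lo i # a) # (Lo j # c) # vs)) = br (join P d # u @ S # rev w) * mon M"
proof -
  have "actV \<delta> n i j (diag ((Lo i # a) # (Lo j # c) # vs)) =
      mon (add_mset (bracelet (S # rev w @ join P d # u)) (cmono elab vs))"
    by (rule actV_merge) (use assms in simp_all)
  then show ?thesis using bracelet_swap2[of S "rev w" "join P d" u] by (simp add: M br_times_single)
qed

text \<open>The single lower end of the \<open>P\<close> meets the two ends of the arc, which give
  the two relative directions of the merged words.\<close>

lemma realises_p_s:
  assumes cfg: "config n (v # v' # vs)" and v: "lifts v (Pd # u)" "lifts v' (Sd # w)"
    and uw: "set u \<subseteq> letters" "set w \<subseteq> letters" and fit: "path False u False"
  shows "realises \<delta> (add_mset (bracelet (Pd # u)) (add_mset (bracelet (Sd # w)) M))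
     ((br (P # u @ S # w) + br (P # u @ S # rev w)) * mon M)"
proof -
  have "path False (Pd # u) False" using fit by (simp add: ex_bool_eq)
  then obtain x a where xa: "v = x # a" "map elab (chain x a x) = P # u" "\<not> is_upper x"
    using lifts_Cons[OF v(1) uw(1)] by auto
  obtain y c where yc: "v' = y # c" "map elab (chain y c y) = S # w"
    by (rule lifts_Cons[OF v(2) uw(2)]) auto
  have y: "\<not> is_upper y"
    using yc(2) chain_tch[of y c y] by (cases y) (auto simp: elab_pair)
  obtain i where x: "x = Lo i" using xa by (cases x) auto
  obtain j j' c' where y': "y = Lo j" "c = Up j' # c'" "map elab (chain (Up j') c' y) = w"
    by (rule S_head[OF yc(2) y])
  have a1: "map elab (chain (Lo i) a (Lo i)) = P # u" using xa(2) by (simp add: x)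
  obtain k where k: "chain (Lo i) a (Lo i) = {Lo i, Up k} # tch a (Lo i)" "map elab (tch a (Lo i)) = u"
    by (rule P_head[OF a1])
  let ?e = "{Lo i, Up k}" and ?f = "{Lo j, Lo j'}" and ?b = "diag (v # v' # vs)"
  let ?A = "tch a (Lo i)" and ?B = "chain (Up j') c' (Lo j)"
  have vv: "v = Lo i # a" "v' = Lo j # Up j' # c'" using xa yc x y' by simp_all
  have w: "map elab ?B = w" using y' by simp
  have cyc: "cyc v = ?e # ?A" "cyc v' = ?f # ?B" by (simp_all add: vv k)
  have "distinct (cyc v @ cyc v')" using distinct_edges[OF cfg] by auto
  then have ne: "?e \<notin> set ?A" "?e \<notin> set ?B" "?f \<notin> set ?A" "?f \<notin> set ?B" "?e \<noteq> ?f" by (auto simp: cyc)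
  have dist: "j \<noteq> j'" "i \<noteq> j" "i \<noteq> j'"
    using config_distinct(1)[OF cfg] by (auto simp: vv)
  have "dotted n (v # v' # vs) (elab(?e := Pd, ?f := Sd)) ?e ?f"
    using cfg ne by (intro dotted_two) (auto simp: cyc elab_pair)
  moreover have "cmono (elab(?e := Pd, ?f := Sd)) (v # v' # vs) = add_mset (bracelet (Pd # u)) (add_mset (bracelet (Sd # w)) M)"
    using not_in_rest2[OF cfg, of ?e] not_in_rest2[OF cfg, of ?f] ne by (simp add: cyc k w M)
  moreover have "pairV \<delta> n ?b ?e ?f = (br (P # u @ S # w) + br (P # u @ S # rev w)) * mon M"
  proof -
    have cfg1: "config n ((Lo i # a) # (Lo j # Up j' # c') # vs)" using cfg vv by simp
    note f2 = flip_arc2[OF cfg1]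
    have "map elab (chain (Lo j) (Up j' # c') (Lo j)) = S # w" using w by (simp add: elab_pair)
    from merge_word[OF cfg1 a1 this]
    have 1: "actV \<delta> n i j ?b = br (P # u @ S # rev w) * mon M" by (simp add: vv join_def)
    have "map elab (chain (Lo j') (Up j # rf c') (Lo j')) = S # rev w"
      using f2(3) w by (simp add: elab_pair rev_map[symmetric])
    from merge_word[OF f2(1) a1 this]
    have 2: "actV \<delta> n i j' ?b = br (P # u @ S # w) * mon M" unfolding f2(2) by (simp add: vv join_def)
    have "pairV \<delta> n ?b ?e ?f = actV \<delta> n i j ?b + actV \<delta> n i j' ?b"
      using dist by (simp add: pairV_def)
    then show ?thesis using 1 2 by (simp add: algebra_simps)
  qed
  ultimately show ?thesis unfolding realises_def by blast
qed

text \<open>Each line has one lower end, and joining the two upper ends makes the new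
  \<open>N\<close>; fitness of both words says that both lines are walked upwards.\<close>

lemma realises_p_p:
  assumes cfg: "config n (v # v' # vs)" and v: "lifts v (Pd # u)" "lifts v' (Pd # w)"
    and uw: "set u \<subseteq> letters" "set w \<subseteq> letters" and fit: "path False u False" "path False w False"
  shows "realises \<delta> (add_mset (bracelet (Pd # u)) (add_mset (bracelet (Pd # w)) M))
     (br (N # u @ S # rev w) * mon M)"
proof -
  have st: "path False (Pd # u) False" "path False (Pd # w) False" using fit by (simp_all add: ex_bool_eq)
  obtain x a where xa: "v = x # a" "map elab (chain x a x) = P # u" "\<not> is_upper x"
    using lifts_Cons[OF v(1) uw(1)] st by auto
  obtain y c where yc: "v' = y # c" "map elab (chain y c y) = P # w" "\<not> is_upper y"
    using lifts_Cons[OF v(2) uw(2)] st by auto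
  obtain i where x: "x = Lo i" using xa by (cases x) auto
  obtain j where y: "y = Lo j" using yc by (cases y) auto
  have a1: "map elab (chain (Lo i) a (Lo i)) = P # u" using xa(2) by (simp add: x)
  obtain k where k: "chain (Lo i) a (Lo i) = {Lo i, Up k} # tch a (Lo i)" "map elab (tch a (Lo i)) = u"
    by (rule P_head[OF a1])
  have c1: "map elab (chain (Lo j) c (Lo j)) = P # w" using yc(2) by (simp add: y)
  obtain l where l: "chain (Lo j) c (Lo j) = {Lo j, Up l} # tch c (Lo j)" "map elab (tch c (Lo j)) = w"
    by (rule P_head[OF c1])
  let ?e = "{Lo i, Up k}" and ?f = "{Lo j, Up l}" and ?b = "diag (v # v' # vs)"
  let ?A = "tch a (Lo i)" and ?B = "tch c (Lo j)"
  have vv: "v = Lo i # a" "v' = Lo j # c" using xa yc x y by simp_all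
  have cyc: "cyc v = ?e # ?A" "cyc v' = ?f # ?B" by (simp_all add: vv k l)
  have "distinct (cyc v @ cyc v')" using distinct_edges[OF cfg] by auto
  then have ne: "?e \<notin> set ?A" "?e \<notin> set ?B" "?f \<notin> set ?A" "?f \<notin> set ?B" "?e \<noteq> ?f" by (auto simp: cyc)
  have dist: "i \<noteq> j"
    using config_distinct(1)[OF cfg] by (auto simp: vv)
  have "dotted n (v # v' # vs) (elab(?e := Pd, ?f := Pd)) ?e ?f"
    using cfg ne by (intro dotted_two) (auto simp: cyc elab_pair)
  moreover have "cmono (elab(?e := Pd, ?f := Pd)) (v # v' # vs) = add_mset (bracelet (Pd # u)) (add_mset (bracelet (Pd # w)) M)"
    using not_in_rest2[OF cfg, of ?e] not_in_rest2[OF cfg, of ?f] ne by (simp add: cyc k l M)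
  moreover have "pairV \<delta> n ?b ?e ?f = br (N # u @ S # rev w) * mon M"
    using dist merge_word[OF cfg[unfolded vv] a1 c1] by (simp add: pairV_def vv join_def)
  ultimately show ?thesis unfolding realises_def by blast
qed

text \<open>Both dotted lines are walked upwards, so the directions agree and one word is
  reversed.\<close>

lemma realises_pp_fit:
  assumes cfg: "config n (v # vs)" and v: "lifts v (Pd # u @ Pd # w)"
    and uw: "set u \<subseteq> letters" "set w \<subseteq> letters" and fit: "path False u False" "path False w False"
  shows "realises \<delta> (add_mset (bracelet (Pd # u @ Pd # w)) M) (br (N # u @ S # rev w) * mon M)"
proof -
  have "path False (Pd # u @ Pd # w) False" using fit by (auto simp: path_append)
  with v obtain x a where xa: "v = x # a" "map elab (chain x a x) = (P # u) @ (P # w)" "\<not> is_upper x"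
    by (cases v) (auto simp: lifts_def map_undot_letters uw)
  then obtain i where x: "x = Lo i" by (cases x) auto
  obtain a1 y c where a: "a = a1 @ y # c" "map elab (chain x a1 y) = P # u" "map elab (chain y c x) = P # w"
    by (rule chain_split[OF xa(2)]) auto
  have "\<not> is_upper y" using lower_of_path[of "P # u" False i a1 y] fit(1) a(2) by (simp add: x ex_bool_eq)
  then obtain j where y: "y = Lo j" by (cases y) auto
  have a1: "map elab (chain (Lo i) a1 (Lo j)) = P # u" using a(2) by (simp add: x y)
  obtain k where k: "chain (Lo i) a1 (Lo j) = {Lo i, Up k} # tch a1 (Lo j)" "map elab (tch a1 (Lo j)) = u"
    by (rule P_head[OF a1])
  have c1: "map elab (chain (Lo j) c (Lo i)) = P # w" using a(3) by (simp add: x y)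
  obtain l where l: "chain (Lo j) c (Lo i) = {Lo j, Up l} # tch c (Lo i)" "map elab (tch c (Lo i)) = w"
    by (rule P_head[OF c1])
  have v': "v = Lo i # a1 @ Lo j # c" by (simp add: xa a y x)
  let ?e = "{Lo i, Up k}" and ?f = "{Lo j, Up l}" and ?b = "diag (v # vs)"
  let ?A = "tch a1 (Lo j)" and ?B = "tch c (Lo i)"
  have cyc: "cyc v = ?e # ?A @ ?f # ?B" by (simp add: v' chain_append k l)
  have "distinct (cyc v)" using distinct_edges[OF cfg] by simp
  then have ne: "?e \<notin> set ?A" "?e \<notin> set ?B" "?f \<notin> set ?A" "?f \<notin> set ?B" "?e \<noteq> ?f" by (auto simp: cyc)
  have dist: "i \<noteq> j"
    using config_distinct(1)[OF cfg] by (auto simp: v')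
  have "dotted n (v # vs) (elab(?e := Pd, ?f := Pd)) ?e ?f"
    using cfg ne by (intro dotted_two) (auto simp: cyc elab_pair)
  moreover have "cmono (elab(?e := Pd, ?f := Pd)) (v # vs) = add_mset (bracelet (Pd # u @ Pd # w)) M"
    using not_in_rest[OF cfg, of ?e] not_in_rest[OF cfg, of ?f] ne by (simp add: cyc k l M)
  moreover have "pairV \<delta> n ?b ?e ?f = br (N # u @ S # rev w) * mon M"
    using dist actV_same[OF cfg[unfolded v'] a1 c1]
    by (simp add: pairV_def v' join_def br_times_single bracelet_reverse2 M)
  ultimately show ?thesis unfolding realises_def by blast
qed

text \<open>More \<open>S\<close> than \<open>N\<close> makes \<open>u\<close> lead from the lower
  to the upper row, so the second dotted line is walked downwards and the loop splits.\<close>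

lemma realises_pp_split:
  assumes cfg: "config n (v # vs)" and v: "lifts v (Pd # u @ Pd # w)" and cl: "closed_word (Pd # u @ Pd # w)"
    and uw: "set u \<subseteq> letters" "set w \<subseteq> letters" and more: "count_list u S > count_list u N"
  shows "realises \<delta> (add_mset (bracelet (Pd # u @ Pd # w)) M) (br (N # u) * br (S # w) * mon M)"
proof -
  from cl obtain p q where p: "path p u q" "path q w p" by (auto simp: closed_word_def path_append)
  have "p = False \<and> q = True"
    using path_count[OF p(1)] more by (cases p; cases q) (simp_all add: map_undot_letters uw)
  with p have start: "path False u True" "path True w False" by auto
  then have "path False (Pd # u @ Pd # w) False" by (auto simp: path_append)
  with v obtain x a where xa: "v = x # a" "map elab (chain x a x) = (P # u) @ (P # w)" "\<not> is_upper x"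
    by (cases v) (auto simp: lifts_def map_undot_letters uw)
  then obtain i where x: "x = Lo i" by (cases x) auto
  obtain a1 y c where a: "a = a1 @ y # c" "map elab (chain x a1 y) = P # u" "map elab (chain y c x) = P # w"
    by (rule chain_split[OF xa(2)]) auto
  have "is_upper y" using lower_of_path[of "P # u" True i a1 y] start(1) a(2) by (simp add: x ex_bool_eq)
  then obtain l where y: "y = Up l" by (cases y) auto
  have a1: "map elab (chain (Lo i) a1 (Up l)) = P # u" using a(2) by (simp add: x y)
  obtain k where k: "chain (Lo i) a1 (Up l) = {Lo i, Up k} # tch a1 (Up l)" "map elab (tch a1 (Up l)) = u"
    by (rule P_head[OF a1])
  have c1: "map elab (chain (Up l) c (Lo i)) = P # w" using a(3) by (simp add: x y)
  \<comment> \<open>The second dotted line starts in the upper row; as a \<open>P\<close> it ends at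
    a lower node \<open>Lo j\<close>, and crossing over leads to \<open>Up j\<close>.\<close>
  obtain j c' where c: "c = Up j # c'"
  proof (cases c)
    case Nil then show ?thesis using c1 by (simp add: elab_pair)
  next
    case (Cons z c') then show ?thesis using c1 that by (cases z) (auto simp: elab_pair)
  qed
  have w: "map elab (chain (Up j) c' (Lo i)) = w" using c1 by (simp add: c)
  have v': "v = Lo i # (a1 @ [Up l]) @ Up j # c'" by (simp add: xa a y x c)
  let ?e = "{Lo i, Up k}" and ?f = "{Up l, Lo j}" and ?b = "diag (v # vs)"
  let ?A = "tch a1 (Up l)" and ?B = "chain (Up j) c' (Lo i)"
  have cyc: "cyc v = ?e # ?A @ ?f # ?B" by (simp add: v' chain_append k)
  have "distinct (cyc v)" using distinct_edges[OF cfg] by simp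
  then have ne: "?e \<notin> set ?A" "?e \<notin> set ?B" "?f \<notin> set ?A" "?f \<notin> set ?B" "?e \<noteq> ?f" by (auto simp: cyc)
  have dist: "i \<noteq> j"
    using config_distinct(1)[OF cfg] by (auto simp: v')
  have "dotted n (v # vs) (elab(?e := Pd, ?f := Pd)) ?e ?f"
    using cfg ne by (intro dotted_two) (auto simp: cyc elab_pair)
  moreover have "cmono (elab(?e := Pd, ?f := Pd)) (v # vs) = add_mset (bracelet (Pd # u @ Pd # w)) M"
    using not_in_rest[OF cfg, of ?e] not_in_rest[OF cfg, of ?f] ne by (simp add: cyc k w M)
  moreover have "pairV \<delta> n ?b ?e ?f = br (N # u) * br (S # w) * mon M"
  proof -
    have "map elab (chain (Lo i) (a1 @ [Up l]) (Up j)) = P # u @ [P]"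
      using a1 by (simp add: chain_append elab_pair)
    from actV_opp[OF cfg[unfolded v'] this w] dist show ?thesis
      by (simp add: pairV_def v' join_def mult.assoc br_times_single add_mset_commute M)
  qed
  ultimately show ?thesis unfolding realises_def by blast
qed

end

text \<open>The words of the rule and of an undotted cofactor \<open>M\<close> are lifted together
  into one configuration; the cofactor is what later yields linearity over undotted
  polynomials.\<close>

lemma tau_rule_realises:
  assumes rule: "tau_rule \<delta> l r" and l: "l \<in> poly_bar_2" and M: "set_mset M \<subseteq> frakb"
  obtains m where "l = Poly_Mapping.single m 1" "realises \<delta> (m + M) (r * Poly_Mapping.single M 1)"
proof -
  note result = that
  obtain Ms where Ms: "M = mset (map bracelet Ms)" "\<And>w. w \<in> set Ms \<Longrightarrow> w \<noteq> [] \<and> closed_word w \<and> set w \<subseteq> letters"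
    by (rule mset_frakb_words[OF M]) blast
  have one: "\<exists>n v vs. config n (v # vs) \<and> lifts v w \<and> M = cmono elab vs"
    if w: "closed_word w" "w \<noteq> []" for w
  proof -
    obtain n ws where ws: "config n ws" "list_all2 lifts ws (w # Ms)"
      by (rule config_lift[of "w # Ms"]) (use w Ms in auto)
    then obtain v vs where v: "ws = v # vs" "lifts v w" "list_all2 lifts vs Ms"
      by (auto simp: list_all2_Cons2)
    have "cmono elab vs = M" using cmono_lifts[OF v(3)] Ms by simp
    then show ?thesis using ws(1) v by blast
  qed
  have two: "\<exists>n v v' vs. config n (v # v' # vs) \<and> lifts v w \<and> lifts v' w' \<and> M = cmono elab vs"
    if w: "closed_word w" "closed_word w'" "w \<noteq> []" "w' \<noteq> []" for w w'
  proof -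
    obtain n ws where ws: "config n ws" "list_all2 lifts ws (w # w' # Ms)"
      by (rule config_lift[of "w # w' # Ms"]) (use w Ms in auto)
    then obtain v v' vs where v: "ws = v # v' # vs" "lifts v w" "lifts v' w'" "list_all2 lifts vs Ms"
      by (auto simp: list_all2_Cons2)
    have "cmono elab vs = M" using cmono_lifts[OF v(4)] Ms by simp
    then show ?thesis using ws(1) v by blast
  qed
  have res1: thesis if "l = br w" "realises \<delta> (add_mset (bracelet w) M) (r * Poly_Mapping.single M 1)" for w
    using that by (intro result[of "{#bracelet w#}"]) (simp_all add: br_def)
  have res2: thesis if "l = br w * br w'"
    "realises \<delta> (add_mset (bracelet w) (add_mset (bracelet w') M)) (r * Poly_Mapping.single M 1)" for w w'
    using that by (intro result[of "{#bracelet w, bracelet w'#}"]) (simp_all add: br_mult)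
  from rule show thesis
  proof cases
    case (ss_same u)
    note l = ss_same(1)
    have cl: "closed_word (Sdd # u)" using \<open>l \<in> poly_bar_2\<close> br_in_poly_bar_2 l by simp
    obtain n v vs where v: "config n (v # vs)" "lifts v (Sdd # u)" "M = cmono elab vs" using one[OF cl] by auto
    show ?thesis by (rule res1[OF l]) (use realises_ss_same[OF v(3,1,2)] ss_same in simp)
  next
    case (ss u w)
    note l = ss(1)
    have cl: "closed_word (Sd # u @ Sd # w)" using \<open>l \<in> poly_bar_2\<close> br_in_poly_bar_2 l by simp
    obtain n v vs where v: "config n (v # vs)" "lifts v (Sd # u @ Sd # w)" "M = cmono elab vs" using one[OF cl] by auto
    show ?thesis by (rule res1[OF l]) (use realises_ss[OF v(3,1,2)] ss in simp)
  next
    case (s_s u w)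
    note l = s_s(1)
    have cl: "closed_word (Sd # u)" "closed_word (Sd # w)" using \<open>l \<in> poly_bar_2\<close> br_mult_in_poly_bar_2 l by simp_all
    obtain n v v' vs where v: "config n (v # v' # vs)" "lifts v (Sd # u)" "lifts v' (Sd # w)" "M = cmono elab vs"
      using two[OF cl] by auto
    show ?thesis by (rule res2[OF l]) (use realises_s_s[OF v(4,1,2,3)] s_s in simp)
  next
    case (ps u w)
    note l = ps(1)
    have cl: "closed_word (Pd # u @ Sd # w)" using \<open>l \<in> poly_bar_2\<close> br_in_poly_bar_2 l by simp
    obtain n v vs where v: "config n (v # vs)" "lifts v (Pd # u @ Sd # w)" "M = cmono elab vs" using one[OF cl] by auto
    show ?thesis by (rule res1[OF l]) (use realises_ps[OF v(3,1,2) cl] ps fit_iff in simp)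
  next
    case (p_s u w)
    note l = p_s(1)
    have cl: "closed_word (Pd # u)" "closed_word (Sd # w)" using \<open>l \<in> poly_bar_2\<close> br_mult_in_poly_bar_2 l by simp_all
    obtain n v v' vs where v: "config n (v # v' # vs)" "lifts v (Pd # u)" "lifts v' (Sd # w)" "M = cmono elab vs"
      using two[OF cl] by auto
    show ?thesis by (rule res2[OF l]) (use realises_p_s[OF v(4,1,2,3)] p_s fit_iff in simp)
  next
    case (pp_fit u w)
    note l = pp_fit(1)
    have cl: "closed_word (Pd # u @ Pd # w)" using \<open>l \<in> poly_bar_2\<close> br_in_poly_bar_2 l by simp
    obtain n v vs where v: "config n (v # vs)" "lifts v (Pd # u @ Pd # w)" "M = cmono elab vs" using one[OF cl] by auto
    show ?thesis by (rule res1[OF l]) (use realises_pp_fit[OF v(3,1,2)] pp_fit fit_iff in simp)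
  next
    case (pp_split u w)
    note l = pp_split(1)
    have cl: "closed_word (Pd # u @ Pd # w)" using \<open>l \<in> poly_bar_2\<close> br_in_poly_bar_2 l by simp
    obtain n v vs where v: "config n (v # vs)" "lifts v (Pd # u @ Pd # w)" "M = cmono elab vs" using one[OF cl] by auto
    show ?thesis by (rule res1[OF l]) (use realises_pp_split[OF v(3,1,2) cl] pp_split in simp)
  next
    case (p_p u w)
    note l = p_p(1)
    have cl: "closed_word (Pd # u)" "closed_word (Pd # w)" using \<open>l \<in> poly_bar_2\<close> br_mult_in_poly_bar_2 l by simp_all
    obtain n v v' vs where v: "config n (v # v' # vs)" "lifts v (Pd # u)" "lifts v' (Pd # w)" "M = cmono elab vs"
      using two[OF cl] by auto
    show ?thesis by (rule res2[OF l]) (use realises_p_p[OF v(4,1,2,3)] p_p fit_iff in simp)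
  qed
qed

subsection \<open>Every two-dotted monomial is covered by a rule\<close>

lemma dots_0_letters: "sum_list (map dots u) = 0 \<longleftrightarrow> set u \<subseteq> letters"
proof -
  have "dots c = 0 \<longleftrightarrow> c \<in> letters" for c by (cases c) (auto simp: letters_def)
  then show ?thesis by (induction u) auto
qed

lemma dots_split:
  assumes "sum_list (map dots w) = d" "d > 0"
  obtains x c y where "w = x @ c # y" "dots c > 0" "dots c + sum_list (map dots (y @ x)) = d"
proof -
  have "\<exists>c\<in>set w. dots c > 0"
  proof (rule ccontr)
    assume "\<not> ?thesis"
    then have "sum_list (map dots w) = 0" by (induction w) auto
    with assms show False by simp
  qed
  then obtain c where c: "c \<in> set w" "dots c > 0" by blast
  from split_list[OF c(1)] obtain x y where "w = x @ c # y" by blast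
  with c(2) assms(1) show ?thesis by (intro that[of x c y]) auto
qed

lemma dots_1: "dots c = 1 \<Longrightarrow> c = Sd \<or> c = Pd"
  by (cases c) auto

lemma dots_2: "dots c = 2 \<Longrightarrow> c = Sdd"
  by (cases c) auto

text \<open>Reversing the bracelet exchanges the rows of a closed walk, so one of the two directions
  makes the word after \<open>Pd\<close> fit.\<close>

lemma one_dot:
  assumes "\<beta> \<in> frakb_bar" "bdots \<beta> = 1"
  shows "(\<exists>u. \<beta> = bracelet (Sd # u) \<and> set u \<subseteq> letters) \<or>
    (\<exists>u. \<beta> = bracelet (Pd # u) \<and> set u \<subseteq> letters \<and> fit u)"
proof -
  obtain w where w: "\<beta> = bracelet w" by (induct \<beta> rule: bracelet.abs_induct) blast
  with assms have cl: "closed_word w" and d: "sum_list (map dots w) = 1"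
    by (simp_all add: bracelet_in_frakb_bar_iff bdots.abs_eq)
  obtain x c y where xy: "w = x @ c # y" "dots c > 0" "dots c + sum_list (map dots (y @ x)) = 1"
    by (rule dots_split[OF d]) auto
  define u where "u = y @ x"
  have "dots c + sum_list (map dots u) = 1" using xy(3) by (simp only: u_def)
  with xy(2) have c: "dots c = 1" and "sum_list (map dots u) = 0" by linarith+
  then have u: "set u \<subseteq> letters" by (simp only: dots_0_letters)
  have \<beta>: "\<beta> = bracelet (c # u)" using bracelet_swap[of x "c # y"] by (simp add: w xy u_def)
  have "closed_word (c # u)" using closed_bracelet_equiv cl \<beta> w by (auto simp: bracelet_eq_iff)
  show ?thesis
  proof (cases "c = Sd")
    case True then show ?thesis using \<beta> u by blast
  next
    case False
    then have "c = Pd" using dots_1[OF c] by simp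
    with \<open>closed_word (c # u)\<close> obtain a where a: "path a u a" by (auto simp: closed_word_def)
    show ?thesis
    proof (cases a)
      case True
      then have "path False (rev u) False" using a by (simp add: path_rev)
      then have "fit (rev u)" using u by (simp add: fit_iff)
      then show ?thesis using \<beta> \<open>c = Pd\<close> u bracelet_reverse1[of Pd u]
        by (intro disjI2 exI[of _ "rev u"]) simp
    next
      case False
      then show ?thesis using \<beta> \<open>c = Pd\<close> u a by (intro disjI2 exI[of _ u]) (simp add: fit_iff)
    qed
  qed
qed

lemma bracelet_reverse_dots: "bracelet (c # p @ d # q) = bracelet (c # rev q @ d # rev p)"
  using bracelet_reverse2[of d q c "rev p"] bracelet_swap2[of c "rev q" d "rev p"]
    bracelet_swap2[of d "rev q" c p] bracelet_reverse2[of c "rev p" d q] by simp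

text \<open>The rows in which the two intermediate words begin and end decide the rule. A word
  leading from the upper row back to it becomes fit when the bracelet is reversed, which also
  exchanges the places of the two words.\<close>

lemma two_dots:
  assumes "\<beta> \<in> frakb_bar" "bdots \<beta> = 2"
  shows "\<exists>w r. \<beta> = bracelet w \<and> tau_rule \<delta> (br w) r"
proof -
  obtain w where w: "\<beta> = bracelet w" by (induct \<beta> rule: bracelet.abs_induct) blast
  with assms have cl: "closed_word w" and d: "sum_list (map dots w) = 2"
    by (simp_all add: bracelet_in_frakb_bar_iff bdots.abs_eq)
  obtain x c y where xy: "w = x @ c # y" "dots c > 0" "dots c + sum_list (map dots (y @ x)) = 2"
    by (rule dots_split[OF d]) auto
  define u where "u = y @ x"
  have \<beta>: "\<beta> = bracelet (c # u)" using bracelet_swap[of x "c # y"] by (simp add: w xy u_def)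
  have cl': "closed_word (c # u)" using closed_bracelet_equiv cl \<beta> w by (auto simp: bracelet_eq_iff)
  have cu: "dots c + sum_list (map dots u) = 2" using xy by (simp add: u_def)
  consider "dots c = 2" | "dots c = 1" using xy cu by fastforce
  then show ?thesis
  proof cases
    case 1
    then have "c = Sdd" "set u \<subseteq> letters" using cu dots_2 by (auto simp flip: dots_0_letters)
    then show ?thesis using \<beta> tau_rule.ss_same by blast
  next
    case 2
    with cu have "sum_list (map dots u) = 1" by simp
    then obtain p d' q where pq: "u = p @ d' # q" "dots d' > 0" "dots d' + sum_list (map dots (q @ p)) = 1"
      by (rule dots_split) auto
    have "dots d' + (sum_list (map dots q) + sum_list (map dots p)) = 1" using pq(3) by simp
    with pq(2) have d': "dots d' = 1" and "sum_list (map dots p) = 0" "sum_list (map dots q) = 0" by linarith+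
    then have let_pq: "set p \<subseteq> letters" "set q \<subseteq> letters" by (simp_all only: dots_0_letters)
    have ps: "\<exists>w r. bracelet (Pd # p @ Sd # q) = bracelet w \<and> tau_rule \<delta> (br w) r"
      if "closed_word (Pd # p @ Sd # q)" "set p \<subseteq> letters" "set q \<subseteq> letters" for p q
    proof -
      from that(1) obtain a where a: "path a p False" "path True q a" by (auto simp: closed_word_def path_append)
      show ?thesis
      proof (cases a)
        case False
        then have "fit p" using a that by (simp add: fit_iff)
        then show ?thesis using tau_rule.ps[OF that(2,3)] by blast
      next
        \<comment> \<open>Here \<open>q\<close> returns to the upper row, and reversing the bracelet
          puts the fit word \<open>rev q\<close> directly after \<open>Pd\<close>.\<close>
        case True
        then have "fit (rev q)" using a that by (simp add: fit_iff path_rev)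
        then show ?thesis using tau_rule.ps[of "rev q" "rev p"] that bracelet_reverse_dots[of Pd p Sd q] by auto
      qed
    qed
    have pp: "\<exists>w r. bracelet (Pd # p @ Pd # q) = bracelet w \<and> tau_rule \<delta> (br w) r"
      if "closed_word (Pd # p @ Pd # q)" "set p \<subseteq> letters" "set q \<subseteq> letters" for p q
    proof -
      from that(1) obtain a b where ab: "path a p b" "path b q a" by (auto simp: closed_word_def path_append)
      have split: "count_list p S > count_list p N" if "path False p True" "set p \<subseteq> letters" for p
        using path_count[OF that(1)] by (simp add: map_undot_letters that(2))
      show ?thesis
      \<comment> \<open>The rows at the two ends of \<open>p\<close>: equal rows lead to
        \<open>pp_fit\<close>, different rows to \<open>pp_split\<close> with \<open>p\<close> or
        \<open>q\<close> in front.\<close>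
      proof (cases a; cases b)
        assume "\<not> a" "\<not> b"
        then have "fit p" "fit q" using ab that by (simp_all add: fit_iff)
        then show ?thesis using tau_rule.pp_fit[OF that(2,3)] by blast
      next
        assume "a" "b"
        then have "fit (rev p)" "fit (rev q)" using ab that by (simp_all add: fit_iff path_rev)
        then show ?thesis using tau_rule.pp_fit[of "rev q" "rev p"] that bracelet_reverse_dots[of Pd p Pd q] by auto
      next
        assume "\<not> a" "b"
        then have "count_list p S > count_list p N" using split[of p] ab(1) that(2) by simp
        from tau_rule.pp_split[OF that(2,3) this] show ?thesis by blast
      next
        assume "a" "\<not> b"
        then have "count_list q S > count_list q N" using split[of q] ab(2) that(3) by simp
        from tau_rule.pp_split[OF that(3,2) this] show ?thesis using bracelet_swap2[of Pd p Pd q] by auto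
      qed
    qed
    have "closed_word (d' # q @ c # p)"
      using cl' closed_bracelet_equiv[of "c # p @ d' # q" "d' # q @ c # p"] bracelet_swap2[of c p d' q]
      by (simp add: pq bracelet_eq_iff)
    moreover have "c = Sd \<or> c = Pd" "d' = Sd \<or> d' = Pd" using 2 d' dots_1 by blast+
    ultimately consider "c = Sd" "d' = Sd" | "c = Pd" "d' = Sd" | "c = Sd" "d' = Pd" "closed_word (Pd # q @ Sd # p)"
      | "c = Pd" "d' = Pd" by blast
    then show ?thesis
    proof cases
      case 1
      then show ?thesis unfolding \<beta> pq using tau_rule.ss[OF let_pq] by blast
    next
      case 2
      then show ?thesis unfolding \<beta> pq using ps[of p q] cl' let_pq by (simp add: pq)
    next
      case 3
      then show ?thesis unfolding \<beta> pq using ps[of q p] let_pq bracelet_swap2[of Sd p Pd q] by simp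
    next
      case 4
      then show ?thesis unfolding \<beta> pq using pp[of p q] cl' let_pq by (simp add: pq)
    qed
  qed
qed

lemma bdots_0_frakb:
  assumes "\<beta> \<in> frakb_bar" "bdots \<beta> = 0" shows "\<beta> \<in> frakb"
  using assms by (induct \<beta> rule: bracelet.abs_induct)
    (simp add: bracelet_in_frakb_bar_iff bracelet_in_frakb_iff bdots.abs_eq flip: dots_0_letters)

lemma frakb_bdots_0:
  assumes "\<beta> \<in> frakb" shows "\<beta> \<in> frakb_bar" "bdots \<beta> = 0"
  using assms by (induct \<beta> rule: bracelet.abs_induct;
    simp add: bracelet_in_frakb_bar_iff bracelet_in_frakb_iff bdots.abs_eq flip: dots_0_letters)+

lemma mdots_add [simp]: "mdots (m + m') = mdots m + mdots m'" "mdots (add_mset \<beta> m) = bdots \<beta> + mdots m"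
  "mdots {#} = 0"
  by (simp_all add: mdots_def)

lemma mdots_0_frakb: "set_mset M \<subseteq> frakb_bar \<Longrightarrow> mdots M = 0 \<Longrightarrow> set_mset M \<subseteq> frakb"
  by (induction M) (auto intro: bdots_0_frakb)

lemma frakb_mdots_0: "set_mset M \<subseteq> frakb \<Longrightarrow> mdots M = 0 \<and> set_mset M \<subseteq> frakb_bar"
  by (induction M) (auto intro: frakb_bdots_0)

lemma mdots_split:
  assumes "mdots m > 0" obtains \<beta> M where "m = add_mset \<beta> M" "bdots \<beta> > 0"
proof -
  have "\<exists>\<beta>\<in>#m. bdots \<beta> > 0"
    using assms by (induction m) auto
  then show ?thesis using that by (metis insert_DiffM)
qed

definition two_dotted :: "monomial \<Rightarrow> bool" where
  "two_dotted m \<longleftrightarrow> set_mset m \<subseteq> frakb_bar \<and> mdots m = 2"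

text \<open>Left-hand sides times undotted monomials exhaust the domain of the trace, so the rules
  and linearity determine it; by \<open>tau_rule_realises\<close> every such monomial has a realised
  value.\<close>

lemma covered:
  assumes "two_dotted m"
  obtains M m0 r where "m = m0 + M" "set_mset M \<subseteq> frakb" "tau_rule \<delta> (Poly_Mapping.single m0 1) r"
    "Poly_Mapping.single m0 (1 :: complex) \<in> poly_bar_2"
proof -
  note assms = assms[unfolded two_dotted_def]
  obtain \<beta> M where M: "m = add_mset \<beta> M" "bdots \<beta> > 0" using mdots_split[of m] assms by auto
  consider "bdots \<beta> = 2" "mdots M = 0" | "bdots \<beta> = 1" "mdots M = 1" using M assms by fastforce
  then show ?thesis
  proof cases
    case 1
    then obtain w r where w: "\<beta> = bracelet w" "tau_rule \<delta> (br w) r" using two_dots[of \<beta> \<delta>] M assms by auto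
    show ?thesis
      by (rule that[of "{#\<beta>#}" M r])
        (use w 1 M assms mdots_0_frakb[of M] in \<open>auto simp: br_def poly_bar_2_def\<close>)
  next
    case 2
    obtain \<beta>' M' where M': "M = add_mset \<beta>' M'" "bdots \<beta>' > 0" using mdots_split[of M] 2 by auto
    then have 3: "bdots \<beta>' = 1" "mdots M' = 0" using 2 by auto
    have in_bar: "\<beta> \<in> frakb_bar" "\<beta>' \<in> frakb_bar" "set_mset M' \<subseteq> frakb_bar" using M M' assms by auto
    have "\<exists>r. tau_rule \<delta> (Poly_Mapping.single {#\<beta>, \<beta>'#} 1) r"
      using one_dot[OF in_bar(1) 2(1)] one_dot[OF in_bar(2) 3(1)]
    proof (elim disjE exE conjE)
      fix u w assume "\<beta> = bracelet (Sd # u)" "set u \<subseteq> letters" "\<beta>' = bracelet (Sd # w)" "set w \<subseteq> letters"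
      then show ?thesis using tau_rule.s_s[of u w \<delta>] by (auto simp: br_mult)
    next
      fix u w assume "\<beta> = bracelet (Sd # u)" "set u \<subseteq> letters" "\<beta>' = bracelet (Pd # w)" "set w \<subseteq> letters" "fit w"
      then show ?thesis using tau_rule.p_s[of w u \<delta>] by (auto simp: br_mult add_mset_commute)
    next
      fix u w assume "\<beta> = bracelet (Pd # u)" "set u \<subseteq> letters" "fit u" "\<beta>' = bracelet (Sd # w)" "set w \<subseteq> letters"
      then show ?thesis using tau_rule.p_s[of u w \<delta>] by (auto simp: br_mult)
    next
      fix u w assume "\<beta> = bracelet (Pd # u)" "set u \<subseteq> letters" "fit u" "\<beta>' = bracelet (Pd # w)" "set w \<subseteq> letters" "fit w"
      then show ?thesis using tau_rule.p_p[of u w \<delta>] by (auto simp: br_mult)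
    qed
    then obtain r where r: "tau_rule \<delta> (Poly_Mapping.single {#\<beta>, \<beta>'#} 1) r" by blast
    show ?thesis
      by (rule that[of "{#\<beta>, \<beta>'#}" M' r])
        (use r 2 3 M M' in_bar mdots_0_frakb[of M'] in \<open>auto simp: poly_bar_2_def\<close>)
  qed
qed

subsection \<open>Existence and uniqueness of the trace\<close>

definition tau0 :: "complex \<Rightarrow> monomial \<Rightarrow> bpoly" where
  "tau0 \<delta> m = (THE r. realises \<delta> m r)"

lemma realises_unique:
  assumes "realises \<delta> m r" "realises \<delta> m r'" shows "r = r'"
proof -
  obtain n ws L e1 e2 where 1: "dotted n ws L e1 e2" "cmono L ws = m" "pairV \<delta> n (diag ws) e1 e2 = r"
    using assms(1) unfolding realises_def by blast
  obtain n' ws' L' e1' e2' where 2: "dotted n' ws' L' e1' e2'" "cmono L' ws' = m" "pairV \<delta> n' (diag ws') e1' e2' = r'"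
    using assms(2) unfolding realises_def by blast
  show ?thesis using dotted_pairV_unique[OF 1(1) 2(1), of \<delta>] 1 2 by simp
qed

lemma tau0_eq: "realises \<delta> m r \<Longrightarrow> tau0 \<delta> m = r"
  unfolding tau0_def by (rule the_equality) (auto intro: realises_unique)

lemma cmono_frakb:
  assumes "config n ws" shows "set_mset (cmono elab ws) \<subseteq> frakb"
proof
  fix \<beta> assume "\<beta> \<in># cmono elab ws"
  then obtain w where w: "w \<in> set ws" "\<beta> = bracelet (map elab (cyc w))" by (auto simp: cmono_def)
  have "w \<noteq> []" using w assms by (auto simp: config_def)
  then have "cyc w \<noteq> []" by simp
  then show "\<beta> \<in> frakb" using w closed_cyc[of w elab] by (auto simp: bracelet_in_frakb_iff)
qed

lemma diagram_monomial_frakb: "b \<in> diagrams n \<Longrightarrow> set_mset (diagram_monomial n b) \<subseteq> frakb"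
proof -
  assume "b \<in> diagrams n"
  then obtain ws where "config n ws" "diag ws = b" by (rule config_ex)
  then show ?thesis using cmono_frakb diagram_monomial_config by metis
qed

lemma poly_alg_simps:
  "0 \<in> poly_alg" "f \<in> poly_alg \<Longrightarrow> g \<in> poly_alg \<Longrightarrow> f + g \<in> poly_alg"
  "(\<And>x. x \<in> A \<Longrightarrow> h x \<in> poly_alg) \<Longrightarrow> sum h A \<in> poly_alg"
  "f \<in> poly_alg \<Longrightarrow> cscale c f \<in> poly_alg"
proof -
  show 0: "0 \<in> poly_alg" by (simp add: poly_alg_def)
  show add: "f + g \<in> poly_alg" if "f \<in> poly_alg" "g \<in> poly_alg" for f g
    using that keys_add[of f g] by (auto simp: poly_alg_def)
  show "sum h A \<in> poly_alg" if "\<And>x. x \<in> A \<Longrightarrow> h x \<in> poly_alg"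
    using that by (induction A rule: infinite_finite_induct) (auto intro: 0 add)
  have "Poly_Mapping.keys (cscale c f) \<subseteq> Poly_Mapping.keys f" by (auto simp: in_keys_iff)
  then show "cscale c f \<in> poly_alg" if "f \<in> poly_alg" using that by (auto simp: poly_alg_def)
qed

lemma realises_poly_alg: "realises \<delta> m r \<Longrightarrow> r \<in> poly_alg"
proof -
  assume "realises \<delta> m r"
  then obtain n ws L e1 e2 where d: "dotted n ws L e1 e2" and r: "r = pairV \<delta> n (diag ws) e1 e2"
    by (auto simp: realises_def)
  then have b: "diag ws \<in> diagrams n" and e: "e1 \<in> diag ws" "e2 \<in> diag ws"
    using diag_diagrams by (auto simp: dotted_def)
  have lt: "i < n" if "i \<in> los e" "e \<in> diag ws" for i e
    using that b by (auto simp: los_def diagrams_def nodes_iff dest!: subsetD)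
  have "actV \<delta> n i j (diag ws) \<in> poly_alg" if "i \<noteq> j" "i < n" "j < n" for i j
    using diagram_monomial_frakb[OF dact_diagrams[OF b that(2,3,1)]]
    by (auto simp: actV_def poly_alg_def)
  then show ?thesis unfolding r pairV_def
    by (intro poly_alg_simps) (auto simp: poly_alg_simps intro: lt e)
qed

lemma lin_ext_cong: "(\<And>m. m \<in> Poly_Mapping.keys f \<Longrightarrow> g m = h m) \<Longrightarrow> lin_ext g f = lin_ext h f"
  unfolding lin_ext_def by (intro sum.cong) auto

lemma poly_bar_2_alt: "poly_bar_2 = {f. \<forall>m\<in>Poly_Mapping.keys f. two_dotted m}"
  by (simp add: poly_bar_2_def two_dotted_def)

lemma tau0_rule:
  assumes "tau_rule \<delta> (Poly_Mapping.single m0 1) r" "Poly_Mapping.single m0 (1::complex) \<in> poly_bar_2"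
    "set_mset M \<subseteq> frakb"
  shows "realises \<delta> (m0 + M) (r * Poly_Mapping.single M 1)"
proof -
  obtain m where m: "Poly_Mapping.single m0 (1::complex) = Poly_Mapping.single m 1" "realises \<delta> (m + M) (r * Poly_Mapping.single M 1)"
    by (rule tau_rule_realises[OF assms])
  have "Poly_Mapping.keys (Poly_Mapping.single m0 (1::complex)) = Poly_Mapping.keys (Poly_Mapping.single m (1::complex))"
    by (simp only: m(1))
  then have "m = m0" by simp
  with m(2) show ?thesis by simp
qed

text \<open>An undotted factor is absorbed into the cofactor of the rule that covers
  \<open>m\<close>.\<close>

lemma tau0_mult:
  assumes m: "two_dotted m" and A: "set_mset A \<subseteq> frakb"
  shows "tau0 \<delta> (A + m) = Poly_Mapping.single A 1 * tau0 \<delta> m" "two_dotted (A + m)"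
proof -
  obtain M m0 r where M: "m = m0 + M" "set_mset M \<subseteq> frakb" "tau_rule \<delta> (Poly_Mapping.single m0 1) r"
    "Poly_Mapping.single m0 (1::complex) \<in> poly_bar_2"
    by (rule covered[OF m, where \<delta> = \<delta>])
  have 1: "tau0 \<delta> m = r * Poly_Mapping.single M 1"
    unfolding M(1) by (rule tau0_eq[OF tau0_rule[OF M(3,4,2)]])
  have "tau0 \<delta> (m0 + (A + M)) = r * Poly_Mapping.single (A + M) 1"
    by (rule tau0_eq[OF tau0_rule[OF M(3,4)]]) (use A M in auto)
  moreover have "A + m = m0 + (A + M)" by (simp add: M ac_simps)
  moreover have "Poly_Mapping.single (A + M) (1::complex) = Poly_Mapping.single A 1 * Poly_Mapping.single M 1"
    by (simp add: mult_single)
  ultimately show "tau0 \<delta> (A + m) = Poly_Mapping.single A 1 * tau0 \<delta> m"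
    by (simp only: 1 ac_simps)
  show "two_dotted (A + m)" using m frakb_mdots_0[OF A] by (auto simp: two_dotted_def)
qed

lemma mult_expand:
  "a * (f :: bpoly) = (\<Sum>A\<in>Poly_Mapping.keys a. \<Sum>m\<in>Poly_Mapping.keys f.
     Poly_Mapping.single (A + m) (Poly_Mapping.lookup a A * Poly_Mapping.lookup f m))"
proof -
  have "a * f = (\<Sum>A\<in>Poly_Mapping.keys a. Poly_Mapping.single A (Poly_Mapping.lookup a A)) *
      (\<Sum>m\<in>Poly_Mapping.keys f. Poly_Mapping.single m (Poly_Mapping.lookup f m))"
    by (simp only: poly_mapping_expand[of a, symmetric] poly_mapping_expand[of f, symmetric])
  then show ?thesis by (simp add: sum_product mult_single)
qed

lemma lin_ext_tau0_mult:
  assumes a: "a \<in> poly_alg" and f: "f \<in> poly_bar_2"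
  shows "lin_ext (tau0 \<delta>) (a * f) = a * lin_ext (tau0 \<delta>) f" "a * f \<in> poly_bar_2"
proof -
  let ?la = "Poly_Mapping.lookup a" and ?lf = "Poly_Mapping.lookup f"
  have "lin_ext (tau0 \<delta>) (a * f) = (\<Sum>A\<in>Poly_Mapping.keys a. \<Sum>m\<in>Poly_Mapping.keys f. cscale (?la A * ?lf m) (tau0 \<delta> (A + m)))"
    unfolding mult_expand[of a f] by (simp add: lin_ext_sum)
  also have "\<dots> = (\<Sum>A\<in>Poly_Mapping.keys a. \<Sum>m\<in>Poly_Mapping.keys f. Poly_Mapping.single A (?la A) * cscale (?lf m) (tau0 \<delta> m))"
  proof (intro sum.cong refl)
    fix A m assume "A \<in> Poly_Mapping.keys a" "m \<in> Poly_Mapping.keys f"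
    then have "set_mset A \<subseteq> frakb" "two_dotted m" using a f by (auto simp: poly_alg_def poly_bar_2_alt)
    from tau0_mult(1)[OF this(2,1), of \<delta>]
    have "cscale (?la A * ?lf m) (tau0 \<delta> (A + m)) = cscale (?la A * ?lf m) (Poly_Mapping.single A 1 * tau0 \<delta> m)" by simp
    also have "\<dots> = Poly_Mapping.single A (?la A) * cscale (?lf m) (tau0 \<delta> m)"
      by (simp add: cscale_eq_mult mult_single flip: mult.assoc)
    finally show "cscale (?la A * ?lf m) (tau0 \<delta> (A + m)) = Poly_Mapping.single A (?la A) * cscale (?lf m) (tau0 \<delta> m)" .
  qed
  also have "\<dots> = (\<Sum>A\<in>Poly_Mapping.keys a. Poly_Mapping.single A (?la A)) * lin_ext (tau0 \<delta>) f"
    by (simp add: lin_ext_def sum_product)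
  also have "\<dots> = a * lin_ext (tau0 \<delta>) f" by (simp only: poly_mapping_expand[of a, symmetric])
  finally show "lin_ext (tau0 \<delta>) (a * f) = a * lin_ext (tau0 \<delta>) f" .
  show "a * f \<in> poly_bar_2"
    using keys_mult[of a f] a f tau0_mult(2) unfolding poly_alg_def poly_bar_2_alt by blast
qed

lemma poly_bar_2_add: "f \<in> poly_bar_2 \<Longrightarrow> g \<in> poly_bar_2 \<Longrightarrow> f + g \<in> poly_bar_2"
  using keys_add[of f g] by (auto simp: poly_bar_2_def)

text \<open>Existence of the trace: the realised values satisfy all rules at once, however these
  overlap.\<close>

lemma is_tau_tau0: "is_tau \<delta> (\<lambda>f. if f \<in> poly_bar_2 then lin_ext (tau0 \<delta>) f else 0)"
  unfolding is_tau_def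
proof (intro conjI ballI allI impI)
  fix f assume f: "f \<in> poly_bar_2"
  have "tau0 \<delta> m \<in> poly_alg" if m: "two_dotted m" for m
  proof -
    obtain M m0 r where M: "m = m0 + M" "set_mset M \<subseteq> frakb" "tau_rule \<delta> (Poly_Mapping.single m0 1) r"
      "Poly_Mapping.single m0 (1::complex) \<in> poly_bar_2"
      by (rule covered[OF m, where \<delta> = \<delta>])
    from tau0_rule[OF M(3,4,2)] show ?thesis using tau0_eq realises_poly_alg by (metis M(1))
  qed
  then have "lin_ext (tau0 \<delta>) f \<in> poly_alg"
    unfolding lin_ext_def using f by (intro poly_alg_simps(3,4)) (auto simp: poly_bar_2_alt)
  then show "(if f \<in> poly_bar_2 then lin_ext (tau0 \<delta>) f else 0) \<in> poly_alg" using f by simp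
next
  fix l r assume A: "tau_rule \<delta> l r \<and> l \<in> poly_bar_2"
  obtain m where m: "l = Poly_Mapping.single m 1" "realises \<delta> (m + {#}) (r * Poly_Mapping.single {#} 1)"
    by (rule tau_rule_realises[of \<delta> l r "{#}"]) (use A in auto)
  have "realises \<delta> m r" using m(2) by simp
  then show "(if l \<in> poly_bar_2 then lin_ext (tau0 \<delta>) l else 0) = r"
    using A m(1) by (simp add: tau0_eq)
qed (use lin_ext_add lin_ext_tau0_mult poly_bar_2_add in auto)

lemma tau_eq:
  assumes "f \<in> poly_bar_2" shows "tau \<delta> f = lin_ext (tau0 \<delta>) f"
proof -
  let ?T = "\<lambda>f. if f \<in> poly_bar_2 then lin_ext (tau0 \<delta>) f else 0"
  have "tau \<delta> = ?T"
    unfolding tau_def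
  proof (rule the_equality)
    show "is_tau \<delta> ?T \<and> (\<forall>f. f \<notin> poly_bar_2 \<longrightarrow> ?T f = 0)" using is_tau_tau0 by simp
    fix T assume T: "is_tau \<delta> T \<and> (\<forall>f. f \<notin> poly_bar_2 \<longrightarrow> T f = 0)"
    show "T = ?T"
    proof
      fix f
      have mono: "T (Poly_Mapping.single m c) = cscale c (tau0 \<delta> m)" if m: "two_dotted m" for m c
      proof -
        obtain M m0 r where M: "m = m0 + M" "set_mset M \<subseteq> frakb" "tau_rule \<delta> (Poly_Mapping.single m0 1) r"
          "Poly_Mapping.single m0 (1::complex) \<in> poly_bar_2"
          by (rule covered[OF m, where \<delta> = \<delta>])
        \<comment> \<open>The scalar is moved to the undotted cofactor, where linearity over
          \<open>poly_alg\<close> applies.\<close>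
        have "Poly_Mapping.single m c = Poly_Mapping.single M c * Poly_Mapping.single m0 1"
          by (simp add: M(1) mult_single add.commute)
        moreover have "Poly_Mapping.single M c \<in> poly_alg" using M(2) by (simp add: poly_alg_def)
        ultimately have "T (Poly_Mapping.single m c) = Poly_Mapping.single M c * T (Poly_Mapping.single m0 1)"
          using T M(4) unfolding is_tau_def by metis
        also have "T (Poly_Mapping.single m0 1) = r" using T M(3,4) unfolding is_tau_def by blast
        also have "Poly_Mapping.single M c * r = cscale c (r * Poly_Mapping.single M 1)"
          by (simp add: cscale_eq_mult mult_single ac_simps flip: mult.assoc)
        also have "r * Poly_Mapping.single M 1 = tau0 \<delta> m"
          unfolding M(1) by (rule tau0_eq[OF tau0_rule[OF M(3,4,2)], symmetric])
        finally show ?thesis .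
      qed
      show "T f = ?T f"
      proof (cases "f \<in> poly_bar_2")
        case True
        have "T f = lin_ext (\<lambda>m. T (Poly_Mapping.single m 1)) f"
        proof (rule linear_on_monomials[OF poly_bar_2_alt _ _ True])
          show "T (f + g) = T f + T g" if "f \<in> poly_bar_2" "g \<in> poly_bar_2" for f g
            using T that unfolding is_tau_def by blast
          show "T (Poly_Mapping.single m c) = cscale c (T (Poly_Mapping.single m 1))" if "two_dotted m" for m c
            using mono[OF that, of c] mono[OF that, of 1] by simp
        qed
        also have "\<dots> = lin_ext (tau0 \<delta>) f"
          using True mono[of _ 1] by (intro lin_ext_cong) (auto simp: poly_bar_2_alt)
        finally show ?thesis using True by simp
      qed (use T in simp)
    qed
  qed
  then show ?thesis using assms by simp
qed

subsection \<open>The second derivative of a monomial\<close>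

text \<open>Positions are exchanged for lines, so that differentiating means relabelling one line
  and all loops can be treated in one sum.\<close>

lemma word_deriv_edges:
  assumes "distinct es"
  shows "word_deriv (map L es) =
    (\<Sum>e\<in>set es. case letter_deriv (L e) of None \<Rightarrow> 0 | Some c \<Rightarrow> br (map (L(e := c)) es))"
proof -
  have upd: "(map L es)[j := c] = map (L(es ! j := c)) es" if "j < length es" for j c
  proof (rule nth_equalityI)
    fix k assume "k < length ((map L es)[j := c])"
    then show "(map L es)[j := c] ! k = map (L(es ! j := c)) es ! k"
      using that assms by (cases "k = j") (simp_all add: nth_eq_iff_index_eq)
  qed simp
  let ?F = "\<lambda>e. case letter_deriv (L e) of None \<Rightarrow> 0 | Some c \<Rightarrow> br (map (L(e := c)) es)"
  have bij: "bij_betw ((!) es) {..<length es} (set es)"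
    using assms by (intro bij_betw_nth) auto
  have "word_deriv (map L es) = (\<Sum>j<length es. ?F (es ! j))"
    unfolding word_deriv_def
  proof (rule sum.cong)
    fix j assume "j \<in> {..<length es}"
    then have j: "j < length es" by simp
    show "(case letter_deriv (map L es ! j) of None \<Rightarrow> 0 | Some c \<Rightarrow> br ((map L es)[j := c])) = ?F (es ! j)"
      by (simp only: upd[OF j] nth_map[OF j])
  qed simp
  also have "\<dots> = (\<Sum>e\<in>set es. ?F e)" by (rule sum.reindex_bij_betw[OF bij])
  finally show ?thesis .
qed

lemma monomial_deriv_add:
  "monomial_deriv (add_mset \<beta> m) =
     bracelet_deriv \<beta> * Poly_Mapping.single m 1 + Poly_Mapping.single {#\<beta>#} 1 * monomial_deriv m"
proof -
  have "(\<Sum>\<beta>'\<in>#m. bracelet_deriv \<beta>' * Poly_Mapping.single (add_mset \<beta> m - {#\<beta>'#}) 1) =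
      (\<Sum>\<beta>'\<in>#m. Poly_Mapping.single {#\<beta>#} 1 * (bracelet_deriv \<beta>' * Poly_Mapping.single (m - {#\<beta>'#}) 1))"
  proof (rule arg_cong[where f = sum_mset], rule image_mset_cong)
    fix \<beta>' assume "\<beta>' \<in># m"
    \<comment> \<open>This holds also for \<open>\<beta>' = \<beta>\<close>, since
      \<open>\<beta>'\<close> occurs in \<open>m\<close>.\<close>
    then have "add_mset \<beta> m - {#\<beta>'#} = {#\<beta>#} + (m - {#\<beta>'#})" by simp
    then have "Poly_Mapping.single (add_mset \<beta> m - {#\<beta>'#}) (1::complex) =
        Poly_Mapping.single {#\<beta>#} 1 * Poly_Mapping.single (m - {#\<beta>'#}) 1"
      by (simp only: mult_single mult_1)
    then show "bracelet_deriv \<beta>' * Poly_Mapping.single (add_mset \<beta> m - {#\<beta>'#}) 1 =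
        Poly_Mapping.single {#\<beta>#} 1 * (bracelet_deriv \<beta>' * Poly_Mapping.single (m - {#\<beta>'#}) 1)"
      by (simp only: ac_simps)
  qed
  then show ?thesis by (simp add: monomial_deriv_def sum_mset_distrib_left)
qed

lemma monomial_deriv_cmono:
  assumes "distinct (concat (map cyc ws))"
  shows "monomial_deriv (cmono L ws) =
    (\<Sum>e\<in>diag ws. case letter_deriv (L e) of None \<Rightarrow> 0 | Some c \<Rightarrow> Poly_Mapping.single (cmono (L(e := c)) ws) 1)"
  using assms
proof (induction ws)
  case Nil then show ?case by (simp add: monomial_deriv_def)
next
  case (Cons w ws)
  let ?F = "\<lambda>ws e. case letter_deriv (L e) of None \<Rightarrow> 0 | Some c \<Rightarrow> Poly_Mapping.single (cmono (L(e := c)) ws) (1::complex)"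
  have d: "distinct (cyc w)" "distinct (concat (map cyc ws))" "set (cyc w) \<inter> diag ws = {}"
    using Cons.prems by (auto simp: diag_def)
  have fin: "finite (diag ws)" by (simp add: diag_def)
  have "bracelet_deriv (bracelet (map L (cyc w))) * Poly_Mapping.single (cmono L ws) 1
      = (\<Sum>e\<in>set (cyc w). ?F (w # ws) e)"
    unfolding bracelet_deriv.abs_eq word_deriv_edges[OF d(1)] sum_distrib_right
  proof (rule sum.cong)
    fix e assume "e \<in> set (cyc w)"
    then have "e \<notin> diag ws" using d(3) by blast
    then show "(case letter_deriv (L e) of None \<Rightarrow> 0 | Some c \<Rightarrow> br (map (L(e := c)) (cyc w))) *
        Poly_Mapping.single (cmono L ws) 1 = ?F (w # ws) e"
      by (auto simp: br_times_single simp del: fun_upd_apply split: option.split)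
  qed simp
  moreover have "Poly_Mapping.single {#bracelet (map L (cyc w))#} 1 * (\<Sum>e\<in>diag ws. ?F ws e) = (\<Sum>e\<in>diag ws. ?F (w # ws) e)"
    unfolding sum_distrib_left
  proof (rule sum.cong)
    fix e assume "e \<in> diag ws"
    then have "e \<notin> set (cyc w)" using d(3) by blast
    then show "Poly_Mapping.single {#bracelet (map L (cyc w))#} 1 * ?F ws e = ?F (w # ws) e"
      by (auto simp: mult_single simp del: fun_upd_apply split: option.split)
  qed simp
  ultimately show ?case
    using Cons.IH[OF d(2)] fin d(3) by (simp add: monomial_deriv_add sum.union_disjoint)
qed

lemma derivation_simps:
  "derivation 0 = 0" "derivation (sum h A) = (\<Sum>x\<in>A. derivation (h x))"
  "derivation (cscale c f) = cscale c (derivation f)" "derivation (Poly_Mapping.single m 1) = monomial_deriv m"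
  "derivation (f + g) = derivation f + derivation g"
  by (simp_all add: derivation_def lin_ext_sum lin_ext_cscale lin_ext_add)

text \<open>The second letter is differentiated in the labelling already changed at
  \<open>e1\<close>, so that \<open>e1 = e2\<close> produces \<open>Sdd\<close> from an
  \<open>S\<close> and nothing from a \<open>P\<close>.\<close>

definition second_term :: "node list list \<Rightarrow> node set \<Rightarrow> node set \<Rightarrow> bpoly" where
  "second_term ws e1 e2 =
     (case letter_deriv (elab e1) of None \<Rightarrow> 0 | Some c \<Rightarrow>
        (case letter_deriv ((elab(e1 := c)) e2) of None \<Rightarrow> 0 | Some d \<Rightarrow>
           Poly_Mapping.single (cmono (elab(e1 := c, e2 := d)) ws) 1))"

lemma second_derivation:
  assumes cfg: "config n ws"
  shows "derivation (derivation (Poly_Mapping.single (cmono elab ws) 1)) =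
    (\<Sum>e1\<in>diag ws. \<Sum>e2\<in>diag ws. second_term ws e1 e2)"
proof -
  note D = monomial_deriv_cmono[OF distinct_edges[OF cfg]]
  have "derivation (case letter_deriv (elab e1) of None \<Rightarrow> 0 | Some c \<Rightarrow> Poly_Mapping.single (cmono (elab(e1 := c)) ws) 1)
      = (\<Sum>e2\<in>diag ws. second_term ws e1 e2)" for e1
    by (cases "letter_deriv (elab e1)") (simp_all add: derivation_simps D second_term_def)
  then show ?thesis by (simp add: derivation_simps D)
qed

lemma letter_deriv_Some: "letter_deriv c = Some d \<Longrightarrow> undot d = undot c \<and> dots d = Suc (dots c)"
  by (cases c) auto

lemma dotted_two_dotted:
  assumes d: "dotted n ws L e1 e2" shows "two_dotted (cmono L ws)"
proof -
  have cfg: "config n ws" and e: "e1 \<in> diag ws" "e2 \<in> diag ws"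
    and L: "\<And>e. e \<in> diag ws \<Longrightarrow> undot (L e) = elab e \<and> dots (L e) = of_bool (e = e1) + of_bool (e = e2)"
    using d by (auto simp: dotted_def)
  have "bracelet (map L (cyc w)) \<in> frakb_bar" if "w \<in> set ws" for w
  proof -
    have "w \<noteq> []" using that cfg by (auto simp: config_def)
    moreover have "closed_word (map L (cyc w))" using that L by (intro closed_cyc) (auto simp: diag_def)
    ultimately show ?thesis by (auto simp: bracelet_in_frakb_bar_iff)
  qed
  moreover have "mdots (cmono L ws) = 2"
  proof -
    have "mdots (cmono L ws) = sum_list (map (\<lambda>e. dots (L e)) (concat (map cyc ws)))"
      by (induction ws) (simp_all add: bdots.abs_eq comp_def)
    also have "\<dots> = (\<Sum>e\<in>diag ws. dots (L e))"
      using distinct_edges[OF cfg] by (simp only: sum_list_distinct_conv_sum_set diag_def)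
    also have "\<dots> = (\<Sum>e\<in>diag ws. of_bool (e = e1) + of_bool (e = e2))"
      using L by (intro sum.cong) auto
    also have "\<dots> = 2" using e by (simp add: sum.distrib of_bool_def diag_def)
    finally show ?thesis .
  qed
  ultimately show ?thesis by (auto simp: two_dotted_def cmono_def)
qed

lemma los_N: "elab e = N \<Longrightarrow> los e = {}"
  by (auto simp: elab_def los_def in_range_Up subset_iff split: if_splits)

lemma los_P:
  assumes "b \<in> diagrams n" "e \<in> b" "elab e = P" obtains i where "los e = {i}"
proof -
  have "e \<noteq> {}" using assms by (auto simp: diagrams_def)
  then obtain x where "x \<in> e" by blast
  then obtain y where "e = {x, y}" using diagram_edge'[OF assms(1,2)] by metis
  moreover from this have "is_upper x \<longleftrightarrow> \<not> is_upper y" using assms(3) by (simp add: elab_pair)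
  ultimately have "\<exists>i. los e = {i}" by (cases x; cases y) simp_all
  with that show ?thesis by blast
qed

text \<open>The choices annihilated by the derivation admit no pair of different lower ends: an
  \<open>N\<close> has no lower end, and a \<open>P\<close> chosen twice has only one.\<close>

lemma second_term_pairV:
  assumes cfg: "config n ws" and e: "e1 \<in> diag ws" "e2 \<in> diag ws"
  shows "lin_ext (tau0 \<delta>) (second_term ws e1 e2) = pairV \<delta> n (diag ws) e1 e2"
    "second_term ws e1 e2 \<in> poly_bar_2"
proof -
  have "lin_ext (tau0 \<delta>) (second_term ws e1 e2) = pairV \<delta> n (diag ws) e1 e2 \<and> second_term ws e1 e2 \<in> poly_bar_2"
  proof (cases "letter_deriv (elab e1)")
    case None
    then have "elab e1 = N" by (cases "elab e1") (auto simp: elab_def split: if_splits)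
    then show ?thesis using None by (simp add: second_term_def pairV_def los_N poly_bar_2_def)
  next
    case c: (Some c)
    show ?thesis
    proof (cases "letter_deriv ((elab(e1 := c)) e2)")
      case None
      have "pairV \<delta> n (diag ws) e1 e2 = 0"
      proof (cases "e1 = e2")
        case True
        then have "elab e1 = P" using c None
          by (cases "elab e1") (auto simp: elab_def split: if_splits)
        then obtain i where "los e1 = {i}" using los_P[OF diag_diagrams[OF cfg] e(1)] by blast
        then show ?thesis using True by (simp add: pairV_def)
      next
        case False
        then have "elab e2 = N" using None by (cases "elab e2") (auto simp: elab_def split: if_splits)
        then show ?thesis by (simp add: pairV_def los_N)
      qed
      then show ?thesis using c None by (simp add: second_term_def poly_bar_2_def del: fun_upd_apply)
    next
      case d: (Some d)
      let ?L = "elab(e1 := c, e2 := d)"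
      have "dotted n ws ?L e1 e2"
        using cfg e letter_deriv_Some[OF c] letter_deriv_Some[OF d] by (auto simp: dotted_def)
      moreover from this have "realises \<delta> (cmono ?L ws) (pairV \<delta> n (diag ws) e1 e2)"
        unfolding realises_def by blast
      moreover have "second_term ws e1 e2 = Poly_Mapping.single (cmono ?L ws) 1"
        using c d by (simp add: second_term_def del: fun_upd_apply)
      ultimately show ?thesis
        using dotted_two_dotted[of n ws ?L e1 e2] by (simp add: tau0_eq poly_bar_2_alt del: fun_upd_apply)
    qed
  qed
  then show "lin_ext (tau0 \<delta>) (second_term ws e1 e2) = pairV \<delta> n (diag ws) e1 e2"
    "second_term ws e1 e2 \<in> poly_bar_2" by blast+
qed

lemma poly_bar_2_sum: "(\<And>x. x \<in> A \<Longrightarrow> f x \<in> poly_bar_2) \<Longrightarrow> sum f A \<in> poly_bar_2"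
proof -
  have 0: "0 \<in> poly_bar_2" by (simp add: poly_bar_2_def)
  assume "\<And>x. x \<in> A \<Longrightarrow> f x \<in> poly_bar_2"
  then show ?thesis
    by (induction A rule: infinite_finite_induct) (simp_all add: 0 poly_bar_2_add)
qed

text \<open>Each lower node lies on exactly one line, so choosing a line and a lower end of it
  amounts to choosing a lower node.\<close>

lemma sum_los:
  assumes b: "b \<in> diagrams n" shows "(\<Sum>e\<in>b. \<Sum>i\<in>los e. f i) = (\<Sum>i<n. f i)"
proof -
  have "b \<subseteq> Pow (nodes n)" using b by (auto simp: diagrams_def)
  then have fin: "finite b" by (rule finite_subset) (simp add: nodes_def)
  have U: "(\<Union>e\<in>b. los e) = {..<n}"
  proof
    show "(\<Union>e\<in>b. los e) \<subseteq> {..<n}"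
    proof (rule UN_least, rule subsetI)
      fix e i assume "e \<in> b" "i \<in> los e"
      then have "Lo i \<in> nodes n" using b by (auto simp: los_def diagrams_def)
      then show "i \<in> {..<n}" by (simp add: nodes_iff)
    qed
    show "{..<n} \<subseteq> (\<Union>e\<in>b. los e)"
    proof
      fix i assume "i \<in> {..<n}"
      then have "Lo i \<in> nodes n" by (simp add: nodes_iff)
      then obtain y where "{Lo i, y} \<in> b" by (rule diagram_edge[OF b])
      then show "i \<in> (\<Union>e\<in>b. los e)" by (rule UN_I) simp
    qed
  qed
  then have "los e \<subseteq> {..<n}" if "e \<in> b" for e using that by blast
  then have "\<forall>e\<in>b. finite (los e)" by (meson finite_lessThan finite_subset)
  moreover have "\<forall>e\<in>b. \<forall>e'\<in>b. e \<noteq> e' \<longrightarrow> los e \<inter> los e' = {}"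
    using diagram_unique[OF b] by (simp add: los_def disjoint_iff) blast
  ultimately show ?thesis using sum.UNION_disjoint[OF fin, of los f] U by simp
qed

lemma sum_symmetric_pairs:
  fixes F :: "nat \<Rightarrow> nat \<Rightarrow> 'a::comm_monoid_add"
  assumes "\<And>i j. F i j = F j i"
  shows "(\<Sum>i<n. \<Sum>j<n. if i = j then 0 else F i j) = (\<Sum>j<n. \<Sum>i<j. F i j) + (\<Sum>j<n. \<Sum>i<j. F i j)"
proof (induction n)
  case (Suc n)
  have 1: "(\<Sum>j<n. if n = j then 0 else F n j) = (\<Sum>i<n. F i n)"
    by (intro sum.cong) (auto simp: assms[of n])
  have 2: "(\<Sum>i<n. if i = n then 0 else F i n) = (\<Sum>i<n. F i n)"
    by (intro sum.cong) auto
  have 3: "sum (F n) {..<n} = (\<Sum>i<n. F i n)"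
    by (intro sum.cong refl) (rule assms)
  have "(\<Sum>i<Suc n. \<Sum>j<Suc n. if i = j then 0 else F i j) =
     (\<Sum>i<n. \<Sum>j<n. if i = j then 0 else F i j) + (\<Sum>i<n. F i n) + (\<Sum>i<n. F i n)"
    by (simp add: sum.distrib 1 2 3 ac_simps)
  then show ?case by (simp add: Suc ac_simps)
qed simp

definition totalV :: "complex \<Rightarrow> nat \<Rightarrow> diagram \<Rightarrow> bpoly" where
  "totalV \<delta> n b = (\<Sum>j<n. \<Sum>i<j. actV \<delta> n i j b)"

lemma tau_second_derivation:
  assumes b: "b \<in> diagrams n"
  shows "tau \<delta> (derivation (derivation (Poly_Mapping.single (diagram_monomial n b) 1))) = cscale 2 (totalV \<delta> n b)"
    "derivation (derivation (Poly_Mapping.single (diagram_monomial n b) 1)) \<in> poly_bar_2"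
proof -
  obtain ws where ws: "config n ws" "diag ws = b" using config_ex[OF b] by blast
  have \<zeta>: "diagram_monomial n b = cmono elab ws" using diagram_monomial_config[OF ws(1)] ws(2) by simp
  have dd: "derivation (derivation (Poly_Mapping.single (diagram_monomial n b) 1)) =
      (\<Sum>e1\<in>b. \<Sum>e2\<in>b. second_term ws e1 e2)"
    unfolding \<zeta> second_derivation[OF ws(1)] ws(2) ..
  show bar: "derivation (derivation (Poly_Mapping.single (diagram_monomial n b) 1)) \<in> poly_bar_2"
    unfolding dd using second_term_pairV(2)[OF ws(1)] ws(2) by (intro poly_bar_2_sum) auto
  have "tau \<delta> (derivation (derivation (Poly_Mapping.single (diagram_monomial n b) 1))) =
      (\<Sum>e1\<in>b. \<Sum>e2\<in>b. lin_ext (tau0 \<delta>) (second_term ws e1 e2))"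
    unfolding tau_eq[OF bar] unfolding dd by (simp add: lin_ext_sum)
  also have "\<dots> = (\<Sum>e1\<in>b. \<Sum>e2\<in>b. \<Sum>i\<in>los e1. \<Sum>j\<in>los e2. if i = j then 0 else actV \<delta> n i j b)"
    using second_term_pairV(1)[OF ws(1)] ws(2) by (intro sum.cong) (auto simp: pairV_def)
  also have "\<dots> = (\<Sum>e1\<in>b. \<Sum>i\<in>los e1. \<Sum>e2\<in>b. \<Sum>j\<in>los e2. if i = j then 0 else actV \<delta> n i j b)"
    by (intro sum.cong refl sum.swap)
  also have "\<dots> = (\<Sum>i<n. \<Sum>j<n. if i = j then 0 else actV \<delta> n i j b)"
    by (simp only: sum_los[OF b])
  also have "\<dots> = totalV \<delta> n b + totalV \<delta> n b"
    unfolding totalV_def by (rule sum_symmetric_pairs) (rule actV_commute)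
  also have "\<dots> = cscale 2 (totalV \<delta> n b)"
    using cscale_add_left[of 1 1 "totalV \<delta> n b"] by simp
  finally show "tau \<delta> (derivation (derivation (Poly_Mapping.single (diagram_monomial n b) 1))) = cscale 2 (totalV \<delta> n b)" .
qed

subsection \<open>Products with permutations and with the elements \<open>d\<^sub>i\<^sub>j\<close>\<close>

lemma rtrancl_edge: "{x, y} \<in> E \<Longrightarrow> (x, y) \<in> {(x, y). {x, y} \<in> E}\<^sup>*"
  by auto

primrec relab_lower :: "(nat \<Rightarrow> nat) \<Rightarrow> node \<Rightarrow> node" where
  "relab_lower \<sigma> (Up i) = Up i"
| "relab_lower \<sigma> (Lo i) = Lo (\<sigma> i)"

primrec relab_upper :: "(nat \<Rightarrow> nat) \<Rightarrow> node \<Rightarrow> node" where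
  "relab_upper \<sigma> (Up i) = Up (\<sigma> i)"
| "relab_upper \<sigma> (Lo i) = Lo i"

lemma place_above_in: "place_above x = Top i \<longleftrightarrow> x = Up i" "place_above x = Mid i \<longleftrightarrow> x = Lo i"
  "place_above x \<noteq> Bot i" "Top i = place_above x \<longleftrightarrow> x = Up i" "Mid i = place_above x \<longleftrightarrow> x = Lo i"
  "Bot i \<noteq> place_above x"
  by (cases x; auto)+

lemma place_below_in: "place_below x = Mid i \<longleftrightarrow> x = Up i" "place_below x = Bot i \<longleftrightarrow> x = Lo i"
  "place_below x \<noteq> Top i" "Mid i = place_below x \<longleftrightarrow> x = Up i" "Bot i = place_below x \<longleftrightarrow> x = Lo i"
  "Top i \<noteq> place_below x"
  by (cases x; auto)+

lemma place_image_mem: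
  "Top i \<in> place_above ` e \<longleftrightarrow> Up i \<in> e" "Mid i \<in> place_above ` e \<longleftrightarrow> Lo i \<in> e" "Bot i \<notin> place_above ` e"
  "Mid i \<in> place_below ` e \<longleftrightarrow> Up i \<in> e" "Bot i \<in> place_below ` e \<longleftrightarrow> Lo i \<in> e" "Top i \<notin> place_below ` e"
  by (auto simp: image_iff place_above_in place_below_in)

lemma set_eq_node: "A = B \<longleftrightarrow> (\<forall>i. Up i \<in> A \<longleftrightarrow> Up i \<in> B) \<and> (\<forall>i. Lo i \<in> A \<longleftrightarrow> Lo i \<in> B)"
  by (metis node.exhaust subsetI subset_antisym)

lemma diagram_cover:
  assumes "b \<in> diagrams n" "node_index x < n" obtains e where "e \<in> b" "x \<in> e"
  using diagram_edge[OF assms(1), of x] assms(2) by (metis insertI1 nodes_iff)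

lemma diagram_mem:
  assumes "b \<in> diagrams n" "e \<in> b" "x \<in> e" shows "node_index x < n"
proof -
  have "e \<subseteq> nodes n" using assms by (simp add: diagrams_def)
  then show ?thesis using assms(3) nodes_iff by blast
qed

text \<open>Stacking with a permutation merely hangs one outer node on each middle node, so a
  component is a line of \<open>b\<close> with its pendant nodes. The parameters \<open>pl\<close>,
  \<open>side\<close> and \<open>pend\<close> cover multiplication from below and from
  above.\<close>

lemma components_pendant:
  assumes b: "b \<in> diagrams n" and pl: "inj pl" and side: "\<And>i. node_index (side i) = i"
    and pend: "inj pend" "\<And>i x. pend i \<noteq> pl x"
  shows "components (pl ` nodes n \<union> pend ` {..<n}) ({{pl (side i), pend i} | i. i < n} \<union> (`) pl ` b)
    = (\<lambda>e. pl ` e \<union> pend ` {i. side i \<in> e}) ` b"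
proof (rule components_eq)
  let ?cell = "\<lambda>e. pl ` e \<union> pend ` {i. side i \<in> e}"
  let ?E = "{{pl (side i), pend i} | i. i < n} \<union> (`) pl ` b"
  have mem: "pl x \<in> ?cell e \<longleftrightarrow> x \<in> e" "pend i \<in> ?cell e \<longleftrightarrow> side i \<in> e" for i e x
    using pl pend(1) pend(2) pend(2)[symmetric] by (auto simp: inj_eq image_iff)
  have edge: "{pl (side i), pend i} \<in> ?E" if "i < n" for i using that by blast
  have cover: "\<exists>e\<in>b. x \<in> e" if "x \<in> nodes n" for x
    using diagram_cover[OF b, of x] that nodes_iff by metis
  have side_nodes: "side i \<in> nodes n \<longleftrightarrow> i < n" for i by (simp add: nodes_iff side)
  show "\<Union>(?cell ` b) = pl ` nodes n \<union> pend ` {..<n}"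
  proof (rule subset_antisym)
    have "x \<in> nodes n" if "e \<in> b" "x \<in> e" for e x using diagram_mem[OF b that] by (simp add: nodes_iff)
    then have "?cell e \<subseteq> pl ` nodes n \<union> pend ` {..<n}" if "e \<in> b" for e
      using that side_nodes by (intro Un_mono image_mono subsetI) auto
    then show "\<Union>(?cell ` b) \<subseteq> pl ` nodes n \<union> pend ` {..<n}" by (rule UN_least)
    show "pl ` nodes n \<union> pend ` {..<n} \<subseteq> \<Union>(?cell ` b)"
    proof
      fix v assume "v \<in> pl ` nodes n \<union> pend ` {..<n}"
      then have "\<exists>x\<in>nodes n. v = pl x \<or> (\<exists>i. v = pend i \<and> x = side i)" using side_nodes by blast
      then obtain x where x: "x \<in> nodes n" "v = pl x \<or> (\<exists>i. v = pend i \<and> x = side i)" by (rule bexE)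
      from cover[OF x(1)] obtain e where e: "e \<in> b" "x \<in> e" by (rule bexE)
      have "v \<in> ?cell e" using x(2) e(2) by auto
      with e(1) show "v \<in> \<Union>(?cell ` b)" by (rule UN_I)
    qed
  qed
  show "C = D" if "C \<in> ?cell ` b" "D \<in> ?cell ` b" "C \<inter> D \<noteq> {}" for C D
  proof -
    from that obtain e e' v where e: "e \<in> b" "e' \<in> b" "C = ?cell e" "D = ?cell e'" "v \<in> ?cell e" "v \<in> ?cell e'" by blast
    from e(5) have "\<exists>x\<in>e. v = pl x \<or> (\<exists>i. v = pend i \<and> x = side i)" by blast
    then obtain x where x: "x \<in> e" "v = pl x \<or> (\<exists>i. v = pend i \<and> x = side i)" by (rule bexE)
    have "x \<in> e'" using x(2)
    proof (elim disjE exE conjE)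
      assume v: "v = pl x" show ?thesis using e(6) mem(1)[of x e'] unfolding v by (rule iffD1[rotated])
    next
      fix i assume v: "v = pend i" "x = side i"
      show ?thesis using e(6) mem(2)[of i e'] unfolding v by (rule iffD1[rotated])
    qed
    with x(1) have "\<exists>x. x \<in> e \<and> x \<in> e'" by blast
    then have "e = e'" using diagram_unique[OF b] e by blast
    then show ?thesis using e by simp
  qed
  show "{} \<notin> ?cell ` b" using b by (auto simp: diagrams_def)
  show "\<exists>C\<in>?cell ` b. x \<in> C \<and> y \<in> C" if xy: "{x, y} \<in> ?E" for x y
  proof -
    have "\<exists>e\<in>b. {x, y} \<subseteq> ?cell e"
      using xy
    proof
      assume "{x, y} \<in> {{pl (side i), pend i} | i. i < n}"
      then obtain i where i: "i < n" "{x, y} = {pl (side i), pend i}" by blast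
      then obtain e where "e \<in> b" "side i \<in> e" using cover side_nodes by blast
      then show ?thesis unfolding i(2) by (intro bexI[of _ e]) auto
    next
      assume "{x, y} \<in> (`) pl ` b"
      then show ?thesis by (metis Un_upper1 imageE)
    qed
    then show ?thesis by (metis (no_types, lifting) imageI insert_subset)
  qed
  show "\<exists>r\<in>C. \<forall>y\<in>C. (r, y) \<in> {(x, y). {x, y} \<in> ?E}\<^sup>*" if C: "C \<in> ?cell ` b" for C
  proof -
    from C obtain e where e: "e \<in> b" "C = ?cell e" by blast
    have "card e = 2" using b e by (simp add: diagrams_def)
    then obtain x y where xy: "e = {x, y}" by (auto simp: card_2_iff)
    have "pl ` e \<in> (`) pl ` b" using e(1) by (rule imageI)
    then have E: "{pl x, pl y} \<in> ?E" by (simp add: xy)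
    have 1: "(pl x, pl z) \<in> {(x, y). {x, y} \<in> ?E}\<^sup>*" if "z \<in> e" for z
    proof (cases "z = x")
      case False
      with that have "z = y" by (simp add: xy)
      then show ?thesis using rtrancl_edge[OF E] by (simp only:)
    qed simp
    have 2: "(pl x, pend i) \<in> {(x, y). {x, y} \<in> ?E}\<^sup>*" if "side i \<in> e" for i
    proof -
      have "i < n" using diagram_mem[OF b e(1) that] by (simp add: side)
      then have "{pl (side i), pend i} \<in> ?E" by (rule edge)
      then show ?thesis by (rule rtrancl_trans[OF 1[OF that] rtrancl_edge])
    qed
    have "\<forall>v\<in>C. (pl x, v) \<in> {(x, y). {x, y} \<in> ?E}\<^sup>*"
    proof
      fix v assume "v \<in> C"
      then consider z where "z \<in> e" "v = pl z" | i where "side i \<in> e" "v = pend i"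
        unfolding e(2) by blast
      then show "(pl x, v) \<in> {(x, y). {x, y} \<in> ?E}\<^sup>*"
        using 1 2 by cases (simp_all only:)
    qed
    moreover have "pl x \<in> C" using e xy by simp
    ultimately show ?thesis by blast
  qed
qed

lemma stacked_perm_left:
  assumes b: "b \<in> diagrams n" and \<sigma>: "\<sigma> permutes {..<n}"
  shows "stacked_components n (perm_diagram n \<sigma>) b =
    (\<lambda>e. place_above ` e \<union> (\<lambda>i. Bot (\<sigma> i)) ` {i. Lo i \<in> e}) ` b"
proof -
  have "inj place_above"
  proof (rule injI)
    fix x y show "place_above x = place_above y \<Longrightarrow> x = y" by (cases x; cases y) auto
  qed
  moreover have "inj (\<lambda>i. Bot (\<sigma> i))" using permutes_inj[OF \<sigma>] by (simp add: inj_def)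
  moreover have "Top ` {..<n} \<union> Mid ` {..<n} \<union> Bot ` {..<n} = place_above ` nodes n \<union> (\<lambda>i. Bot (\<sigma> i)) ` {..<n}"
  proof -
    have "(\<lambda>i. Bot (\<sigma> i)) ` {..<n} = Bot ` \<sigma> ` {..<n}" by (simp add: image_image)
    then show ?thesis by (simp add: permutes_image[OF \<sigma>] nodes_def image_Un image_image)
  qed
  moreover have "(`) place_below ` perm_diagram n \<sigma> = {{place_above (Lo i), Bot (\<sigma> i)} | i. i < n}"
    by (simp add: perm_diagram_def setcompr_eq_image image_image)
  ultimately show ?thesis
    unfolding stacked_components_def
    using components_pendant[OF b, of place_above Lo "\<lambda>i. Bot (\<sigma> i)"] by (simp add: place_above_in)
qed

lemma stacked_perm_right:
  assumes b: "b \<in> diagrams n" and \<sigma>: "\<sigma> permutes {..<n}"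
  shows "stacked_components n b (perm_diagram n (inv \<sigma>)) =
    (\<lambda>e. place_below ` e \<union> (\<lambda>i. Top (\<sigma> i)) ` {i. Up i \<in> e}) ` b"
proof -
  have "inj place_below"
  proof (rule injI)
    fix x y show "place_below x = place_below y \<Longrightarrow> x = y" by (cases x; cases y) auto
  qed
  moreover have "inj (\<lambda>i. Top (\<sigma> i))" using permutes_inj[OF \<sigma>] by (simp add: inj_def)
  moreover have "Top ` {..<n} \<union> Mid ` {..<n} \<union> Bot ` {..<n} = place_below ` nodes n \<union> (\<lambda>i. Top (\<sigma> i)) ` {..<n}"
  proof -
    have "(\<lambda>i. Top (\<sigma> i)) ` {..<n} = Top ` \<sigma> ` {..<n}" by (simp add: image_image)
    then show ?thesis by (simp add: permutes_image[OF \<sigma>] nodes_def image_Un image_image Un_ac)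
  qed
  moreover have "(`) place_above ` perm_diagram n (inv \<sigma>) = {{place_below (Up i), Top (\<sigma> i)} | i. i < n}"
  proof -
    have "(`) place_above ` perm_diagram n (inv \<sigma>) = (\<lambda>k. {Top k, Mid (inv \<sigma> k)}) ` {..<n}"
      by (simp add: perm_diagram_def setcompr_eq_image image_image lessThan_def)
    \<comment> \<open>Reindexing by \<open>\<sigma>\<close> turns the lines of
      \<open>inv \<sigma>\<close> into pendant lines ending at
      \<open>Top (\<sigma> i)\<close>.\<close>
    also have "\<dots> = (\<lambda>k. {Top k, Mid (inv \<sigma> k)}) ` \<sigma> ` {..<n}" by (simp only: permutes_image[OF \<sigma>])
    also have "\<dots> = (\<lambda>i. {Mid i, Top (\<sigma> i)}) ` {..<n}"
      by (simp add: image_image permutes_inverses[OF \<sigma>] insert_commute)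
    finally show ?thesis by (simp add: setcompr_eq_image lessThan_def)
  qed
  ultimately show ?thesis
    unfolding stacked_components_def
    using components_pendant[OF b, of place_below Up "\<lambda>i. Top (\<sigma> i)"] by (simp add: place_below_in Un_commute)
qed

lemma outer_mem: "Up i \<in> outer -` C \<longleftrightarrow> Top i \<in> C" "Lo i \<in> outer -` C \<longleftrightarrow> Bot i \<in> C"
  by auto

lemma compose_eq:
  assumes "stacked_components n b1 b2 = f ` b" "\<And>e. e \<in> b \<Longrightarrow> outer -` f e = g e" "\<And>e. e \<in> b \<Longrightarrow> g e \<noteq> {}"
  shows "diagram_compose n b1 b2 = g ` b"
proof -
  have "diagram_compose n b1 b2 = (\<lambda>C. outer -` C) ` {C \<in> f ` b. outer -` C \<noteq> {}}"
    unfolding diagram_compose_def assms(1) by blast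
  also have "{C \<in> f ` b. outer -` C \<noteq> {}} = f ` b"
    using assms(2,3) by auto
  also have "(\<lambda>C. outer -` C) ` f ` b = g ` b"
    unfolding image_image using assms(2) by (rule image_cong[OF refl])
  finally show ?thesis .
qed

lemma loops_eq_0:
  assumes "stacked_components n b1 b2 = f ` b" "\<And>e. e \<in> b \<Longrightarrow> outer -` f e \<noteq> {}"
  shows "closed_loops n b1 b2 = 0"
proof -
  have "\<not> f e \<subseteq> Mid ` {..<n}" if e: "e \<in> b" for e
  proof
    assume "f e \<subseteq> Mid ` {..<n}"
    moreover obtain x where "outer x \<in> f e" using assms(2)[OF e] by blast
    ultimately show False by (cases x) auto
  qed
  then have "{C \<in> f ` b. C \<subseteq> Mid ` {..<n}} = {}" by blast
  then show ?thesis by (simp add: closed_loops_def assms(1))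
qed

lemma relab_lower_mem:
  "Up i \<in> relab_lower \<sigma> ` e \<longleftrightarrow> Up i \<in> e" "Lo i \<in> relab_lower \<sigma> ` e \<longleftrightarrow> (\<exists>k. Lo k \<in> e \<and> i = \<sigma> k)"
proof -
  have *: "Up i = relab_lower \<sigma> x \<longleftrightarrow> x = Up i" "Lo i = relab_lower \<sigma> x \<longleftrightarrow> (\<exists>k. x = Lo k \<and> i = \<sigma> k)" for x
    by (cases x; auto)+
  show "Up i \<in> relab_lower \<sigma> ` e \<longleftrightarrow> Up i \<in> e" "Lo i \<in> relab_lower \<sigma> ` e \<longleftrightarrow> (\<exists>k. Lo k \<in> e \<and> i = \<sigma> k)"
    unfolding image_iff * by blast+
qed

lemma relab_upper_mem:
  "Lo i \<in> relab_upper \<sigma> ` e \<longleftrightarrow> Lo i \<in> e" "Up i \<in> relab_upper \<sigma> ` e \<longleftrightarrow> (\<exists>k. Up k \<in> e \<and> i = \<sigma> k)"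
proof -
  have *: "Lo i = relab_upper \<sigma> x \<longleftrightarrow> x = Lo i" "Up i = relab_upper \<sigma> x \<longleftrightarrow> (\<exists>k. x = Up k \<and> i = \<sigma> k)" for x
    by (cases x; auto)+
  show "Lo i \<in> relab_upper \<sigma> ` e \<longleftrightarrow> Lo i \<in> e" "Up i \<in> relab_upper \<sigma> ` e \<longleftrightarrow> (\<exists>k. Up k \<in> e \<and> i = \<sigma> k)"
    unfolding image_iff * by blast+
qed

lemma compose_perm_left:
  assumes b: "b \<in> diagrams n" and \<sigma>: "\<sigma> permutes {..<n}"
  shows "diagram_compose n (perm_diagram n \<sigma>) b = (`) (relab_lower \<sigma>) ` b"
    "closed_loops n (perm_diagram n \<sigma>) b = 0"
proof -
  have *: "outer -` (place_above ` e \<union> (\<lambda>i. Bot (\<sigma> i)) ` {i. Lo i \<in> e}) = relab_lower \<sigma> ` e" for e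
    unfolding set_eq_node outer_mem relab_lower_mem by (auto simp: place_image_mem)
  have ne: "relab_lower \<sigma> ` e \<noteq> {}" if "e \<in> b" for e using b that by (auto simp: diagrams_def)
  show "diagram_compose n (perm_diagram n \<sigma>) b = (`) (relab_lower \<sigma>) ` b"
    by (rule compose_eq[OF stacked_perm_left[OF assms] *]) (rule ne)
  show "closed_loops n (perm_diagram n \<sigma>) b = 0"
    by (rule loops_eq_0[OF stacked_perm_left[OF assms]]) (unfold *, rule ne)
qed

lemma compose_perm_right:
  assumes b: "b \<in> diagrams n" and \<sigma>: "\<sigma> permutes {..<n}"
  shows "diagram_compose n b (perm_diagram n (inv \<sigma>)) = (`) (relab_upper \<sigma>) ` b"
    "closed_loops n b (perm_diagram n (inv \<sigma>)) = 0"
proof -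
  have *: "outer -` (place_below ` e \<union> (\<lambda>i. Top (\<sigma> i)) ` {i. Up i \<in> e}) = relab_upper \<sigma> ` e" for e
    unfolding set_eq_node outer_mem relab_upper_mem by (auto simp: place_image_mem)
  have ne: "relab_upper \<sigma> ` e \<noteq> {}" if "e \<in> b" for e using b that by (auto simp: diagrams_def)
  show "diagram_compose n b (perm_diagram n (inv \<sigma>)) = (`) (relab_upper \<sigma>) ` b"
    by (rule compose_eq[OF stacked_perm_right[OF assms] *]) (rule ne)
  show "closed_loops n b (perm_diagram n (inv \<sigma>)) = 0"
    by (rule loops_eq_0[OF stacked_perm_right[OF assms]]) (unfold *, rule ne)
qed

lemma relab_bij_diagrams:
  assumes b: "b \<in> diagrams n" and f: "inj f" "f ` nodes n = nodes n"
  shows "(`) f ` b \<in> diagrams n"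
proof -
  have 1: "e' \<subseteq> nodes n \<and> card e' = 2" if "e' \<in> (`) f ` b" for e'
  proof -
    from that obtain e where e: "e \<in> b" "e' = f ` e" by blast
    then have "e \<subseteq> nodes n" "card e = 2" using b by (auto simp: diagrams_def)
    then show ?thesis using e f by (metis card_image image_mono inj_on_subset subset_UNIV)
  qed
  have 2: "\<exists>!e'. e' \<in> (`) f ` b \<and> z \<in> e'" if z: "z \<in> nodes n" for z
  proof -
    from z obtain x where x: "x \<in> nodes n" "z = f x" using f(2) by (metis imageE)
    then obtain y where y: "{x, y} \<in> b" using diagram_edge[OF b] by blast
    show ?thesis
    proof (rule ex1I)
      show "f ` {x, y} \<in> (`) f ` b \<and> z \<in> f ` {x, y}" using y x by blast
      fix e' assume e': "e' \<in> (`) f ` b \<and> z \<in> e'"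
      then obtain e where e: "e \<in> b" "e' = f ` e" by blast
      then have "x \<in> e" using e' x f(1) by (metis inj_image_mem_iff)
      then have "e = {x, y}" using diagram_unique[OF b e(1) y] by simp
      then show "e' = f ` {x, y}" using e by simp
    qed
  qed
  show ?thesis using 1 2 by (simp add: diagrams_def)
qed

lemma relab_lower_diagrams:
  assumes b: "b \<in> diagrams n" and \<sigma>: "\<sigma> permutes {..<n}"
  shows "(`) (relab_lower \<sigma>) ` b \<in> diagrams n"
proof (rule relab_bij_diagrams[OF b])
  have inj: "inj \<sigma>" using \<sigma> by (rule permutes_inj)
  show "inj (relab_lower \<sigma>)"
  proof (rule injI)
    fix x y assume "relab_lower \<sigma> x = relab_lower \<sigma> y"
    then show "x = y" using inj by (cases x; cases y) (auto simp: inj_eq)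
  qed
  show "relab_lower \<sigma> ` nodes n = nodes n"
  proof -
    have "relab_lower \<sigma> ` nodes n = Up ` {..<n} \<union> Lo ` \<sigma> ` {..<n}"
      by (simp add: nodes_def image_Un image_image)
    then show ?thesis by (simp only: permutes_image[OF \<sigma>] nodes_def)
  qed
qed

section \<open>Bilinearity and sums over conjugates\<close>

lemma brauer_mult_single:
  "brauer_mult n \<delta> (Poly_Mapping.single b1 c) (Poly_Mapping.single b2 d) =
     Poly_Mapping.single (diagram_compose n b1 b2) (c * d * \<delta> ^ closed_loops n b1 b2)"
  by (simp add: brauer_mult_def mult.assoc)

lemma lin_ext_add_fun: "lin_ext (\<lambda>m. g m + h m) f = lin_ext g f + lin_ext h f"
  by (simp add: lin_ext_def cscale_add sum.distrib)

lemma lin_ext_sum_fun: "lin_ext (\<lambda>m. \<Sum>x\<in>A. g x m) f = (\<Sum>x\<in>A. lin_ext (g x) f)"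
proof (induction A rule: infinite_finite_induct)
  case (insert x A) then show ?case by (simp add: lin_ext_add_fun)
qed (simp_all add: lin_ext_def)

lemma brauer_mult_sum:
  "brauer_mult n \<delta> (\<Sum>x\<in>A. f x) g = (\<Sum>x\<in>A. brauer_mult n \<delta> (f x) g)"
  "brauer_mult n \<delta> g (\<Sum>x\<in>A. f x) = (\<Sum>x\<in>A. brauer_mult n \<delta> g (f x))"
  by (simp_all add: brauer_mult_def lin_ext_sum lin_ext_sum_fun)

lemma gamma_elt_conjd:
  assumes b: "b \<in> diagrams n"
  shows "gamma_elt n \<delta> b = (\<Sum>\<sigma> | \<sigma> permutes {..<n}. dgr (conjd \<sigma> b))"
  unfolding gamma_elt_def
proof (rule sum.cong)
  fix \<sigma> assume "\<sigma> \<in> {\<sigma>. \<sigma> permutes {..<n}}"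
  then have \<sigma>: "\<sigma> permutes {..<n}" by simp
  have "relab_upper \<sigma> (relab_lower \<sigma> x) = relab \<sigma> x" for x by (cases x) auto
  then have "(`) (relab_upper \<sigma>) ` (`) (relab_lower \<sigma>) ` b = conjd \<sigma> b"
    by (simp add: conjd_def image_image)
  then show "brauer_mult n \<delta> (brauer_mult n \<delta> (dgr (perm_diagram n \<sigma>)) (dgr b)) (dgr (perm_diagram n (inv \<sigma>))) = dgr (conjd \<sigma> b)"
    using compose_perm_left[OF b \<sigma>] compose_perm_right[OF relab_lower_diagrams[OF b \<sigma>] \<sigma>]
    by (simp add: dgr_def brauer_mult_single)
qed simp

section \<open>The product of \<open>d_diagram n i j\<close> with a diagram\<close>

context
  fixes n b i j
  assumes b: "b \<in> diagrams n" and i: "i < n" and j: "j < n" and ij: "i \<noteq> j"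
begin

text \<open>The lines of \<open>b\<close> glued together by the upper arc; they may be one and the
  same arc.\<close>

definition touched :: "node set" where
  "touched = \<Union>{e \<in> b. Lo i \<in> e \<or> Lo j \<in> e}"

definition blocks :: "node set set" where
  "blocks = insert touched {e \<in> b. Lo i \<notin> e \<and> Lo j \<notin> e}"

text \<open>The component over a block: a lower node other than \<open>i\<close> and
  \<open>j\<close> is continued by a vertical line to the bottom row, while \<open>Bot i\<close> and
  \<open>Bot j\<close> form a component of their own.\<close>

definition cell :: "node set \<Rightarrow> stacked_node set" where
  "cell X = place_above ` X \<union> Bot ` (los X - {i, j})"

lemma cell_mem: "Top k \<in> cell X \<longleftrightarrow> Up k \<in> X" "Mid k \<in> cell X \<longleftrightarrow> Lo k \<in> X"
  "Bot k \<in> cell X \<longleftrightarrow> Lo k \<in> X \<and> k \<noteq> i \<and> k \<noteq> j"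
  unfolding cell_def by (auto simp: place_image_mem los_def)

lemma touched_Lo: "Lo i \<in> touched" "Lo j \<in> touched"
proof -
  obtain e where "e \<in> b" "Lo i \<in> e" using diagram_cover[OF b, of "Lo i"] i by auto
  then show "Lo i \<in> touched" unfolding touched_def by blast
  obtain e where "e \<in> b" "Lo j \<in> e" using diagram_cover[OF b, of "Lo j"] j by auto
  then show "Lo j \<in> touched" unfolding touched_def by blast
qed

lemma block_of_edge:
  assumes "e \<in> b" obtains X where "X \<in> blocks" "e \<subseteq> X"
proof (cases "Lo i \<in> e \<or> Lo j \<in> e")
  case True
  then have "e \<subseteq> touched" using assms unfolding touched_def by blast
  then show ?thesis using that by (auto simp: blocks_def)
next
  case False
  then have "e \<in> blocks" using assms by (simp add: blocks_def)
  then show ?thesis using that by blast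
qed

lemma blocks_disjoint:
  assumes "X \<in> blocks" "Y \<in> blocks" "x \<in> X" "x \<in> Y" shows "X = Y"
proof -
  have *: "\<not> x \<in> touched" if "X \<in> b" "Lo i \<notin> X" "Lo j \<notin> X" "x \<in> X" for X
  proof
    assume "x \<in> touched"
    then obtain e where "e \<in> b" "Lo i \<in> e \<or> Lo j \<in> e" "x \<in> e" unfolding touched_def by blast
    then show False using diagram_unique[OF b] that by metis
  qed
  have **: "X = Y" if "X \<in> b" "Y \<in> b" using diagram_unique[OF b that assms(3,4)] .
  show ?thesis using assms * ** by (simp add: blocks_def) metis
qed

lemma block_nodes: "X \<in> blocks \<Longrightarrow> x \<in> X \<Longrightarrow> node_index x < n"
  using diagram_mem[OF b] by (auto simp: blocks_def touched_def)

lemma block_cover: assumes "node_index x < n" obtains X where "X \<in> blocks" "x \<in> X"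
proof -
  obtain e where "e \<in> b" "x \<in> e" using diagram_cover[OF b assms] by blast
  then show ?thesis using block_of_edge that by (metis subsetD)
qed

lemma stacked_d: "stacked_components n (d_diagram n i j) b = insert {Bot i, Bot j} (cell ` blocks)"
  unfolding stacked_components_def
proof (rule components_eq)
  let ?E = "(`) place_below ` d_diagram n i j \<union> (`) place_above ` b"
  let ?R = "{(x, y). {x, y} \<in> ?E}\<^sup>*"
  have below: "(`) place_below ` d_diagram n i j =
      {{Mid i, Mid j}, {Bot i, Bot j}} \<union> {{Mid k, Bot k} | k. k < n \<and> k \<noteq> i \<and> k \<noteq> j}"
    unfolding d_diagram_def image_Un by (simp add: setcompr_eq_image image_image)
  have E1: "{Mid i, Mid j} \<in> ?E" "{Bot i, Bot j} \<in> ?E" unfolding below by simp_all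
  have E2: "{Mid k, Bot k} \<in> ?E" if "k < n" "k \<noteq> i" "k \<noteq> j" for k
    unfolding below using that by (intro UnI1 UnI2 CollectI exI[of _ k]) simp
  show "\<Union> (insert {Bot i, Bot j} (cell ` blocks)) = Top ` {..<n} \<union> Mid ` {..<n} \<union> Bot ` {..<n}"
  proof (rule subset_antisym)
    show "\<Union> (insert {Bot i, Bot j} (cell ` blocks)) \<subseteq> Top ` {..<n} \<union> Mid ` {..<n} \<union> Bot ` {..<n}"
    proof
      fix v assume "v \<in> \<Union> (insert {Bot i, Bot j} (cell ` blocks))"
      then consider "v = Bot i \<or> v = Bot j" | X where "X \<in> blocks" "v \<in> cell X" by blast
      then show "v \<in> Top ` {..<n} \<union> Mid ` {..<n} \<union> Bot ` {..<n}"
      proof cases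
        case 1 then show ?thesis using i j by auto
      next
        case 2 then show ?thesis using block_nodes[OF 2(1), of "Up _"] block_nodes[OF 2(1), of "Lo _"]
          by (cases v) (auto simp: cell_mem)
      qed
    qed
    show "Top ` {..<n} \<union> Mid ` {..<n} \<union> Bot ` {..<n} \<subseteq> \<Union> (insert {Bot i, Bot j} (cell ` blocks))"
    proof
      fix v assume v: "v \<in> Top ` {..<n} \<union> Mid ` {..<n} \<union> Bot ` {..<n}"
      show "v \<in> \<Union> (insert {Bot i, Bot j} (cell ` blocks))"
      proof (cases "v = Bot i \<or> v = Bot j")
        case False
        define x where "x = (case v of Top k \<Rightarrow> Up k | Mid k \<Rightarrow> Lo k | Bot k \<Rightarrow> Lo k)"
        have "node_index x < n" using v by (auto simp: x_def)
        then obtain X where X: "X \<in> blocks" "x \<in> X" by (rule block_cover)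
        then have "v \<in> cell X" using False by (cases v) (auto simp: cell_mem x_def)
        then show ?thesis using X(1) by blast
      qed auto
    qed
  qed
  show "C = D" if CD: "C \<in> insert {Bot i, Bot j} (cell ` blocks)" "D \<in> insert {Bot i, Bot j} (cell ` blocks)" "C \<inter> D \<noteq> {}" for C D
  proof -
    have 1: "{Bot i, Bot j} \<inter> cell X = {}" for X by (simp add: cell_mem)
    have 2: "cell X = cell Y" if XY: "X \<in> blocks" "Y \<in> blocks" "cell X \<inter> cell Y \<noteq> {}" for X Y
    proof -
      obtain v where v: "v \<in> cell X" "v \<in> cell Y" using XY(3) by blast
      have "\<exists>x. x \<in> X \<and> x \<in> Y" using v by (cases v) (auto simp: cell_mem)
      then have "X = Y" using blocks_disjoint[OF XY(1,2)] by blast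
      then show ?thesis by simp
    qed
    from CD(1) show ?thesis
    proof
      assume C: "C = {Bot i, Bot j}"
      with CD(2,3) 1 show ?thesis by blast
    next
      assume C: "C \<in> cell ` blocks"
      from CD(2) show ?thesis
      proof
        assume "D = {Bot i, Bot j}"
        with CD(3) C 1 show ?thesis by blast
      next
        assume "D \<in> cell ` blocks"
        with C CD(3) 2 show ?thesis by blast
      qed
    qed
  qed
  show "{} \<notin> insert {Bot i, Bot j} (cell ` blocks)"
  proof -
    have "X \<noteq> {}" if "X \<in> blocks" for X
      using that touched_Lo b by (auto simp: blocks_def diagrams_def)
    then have "cell X \<noteq> {}" if "X \<in> blocks" for X using that by (simp add: cell_def)
    then show ?thesis by auto
  qed
  show "\<exists>C\<in>insert {Bot i, Bot j} (cell ` blocks). x \<in> C \<and> y \<in> C" if xy: "{x, y} \<in> ?E" for x y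
  proof -
    have sub: ?thesis if "{x, y} \<subseteq> C" "C \<in> insert {Bot i, Bot j} (cell ` blocks)" for C
      using that by (intro bexI[of _ C]) simp_all
    from xy consider "{x, y} = {Mid i, Mid j}" | "{x, y} = {Bot i, Bot j}"
      | k where "{x, y} = {Mid k, Bot k}" "k < n" "k \<noteq> i" "k \<noteq> j" | "{x, y} \<in> (`) place_above ` b"
      unfolding below by blast
    then show ?thesis
    proof cases
      case 1
      show ?thesis by (rule sub[of "cell touched"]) (simp_all add: 1 cell_mem touched_Lo blocks_def)
    next
      case 2
      show ?thesis by (rule sub[of "{Bot i, Bot j}"]) (simp_all only: 2 insertI1 subset_refl)
    next
      case 3
      obtain X where X: "X \<in> blocks" "Lo k \<in> X" using block_cover[of "Lo k"] 3(2) by auto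
      show ?thesis by (rule sub[of "cell X"]) (use X 3 in \<open>simp_all add: cell_mem\<close>)
    next
      case 4
      then obtain e where e: "e \<in> b" "{x, y} = place_above ` e" by (rule imageE) simp
      obtain X where X: "X \<in> blocks" "e \<subseteq> X" using block_of_edge[OF e(1)] by blast
      show ?thesis
        by (rule sub[of "cell X"]) (use X in \<open>auto simp: e(2) cell_def\<close>)
    qed
  qed
  show "\<exists>r\<in>C. \<forall>y\<in>C. (r, y) \<in> ?R" if C: "C \<in> insert {Bot i, Bot j} (cell ` blocks)" for C
    using C
  proof
    assume C: "C = {Bot i, Bot j}"
    show ?thesis using rtrancl_edge[OF E1(2)] by (intro bexI[of _ "Bot i"]) (simp_all add: C del: Un_iff)
  next
    assume "C \<in> cell ` blocks"
    then obtain X where X: "X \<in> blocks" "C = cell X" by blast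
    have in_edge: "(place_above x, place_above z) \<in> ?R" if e: "e \<in> b" "x \<in> e" "z \<in> e" for e x z
    proof (cases "x = z")
      case False
      obtain y where "e = {x, y}" using diagram_edge'[OF b e(1,2)] by blast
      with False e(3) have "e = {x, z}" by auto
      then have "place_above ` e = {place_above x, place_above z}" by simp
      then have "{place_above x, place_above z} \<in> ?E" using e(1) by (metis UnI2 imageI)
      then show ?thesis by (rule rtrancl_edge)
    qed simp
    have "\<exists>r\<in>X. \<forall>z\<in>X. (place_above r, place_above z) \<in> ?R"
    proof (cases "X = touched")
      case True
      \<comment> \<open>A line at \<open>Lo j\<close> is reached from \<open>Mid i\<close> across
        the upper arc of the diagram below.\<close>
      have "(place_above (Lo i), place_above z) \<in> ?R" if z: "z \<in> touched" for z
      proof -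
        from z obtain e where e: "e \<in> b" "Lo i \<in> e \<or> Lo j \<in> e" "z \<in> e" unfolding touched_def by blast
        from e(2) show ?thesis
        proof
          assume "Lo i \<in> e"
          from in_edge[OF e(1) this e(3)] show ?thesis .
        next
          assume "Lo j \<in> e"
          from in_edge[OF e(1) this e(3)] have "(Mid j, place_above z) \<in> ?R" by (simp only: place_above.simps)
          with rtrancl_edge[OF E1(1)] show ?thesis
            unfolding place_above.simps by (rule rtrancl_trans)
        qed
      qed
      then show ?thesis unfolding True using touched_Lo(1) by blast
    next
      case False
      then have Xb: "X \<in> b" using X(1) by (simp add: blocks_def)
      then have "X \<noteq> {}" using b by (auto simp: diagrams_def)
      then obtain x where "x \<in> X" by blast
      then show ?thesis using in_edge[OF Xb] by blast
    qed
    then obtain r where r: "r \<in> X" "\<And>z. z \<in> X \<Longrightarrow> (place_above r, place_above z) \<in> ?R" by blast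
    have "(place_above r, v) \<in> ?R" if v: "v \<in> cell X" for v
    proof (cases "v \<in> place_above ` X")
      case True then show ?thesis using r(2) by blast
    next
      case False
      then obtain k where k: "v = Bot k" "Lo k \<in> X" "k \<noteq> i" "k \<noteq> j" using v by (auto simp: cell_def los_def)
      have "k < n" using block_nodes[OF X(1) k(2)] by simp
      have "(place_above r, Mid k) \<in> ?R" using r(2)[OF k(2)] by (simp only: place_above.simps)
      from rtrancl_trans[OF this rtrancl_edge[OF E2[OF \<open>k < n\<close> k(3,4)]]]
      show ?thesis by (simp only: k(1))
    qed
    moreover have "place_above r \<in> cell X" using r(1) by (simp add: cell_def)
    ultimately show ?thesis unfolding X(2) by blast
  qed
qed

lemma outer_cell: "outer -` cell X = X - {Lo i, Lo j}"
  unfolding set_eq_node outer_mem by (auto simp: cell_mem)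

lemma compose_d: "diagram_compose n (d_diagram n i j) b = dact i j b"
proof -
  have *: "X - {Lo i, Lo j} = X" "X \<noteq> {}" if "X \<in> b" "Lo i \<notin> X" "Lo j \<notin> X" for X
    using that b by (auto simp: diagrams_def)
  have Bot: "outer -` {Bot i, Bot j} = {Lo i, Lo j}"
    unfolding set_eq_node outer_mem by simp
  have "diagram_compose n (d_diagram n i j) b = (\<lambda>C. outer -` C) ` (insert {Bot i, Bot j} (cell ` blocks)) - {{}}"
    unfolding diagram_compose_def stacked_d by blast
  also have "(\<lambda>C. outer -` C) ` (insert {Bot i, Bot j} (cell ` blocks)) =
      insert {Lo i, Lo j} ((\<lambda>X. X - {Lo i, Lo j}) ` blocks)"
    by (simp add: image_image Bot outer_cell)
  also have "(\<lambda>X. X - {Lo i, Lo j}) ` blocks = insert (touched - {Lo i, Lo j}) {e \<in> b. Lo i \<notin> e \<and> Lo j \<notin> e}"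
  proof -
    have "(\<lambda>X. X - {Lo i, Lo j}) ` {e \<in> b. Lo i \<notin> e \<and> Lo j \<notin> e} = {e \<in> b. Lo i \<notin> e \<and> Lo j \<notin> e}"
      using * by (intro trans[OF image_cong image_ident]) auto
    then show ?thesis by (simp add: blocks_def)
  qed
  also have "insert {Lo i, Lo j} (insert (touched - {Lo i, Lo j}) {e \<in> b. Lo i \<notin> e \<and> Lo j \<notin> e}) - {{}} = dact i j b"
  proof -
    have "{} \<notin> {e \<in> b. Lo i \<notin> e \<and> Lo j \<notin> e}" using * by blast
    then show ?thesis unfolding dact_def touched_def by blast
  qed
  finally show ?thesis .
qed

text \<open>A closed loop is a component without outer nodes. Only the block \<open>touched\<close>
  can give one, namely when its nodes are just \<open>Lo i\<close> and \<open>Lo j\<close>.\<close>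

lemma loops_d: "closed_loops n (d_diagram n i j) b = of_bool ({Lo i, Lo j} \<in> b)"
proof -
  have sub: "cell X \<subseteq> Mid ` {..<n} \<longleftrightarrow> X \<subseteq> {Lo i, Lo j}" if X: "X \<in> blocks" for X
  proof
    assume A: "cell X \<subseteq> Mid ` {..<n}"
    have "x \<in> {Lo i, Lo j}" if "x \<in> X" for x
    proof (rule ccontr)
      assume "x \<notin> {Lo i, Lo j}"
      then have "x \<in> outer -` cell X" using that by (simp add: outer_cell)
      then have "outer x \<in> Mid ` {..<n}" using A by blast
      then show False by (cases x) auto
    qed
    then show "X \<subseteq> {Lo i, Lo j}" by blast
  next
    assume A: "X \<subseteq> {Lo i, Lo j}"
    show "cell X \<subseteq> Mid ` {..<n}"
    proof
      fix v assume "v \<in> cell X"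
      then show "v \<in> Mid ` {..<n}" using A i j by (cases v) (auto simp: cell_mem)
    qed
  qed
  have untouched: "\<not> X \<subseteq> {Lo i, Lo j}" if X: "X \<in> b" "Lo i \<notin> X" "Lo j \<notin> X" for X
  proof
    assume "X \<subseteq> {Lo i, Lo j}"
    then have "X = {}" using X by blast
    then show False using X(1) b by (auto simp: diagrams_def)
  qed
  have arc: "touched \<subseteq> {Lo i, Lo j} \<longleftrightarrow> {Lo i, Lo j} \<in> b"
  proof
    assume A: "touched \<subseteq> {Lo i, Lo j}"
    obtain y where y: "{Lo i, y} \<in> b" "Lo i \<noteq> y" using diagram_edge[OF b, of "Lo i"] i by (auto simp: nodes_iff)
    then have "y \<in> touched" unfolding touched_def by blast
    then show "{Lo i, Lo j} \<in> b" using A y by auto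
  next
    assume A: "{Lo i, Lo j} \<in> b"
    then show "touched \<subseteq> {Lo i, Lo j}"
      unfolding touched_def using diagram_unique[OF b _ A] by blast
  qed
  have "{C \<in> insert {Bot i, Bot j} (cell ` blocks). C \<subseteq> Mid ` {..<n}} = cell ` {X \<in> blocks. X \<subseteq> {Lo i, Lo j}}"
    using sub by auto
  also have "{X \<in> blocks. X \<subseteq> {Lo i, Lo j}} = (if {Lo i, Lo j} \<in> b then {touched} else {})"
    using untouched unfolding arc[symmetric] by (auto simp: blocks_def)
  finally show ?thesis by (simp add: closed_loops_def stacked_d)
qed

end

lemma brauer_mult_d:
  assumes "b \<in> diagrams n" "i < n" "j < n" "i \<noteq> j"
  shows "brauer_mult n \<delta> (dgr (d_diagram n i j)) (dgr b) =
    Poly_Mapping.single (dact i j b) (if {Lo i, Lo j} \<in> b then \<delta> else 1)"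
  using compose_d[OF assms] loops_d[OF assms] by (simp add: dgr_def brauer_mult_single)

text \<open>\<open>\<sigma>\<close> need not preserve \<open>i < j\<close>, so the sum is doubled to
  ordered pairs, permuted there, and halved again.\<close>

lemma sum_pairs_permute:
  fixes F :: "nat \<Rightarrow> nat \<Rightarrow> ('a \<Rightarrow>\<^sub>0 complex)"
  assumes sym: "\<And>i j. F i j = F j i" and \<sigma>: "\<sigma> permutes {..<n}"
  shows "(\<Sum>j<n. \<Sum>i<j. F i j) = (\<Sum>j<n. \<Sum>i<j. F (\<sigma> i) (\<sigma> j))"
proof -
  let ?X = "\<Sum>j<n. \<Sum>i<j. F i j" and ?Y = "\<Sum>j<n. \<Sum>i<j. F (\<sigma> i) (\<sigma> j)"
  have perm: "(\<Sum>i<n. g i) = (\<Sum>i<n. g (\<sigma> i))" for g :: "nat \<Rightarrow> ('a \<Rightarrow>\<^sub>0 complex)"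
    using sum.reindex_bij_betw[OF permutes_imp_bij[OF \<sigma>], of g] by simp
  have "?X + ?X = (\<Sum>i<n. \<Sum>j<n. if i = j then 0 else F i j)"
    by (rule sum_symmetric_pairs[symmetric]) (rule sym)
  also have "\<dots> = (\<Sum>i<n. \<Sum>j<n. if \<sigma> i = \<sigma> j then 0 else F (\<sigma> i) (\<sigma> j))"
    by (subst perm) (intro sum.cong refl perm)
  also have "\<dots> = (\<Sum>i<n. \<Sum>j<n. if i = j then 0 else F (\<sigma> i) (\<sigma> j))"
    using permutes_inj[OF \<sigma>] by (simp add: inj_eq)
  also have "\<dots> = ?Y + ?Y"
    by (rule sum_symmetric_pairs) (rule sym)
  finally have "cscale (1/2) (?X + ?X) = cscale (1/2) (?Y + ?Y)" by simp
  then show ?thesis by (simp add: cscale_add flip: cscale_add_left)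
qed

text \<open>Conjugating \<open>b\<close> by \<open>\<sigma>\<close> is compensated by renaming the
  summands of \<open>A_elt n\<close>, so each reconnection commutes with passing to the conjugacy
  sum.\<close>

lemma A_elt_gamma:
  assumes b: "b \<in> diagrams n"
  shows "brauer_mult n \<delta> (A_elt n) (gamma_elt n \<delta> b) =
    (\<Sum>j<n. \<Sum>i<j. cscale (if {Lo i, Lo j} \<in> b then \<delta> else 1) (gamma_elt n \<delta> (dact i j b)))"
proof -
  let ?P = "{\<sigma>. \<sigma> permutes {..<n}}"
  define F where "F b i j = Poly_Mapping.single (dact i j b) (if {Lo i, Lo j} \<in> b then \<delta> else 1)" for b i j
  have F_sym: "F b i j = F b j i" for b i j
    unfolding F_def by (metis dact_commute insert_commute)
  have "brauer_mult n \<delta> (A_elt n) (gamma_elt n \<delta> b) =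
      (\<Sum>\<sigma>\<in>?P. \<Sum>j<n. \<Sum>i<j. brauer_mult n \<delta> (dgr (d_diagram n i j)) (dgr (conjd \<sigma> b)))"
    unfolding A_elt_def gamma_elt_conjd[OF b] brauer_mult_sum ..
  also have "\<dots> = (\<Sum>\<sigma>\<in>?P. \<Sum>j<n. \<Sum>i<j. F (conjd \<sigma> b) i j)"
    unfolding F_def by (intro sum.cong refl brauer_mult_d conjd_diagrams b) auto
  \<comment> \<open>The renaming differs from one \<open>\<sigma>\<close> to the next and is chosen
    so that \<open>dact_conjd\<close> applies.\<close>
  also have "\<dots> = (\<Sum>\<sigma>\<in>?P. \<Sum>j<n. \<Sum>i<j. F (conjd \<sigma> b) (\<sigma> i) (\<sigma> j))"
    by (intro sum.cong refl sum_pairs_permute F_sym) simp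
  also have "\<dots> = (\<Sum>\<sigma>\<in>?P. \<Sum>j<n. \<Sum>i<j. cscale (if {Lo i, Lo j} \<in> b then \<delta> else 1) (dgr (conjd \<sigma> (dact i j b))))"
  proof (intro sum.cong refl)
    fix \<sigma> j i assume A: "\<sigma> \<in> ?P" "j \<in> {..<n}" "i \<in> {..<j}"
    then have \<sigma>: "\<sigma> permutes {..<n}" and lt: "i < n" "j < n" "i \<noteq> j" by auto
    have "{Lo (\<sigma> i), Lo (\<sigma> j)} \<in> conjd \<sigma> b \<longleftrightarrow> {Lo i, Lo j} \<in> b"
      using conjd_edge_iff[OF permutes_inj[OF \<sigma>], of "Lo i" "Lo j" b] by simp
    then show "F (conjd \<sigma> b) (\<sigma> i) (\<sigma> j) = cscale (if {Lo i, Lo j} \<in> b then \<delta> else 1) (dgr (conjd \<sigma> (dact i j b)))"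
      by (simp add: F_def dact_conjd[OF b \<sigma> lt] dgr_def)
  qed
  also have "\<dots> = (\<Sum>j<n. \<Sum>i<j. \<Sum>\<sigma>\<in>?P. cscale (if {Lo i, Lo j} \<in> b then \<delta> else 1) (dgr (conjd \<sigma> (dact i j b))))"
    by (subst sum.swap[of _ ?P]) (intro sum.cong refl sum.swap)
  also have "\<dots> = (\<Sum>j<n. \<Sum>i<j. cscale (if {Lo i, Lo j} \<in> b then \<delta> else 1) (gamma_elt n \<delta> (dact i j b)))"
  proof (intro sum.cong refl)
    fix j i assume "j \<in> {..<n}" "i \<in> {..<j}"
    then have "dact i j b \<in> diagrams n" by (intro dact_diagrams b) auto
    then show "(\<Sum>\<sigma>\<in>?P. cscale (if {Lo i, Lo j} \<in> b then \<delta> else 1) (dgr (conjd \<sigma> (dact i j b)))) =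
        cscale (if {Lo i, Lo j} \<in> b then \<delta> else 1) (gamma_elt n \<delta> (dact i j b))"
      by (simp add: gamma_elt_conjd cscale_sum)
  qed
  finally show ?thesis .
qed

subsection \<open>Monomials and conjugacy classes\<close>

text \<open>The undotted case of \<open>conjugate_configs\<close>: the labels given by
  \<open>elab\<close> contain no marks.\<close>

lemma conjugate_of_monomial:
  assumes b: "b \<in> diagrams n" "b' \<in> diagrams n" and eq: "diagram_monomial n b = diagram_monomial n b'"
  obtains \<sigma> where "\<sigma> permutes {..<n}" "b' = conjd \<sigma> b"
proof -
  obtain ws where ws: "config n ws" "diag ws = b" using config_ex[OF b(1)] by blast
  obtain ws' where ws': "config n ws'" "diag ws' = b'" using config_ex[OF b(2)] by blast
  have cm: "cmono elab ws = cmono elab ws'"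
    using eq diagram_monomial_config[OF ws(1)] diagram_monomial_config[OF ws'(1)] ws(2) ws'(2) by simp
  have two: "count_list (map elab es) Pd \<le> 2" for es
  proof -
    have "elab e \<noteq> Pd" for e by (simp add: elab_def)
    then have "Pd \<notin> elab ` set es" by (metis imageE)
    then have "Pd \<notin> set (map elab es)" by simp
    then have "count_list (map elab es) Pd = 0" by (simp add: count_list_0_iff)
    then show ?thesis by simp
  qed
  obtain \<sigma> where "\<sigma> permutes {..<n}" "diag ws' = conjd \<sigma> (diag ws)"
    by (rule conjugate_configs[OF ws(1) ws'(1) cm], simp, simp, rule two, blast)
  then show ?thesis using that ws(2) ws'(2) by simp
qed

lemma gamma_elt_conj:
  assumes b: "b \<in> diagrams n" and \<sigma>: "\<sigma> permutes {..<n}"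
  shows "gamma_elt n \<delta> (conjd \<sigma> b) = gamma_elt n \<delta> b"
proof -
  have "relab \<tau> (relab \<sigma> x) = relab (\<tau> \<circ> \<sigma>) x" for \<tau> x by (cases x) auto
  then have "conjd \<tau> (conjd \<sigma> b) = conjd (\<tau> \<circ> \<sigma>) b" for \<tau>
    by (simp add: conjd_def image_image)
  then show ?thesis
    using sum_permutations_compose_right[OF \<sigma>, of "\<lambda>\<tau>. dgr (conjd \<tau> b)"]
    by (simp add: gamma_elt_conjd[OF b] gamma_elt_conjd[OF conjd_diagrams(1)[OF b \<sigma>]])
qed

text \<open>The description in \<open>e_mono\<close> has a unique value, because diagrams with one
  monomial are conjugate and their conjugacy sums agree.\<close>

lemma e_mono_eq:
  assumes b: "b \<in> diagrams n" shows "e_mono n \<delta> (diagram_monomial n b) = gamma_elt n \<delta> b"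
  unfolding e_mono_def
proof (rule the_equality)
  fix x assume "\<exists>b'\<in>diagrams n. diagram_monomial n b' = diagram_monomial n b \<and> x = gamma_elt n \<delta> b'"
  then obtain b' where b': "b' \<in> diagrams n" "diagram_monomial n b = diagram_monomial n b'" "x = gamma_elt n \<delta> b'" by metis
  obtain \<sigma> where "\<sigma> permutes {..<n}" "b' = conjd \<sigma> b" by (rule conjugate_of_monomial[OF b b'(1,2)])
  then show "x = gamma_elt n \<delta> b" using gamma_elt_conj[OF b] b'(3) by simp
qed (use b in blast)

lemma monic_monomial_diagram:
  assumes "\<zeta> \<in> monic_monomials n" obtains b where "b \<in> diagrams n" "diagram_monomial n b = \<zeta>"
proof -
  have \<zeta>: "set_mset \<zeta> \<subseteq> frakb" "mdeg \<zeta> = n" using assms by (auto simp: monic_monomials_def)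
  obtain Ms where Ms: "\<zeta> = mset (map bracelet Ms)" "\<And>w. w \<in> set Ms \<Longrightarrow> w \<noteq> [] \<and> closed_word w \<and> set w \<subseteq> letters"
    by (rule mset_frakb_words[OF \<zeta>(1)]) blast
  obtain m ws where ws: "config m ws" "list_all2 lifts ws Ms"
    by (rule config_lift[of Ms]) (use Ms in auto)
  have c: "cmono elab ws = \<zeta>" using cmono_lifts[OF ws(2)] Ms by simp
  then have "m = n" using mdeg_cmono[of elab ws] config_length[OF ws(1)] \<zeta>(2) by simp
  then show ?thesis
    using that[of "diag ws"] diag_diagrams[of n ws] diagram_monomial_config[of n ws] ws(1) c by simp
qed

lemma diagram_monomial_monic:
  assumes "b \<in> diagrams n" shows "diagram_monomial n b \<in> monic_monomials n"
proof -
  obtain ws where ws: "config n ws" "diag ws = b" using config_ex[OF assms] by blast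
  have "mdeg (diagram_monomial n b) = n"
    using diagram_monomial_config[OF ws(1)] ws(2) mdeg_cmono[of elab ws] config_length[OF ws(1)] by simp
  then show ?thesis using diagram_monomial_frakb[OF assms] by (simp add: monic_monomials_def)
qed

lemma poly_alg_deg_alt: "poly_alg_deg n = {f. \<forall>m\<in>Poly_Mapping.keys f. m \<in> monic_monomials n}"
  by (auto simp: poly_alg_deg_def poly_alg_def monic_monomials_def)

lemma lookup_gamma_elt:
  assumes "b \<in> diagrams n"
  shows "Poly_Mapping.lookup (gamma_elt n \<delta> b) b' = of_nat (card {\<sigma>. \<sigma> permutes {..<n} \<and> conjd \<sigma> b = b'})"
proof -
  have "finite {\<sigma>. \<sigma> permutes {..<n}}" by (rule finite_permutations) simp
  then show ?thesis
    by (simp add: gamma_elt_conjd[OF assms] lookup_sum dgr_def lookup_single when_def sum.If_cases Collect_conj_eq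
        flip: sum.inter_filter)
qed

text \<open>Conjugacy sums of different monomials have disjoint supports, so at \<open>b\<close>
  only the monomial of \<open>b\<close> itself contributes.\<close>

lemma lookup_e_map:
  assumes f: "f \<in> poly_alg_deg n" and b: "b \<in> diagrams n"
  shows "Poly_Mapping.lookup (e_map n \<delta> f) b =
    Poly_Mapping.lookup f (diagram_monomial n b) * Poly_Mapping.lookup (gamma_elt n \<delta> b) b"
proof -
  let ?\<zeta> = "diagram_monomial n b"
  have zero: "Poly_Mapping.lookup (e_mono n \<delta> m) b = 0" if m: "m \<in> Poly_Mapping.keys f" "m \<noteq> ?\<zeta>" for m
  proof -
    have "m \<in> monic_monomials n" using f m(1) by (auto simp: poly_alg_deg_alt)
    then obtain b' where b': "b' \<in> diagrams n" "diagram_monomial n b' = m" by (rule monic_monomial_diagram)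
    have "\<not> (\<sigma> permutes {..<n} \<and> conjd \<sigma> b' = b)" for \<sigma>
      using conjd_diagrams(2)[OF b'(1)] b'(2) m(2) by metis
    then have "{\<sigma>. \<sigma> permutes {..<n} \<and> conjd \<sigma> b' = b} = {}" by blast
    then have "Poly_Mapping.lookup (gamma_elt n \<delta> b') b = 0"
      by (simp only: lookup_gamma_elt[OF b'(1)] card.empty of_nat_0)
    then show ?thesis using e_mono_eq[OF b'(1), of \<delta>] b'(2) by simp
  qed
  have "Poly_Mapping.lookup (e_map n \<delta> f) b =
      (\<Sum>m\<in>Poly_Mapping.keys f. Poly_Mapping.lookup f m * Poly_Mapping.lookup (e_mono n \<delta> m) b)"
    by (simp add: e_map_def lin_ext_def lookup_sum)
  also have "\<dots> = (\<Sum>m\<in>Poly_Mapping.keys f. if m = ?\<zeta> then Poly_Mapping.lookup f ?\<zeta> * Poly_Mapping.lookup (gamma_elt n \<delta> b) b else 0)"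
    by (intro sum.cong refl) (auto simp: zero e_mono_eq[OF b])
  also have "\<dots> = Poly_Mapping.lookup f ?\<zeta> * Poly_Mapping.lookup (gamma_elt n \<delta> b) b"
    by (simp add: in_keys_iff)
  finally show ?thesis .
qed

text \<open>The coefficient of \<open>b\<close> in its own conjugacy sum is the order of its
  stabiliser, which is not zero in characteristic 0. This is what makes \<open>Delta\<close>
  unique.\<close>

lemma e_map_inj:
  assumes "f \<in> poly_alg_deg n" "g \<in> poly_alg_deg n" "e_map n \<delta> f = e_map n \<delta> g" shows "f = g"
proof (rule poly_mapping_eqI)
  fix m show "Poly_Mapping.lookup f m = Poly_Mapping.lookup g m"
  proof (cases "m \<in> monic_monomials n")
    case False
    then have "m \<notin> Poly_Mapping.keys f" "m \<notin> Poly_Mapping.keys g" using assms by (auto simp: poly_alg_deg_alt)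
    then show ?thesis by (simp add: in_keys_iff)
  next
    case True
    then obtain b where b: "b \<in> diagrams n" "diagram_monomial n b = m" by (rule monic_monomial_diagram)
    let ?S = "{\<sigma>. \<sigma> permutes {..<n} \<and> conjd \<sigma> b = b}"
    have "relab id x = x" for x by (cases x) auto
    then have "conjd id b = b" by (simp add: conjd_def)
    then have "id \<in> ?S" by (simp add: permutes_id)
    moreover have "finite ?S" by (rule finite_subset[OF _ finite_permutations[of "{..<n}"]]) auto
    ultimately have "card ?S \<noteq> 0" by (metis card_0_eq empty_iff)
    then have "Poly_Mapping.lookup (gamma_elt n \<delta> b) b \<noteq> 0" using b by (simp add: lookup_gamma_elt)
    then show ?thesis
      using lookup_e_map[OF assms(1) b(1), of \<delta>] lookup_e_map[OF assms(2) b(1), of \<delta>] assms(3) b(2) by simp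
  qed
qed

subsection \<open>The operator \<open>\<Delta>\<close>\<close>

lemma poly_alg_deg_simps:
  "0 \<in> poly_alg_deg n" "f \<in> poly_alg_deg n \<Longrightarrow> g \<in> poly_alg_deg n \<Longrightarrow> f + g \<in> poly_alg_deg n"
  "(\<And>x. x \<in> A \<Longrightarrow> h x \<in> poly_alg_deg n) \<Longrightarrow> sum h A \<in> poly_alg_deg n"
  "f \<in> poly_alg_deg n \<Longrightarrow> cscale c f \<in> poly_alg_deg n"
proof -
  show 0: "0 \<in> poly_alg_deg n" by (simp add: poly_alg_deg_alt)
  show add: "f + g \<in> poly_alg_deg n" if "f \<in> poly_alg_deg n" "g \<in> poly_alg_deg n" for f g
    using that keys_add[of f g] unfolding poly_alg_deg_alt by blast
  show "sum h A \<in> poly_alg_deg n" if "\<And>x. x \<in> A \<Longrightarrow> h x \<in> poly_alg_deg n"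
    using that by (induction A rule: infinite_finite_induct) (simp_all add: 0 add)
  have "Poly_Mapping.keys (cscale c f) \<subseteq> Poly_Mapping.keys f" by (auto simp: in_keys_iff)
  then show "cscale c f \<in> poly_alg_deg n" if "f \<in> poly_alg_deg n" using that unfolding poly_alg_deg_alt by blast
qed

text \<open>The right-hand side of the theorem on one monomial, taken as the candidate for the
  description of \<open>Delta\<close>.\<close>

definition Delta0 :: "complex \<Rightarrow> monomial \<Rightarrow> bpoly" where
  "Delta0 \<delta> \<zeta> = cscale (1 / 2) (tau \<delta> (derivation (derivation (Poly_Mapping.single \<zeta> 1))))"

lemma Delta0_eq: "b \<in> diagrams n \<Longrightarrow> Delta0 \<delta> (diagram_monomial n b) = totalV \<delta> n b"
  by (simp add: Delta0_def tau_second_derivation)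

lemma totalV_deg:
  assumes b: "b \<in> diagrams n" shows "totalV \<delta> n b \<in> poly_alg_deg n"
proof -
  have "actV \<delta> n i j b \<in> poly_alg_deg n" if "j < n" "i < j" for i j
    using diagram_monomial_monic[OF dact_diagrams[OF b, of i j]] that
    by (auto simp: actV_def poly_alg_deg_alt)
  then show ?thesis unfolding totalV_def by (intro poly_alg_deg_simps(3)) auto
qed

lemma e_map_totalV:
  assumes b: "b \<in> diagrams n"
  shows "e_map n \<delta> (totalV \<delta> n b) = brauer_mult n \<delta> (A_elt n) (e_mono n \<delta> (diagram_monomial n b))"
proof -
  have "e_map n \<delta> (totalV \<delta> n b) =
      (\<Sum>j<n. \<Sum>i<j. cscale (if {Lo i, Lo j} \<in> b then \<delta> else 1) (e_mono n \<delta> (diagram_monomial n (dact i j b))))"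
    by (simp add: totalV_def e_map_def lin_ext_sum actV_def)
  also have "\<dots> = (\<Sum>j<n. \<Sum>i<j. cscale (if {Lo i, Lo j} \<in> b then \<delta> else 1) (gamma_elt n \<delta> (dact i j b)))"
    by (intro sum.cong refl arg_cong[where f = "cscale _"] e_mono_eq dact_diagrams b) auto
  finally show ?thesis by (simp add: A_elt_gamma[OF b] e_mono_eq[OF b])
qed

text \<open>The candidate gives the required products by \<open>e_map_totalV\<close>. Any competitor
  has the same images under the injective \<open>e_map\<close> on monomials, and linearity does the
  rest.\<close>

lemma Delta_eq:
  assumes f: "f \<in> poly_alg_deg n" shows "Delta n \<delta> f = lin_ext (Delta0 \<delta>) f"
proof -
  let ?D = "\<lambda>f. if f \<in> poly_alg_deg n then lin_ext (Delta0 \<delta>) f else 0"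
  have D0: "Delta0 \<delta> \<zeta> \<in> poly_alg_deg n"
    "e_map n \<delta> (Delta0 \<delta> \<zeta>) = brauer_mult n \<delta> (A_elt n) (e_mono n \<delta> \<zeta>)"
    if "\<zeta> \<in> monic_monomials n" for \<zeta>
  proof -
    obtain b where "b \<in> diagrams n" "diagram_monomial n b = \<zeta>" using \<open>\<zeta> \<in> monic_monomials n\<close> by (rule monic_monomial_diagram)
    then show "Delta0 \<delta> \<zeta> \<in> poly_alg_deg n"
      "e_map n \<delta> (Delta0 \<delta> \<zeta>) = brauer_mult n \<delta> (A_elt n) (e_mono n \<delta> \<zeta>)"
      using Delta0_eq[of b n \<delta>] totalV_deg[of b n \<delta>] e_map_totalV[of b n \<delta>] by auto
  qed
  have single: "Poly_Mapping.single \<zeta> (1::complex) \<in> poly_alg_deg n" if "\<zeta> \<in> monic_monomials n" for \<zeta>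
    using that by (simp add: poly_alg_deg_alt)
  have "Delta n \<delta> = ?D"
    unfolding Delta_def
  proof (rule the_equality)
    have closed_word: "lin_ext (Delta0 \<delta>) f \<in> poly_alg_deg n" if "f \<in> poly_alg_deg n" for f
      unfolding lin_ext_def using that
      by (intro poly_alg_deg_simps(3,4) D0(1)) (auto simp: poly_alg_deg_alt)
    show "is_Delta n \<delta> ?D \<and> (\<forall>f. f \<notin> poly_alg_deg n \<longrightarrow> ?D f = 0)"
      unfolding is_Delta_def
    proof (intro conjI ballI allI impI)
      fix \<zeta> assume "\<zeta> \<in> monic_monomials n"
      then show "brauer_mult n \<delta> (A_elt n) (e_mono n \<delta> \<zeta>) = e_map n \<delta> (?D (Poly_Mapping.single \<zeta> 1))"
        using single D0(2) by simp
    qed (simp_all add: closed_word lin_ext_add lin_ext_cscale poly_alg_deg_simps)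
    fix D assume D: "is_Delta n \<delta> D \<and> (\<forall>f. f \<notin> poly_alg_deg n \<longrightarrow> D f = 0)"
    have mono: "D (Poly_Mapping.single \<zeta> 1) = Delta0 \<delta> \<zeta>" if \<zeta>: "\<zeta> \<in> monic_monomials n" for \<zeta>
    proof (rule e_map_inj)
      show "D (Poly_Mapping.single \<zeta> 1) \<in> poly_alg_deg n"
        using D single[OF \<zeta>] unfolding is_Delta_def by blast
      show "Delta0 \<delta> \<zeta> \<in> poly_alg_deg n" by (rule D0(1)[OF \<zeta>])
      have "brauer_mult n \<delta> (A_elt n) (e_mono n \<delta> \<zeta>) = e_map n \<delta> (D (Poly_Mapping.single \<zeta> 1))"
        using D \<zeta> unfolding is_Delta_def by blast
      then show "e_map n \<delta> (D (Poly_Mapping.single \<zeta> 1)) = e_map n \<delta> (Delta0 \<delta> \<zeta>)"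
        using D0(2)[OF \<zeta>] by simp
    qed
    show "D = ?D"
    proof
      fix f show "D f = ?D f"
      proof (cases "f \<in> poly_alg_deg n")
        case True
        have "D f = lin_ext (\<lambda>m. D (Poly_Mapping.single m 1)) f"
        proof (rule linear_on_monomials[OF poly_alg_deg_alt _ _ True])
          show "D (f + g) = D f + D g" if "f \<in> poly_alg_deg n" "g \<in> poly_alg_deg n" for f g
            using D that unfolding is_Delta_def by blast
          show "D (Poly_Mapping.single m c) = cscale c (D (Poly_Mapping.single m 1))" if "m \<in> monic_monomials n" for m c
          proof -
            have "D (cscale c (Poly_Mapping.single m 1)) = cscale c (D (Poly_Mapping.single m 1))"
              using D single[OF that] unfolding is_Delta_def by blast
            then show ?thesis by simp
          qed
        qed
        also have "\<dots> = lin_ext (Delta0 \<delta>) f"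
          using True mono by (intro lin_ext_cong) (auto simp: poly_alg_deg_alt)
        finally show ?thesis using True by simp
      qed (use D in simp)
    qed
  qed
  then show ?thesis using f by simp
qed

theorem theorem5p4:
  fixes n :: nat and \<delta> :: complex
  assumes "n \<ge> 2"
  shows "\<forall>f\<in>poly_alg_deg n. Delta n \<delta> f = cscale (1 / 2) (tau \<delta> (derivation (derivation f)))"
proof
  fix f assume f: "f \<in> poly_alg_deg n"
  let ?s = "\<lambda>m. Poly_Mapping.single m (1::complex)"
  have f_sum: "f = (\<Sum>m\<in>Poly_Mapping.keys f. cscale (Poly_Mapping.lookup f m) (?s m))"
    using poly_mapping_expand[of f] by simp
  have dd: "derivation (derivation f) =
      (\<Sum>m\<in>Poly_Mapping.keys f. cscale (Poly_Mapping.lookup f m) (derivation (derivation (?s m))))"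
    by (subst f_sum) (simp only: derivation_simps)
  \<comment> \<open>\<open>tau_eq\<close> is available only on \<open>poly_bar_2\<close>, so each
    term has to be placed there before the sum is taken apart.\<close>
  have bar: "derivation (derivation (?s m)) \<in> poly_bar_2" if "m \<in> Poly_Mapping.keys f" for m
  proof -
    have "m \<in> monic_monomials n" using f that by (auto simp: poly_alg_deg_alt)
    then obtain b where "b \<in> diagrams n" "diagram_monomial n b = m" by (rule monic_monomial_diagram)
    then show ?thesis using tau_second_derivation(2)[of b n] by simp
  qed
  have "cscale c g \<in> poly_bar_2" if "g \<in> poly_bar_2" for c g
  proof -
    have "Poly_Mapping.keys (cscale c g) \<subseteq> Poly_Mapping.keys g" by (auto simp: in_keys_iff)
    then show ?thesis using that unfolding poly_bar_2_alt by blast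
  qed
  then have "derivation (derivation f) \<in> poly_bar_2"
    unfolding dd by (intro poly_bar_2_sum) (simp add: bar)
  then have "tau \<delta> (derivation (derivation f)) =
      (\<Sum>m\<in>Poly_Mapping.keys f. cscale (Poly_Mapping.lookup f m) (lin_ext (tau0 \<delta>) (derivation (derivation (?s m)))))"
    by (simp only: tau_eq dd lin_ext_sum lin_ext_cscale)
  also have "\<dots> = (\<Sum>m\<in>Poly_Mapping.keys f. cscale (Poly_Mapping.lookup f m) (tau \<delta> (derivation (derivation (?s m)))))"
    by (intro sum.cong refl) (simp add: tau_eq bar)
  finally have "cscale (1 / 2) (tau \<delta> (derivation (derivation f))) = lin_ext (Delta0 \<delta>) f"
    by (simp add: lin_ext_def Delta0_def cscale_sum mult.commute)
  then show "Delta n \<delta> f = cscale (1 / 2) (tau \<delta> (derivation (derivation f)))"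
    by (simp add: Delta_eq[OF f])
qed

end
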